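(* Let $\boldsymbol{Z}$ be the $d$-type branching process with immigration at the atoms of a $(\Lambda,K)$-determinantal point process $\Phi$ (defined in the context), and let $\rho$ be the Perron–Frobenius root of the matrix $A$. Suppose that $$\int_{(0,\infty)}e^{-\rho x}K(x,x)\,\Lambda(\mathrm{d}x)<\infty.$$ Then there exists an $\mathbb{R}^d$-valued random variable $\boldsymbol{W}$ such that $$\frac{\boldsymbol{Z}(t)}{e^{\rho t}}\longrightarrow\boldsymbol{W}\quad\text{in distribution as }t\to\infty.$$ Moreover, $$\boldsymbol{W}\stackrel{d}{=}\sum_i\boldsymbol{v}\,W_\times^{(i)}e^{-\rho T_i},$$ where the sum is over the atoms $T_i$ of $\Phi$ in $(0,\infty)$ and the $W_\times^{(i)}$ are i.i.d. copies of $W_\times$, independent of $\Phi$; and for every $\boldsymbol{s}\in[0,\infty)^d$, $$\mathbb{E}\left[\exp(-\langle\boldsymbol{W},\boldsymbol{s}\rangle)\right]=\mathbb{E}\left[\exp\left(-\int_{(0,\infty)}f_{\boldsymbol{s}}(x)\,\Phi(\mathrm{d}x)\right)\right],\qquad f_{\boldsymbol{s}}(x):=-\ln\left(\mathbb{E}\left[\exp\left(-\langle\boldsymbol{v}W_\times,\boldsymbol{s}e^{-\rho x}\rangle\right)\right]\right).$$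
   Context: Notation: $\mathbb{R}_+=[0,\infty)$, $\mathbb{N}_0=\{0,1,2,\dots\}$; $\langle\cdot,\cdot\rangle$ is the usual scalar product on $\mathbb{R}^d$. A point process is a random measure $\Phi=\sum_{i\le\kappa}\delta_{T_i}$ on $\mathbb{R}_+$ with random number $\kappa$ (possibly infinite) of random atoms $T_i\in\mathbb{R}_+$, repeated according to multiplicity. Process without immigration: $\boldsymbol{Z}_\times=(\boldsymbol{Z}_\times(t))_{t\ge0}$, with coordinates $Z_{\times,k}$, is a continuous-time $d$-type Markov branching process with random initial state $\boldsymbol{Z}_\times(0)$ distributed as $\boldsymbol{I}$, an $\mathbb{N}_0^d$-valued random vector. Particles evolve independently; a particle of type $i$ lives an exponential time with rate $1/\mu_i$ (mean $\mu_i>0$), and at death produces offspring distributed as $\boldsymbol{\nu}_i$, an $\mathbb{N}_0^d$-valued random vector whose $j$-th coordinate $(\nu_i)_j$ is the number of offspring of type $j$. Standing assumptions: all $I_i$ and $(\nu_i)_j$ have finite expectation; the total progeny $\|\boldsymbol{\nu}_i\|=\sum_j(\nu_i)_j$ is not a.s. constant for at least one $i$; the matrix $M=(\mathbb{E}[(\nu_i)_j])_{1\le i,j\le d}$ is primitive (some power has strictly positive entries); the $d\times d$ matrix $A$ with $A_{i,j}=\mu_i^{-1}(\mathbb{E}[(\nu_i)_j]-\mathbf{1}_{\{i=j\}})$ is irreducible. Let $\rho$ be the Perron–Frobenius root (largest eigenvalue) of $A$, and let $\boldsymbol{u},\boldsymbol{v}$ be the row vectors (with strictly positive coordinates) such that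 $A\boldsymbol{u}^t=\rho\boldsymbol{u}^t$, $\boldsymbol{v}A=\rho\boldsymbol{v}$, $\sum_iu_iv_i=1$, $\sum_iu_i=1$. It is a classical fact that there is a real-valued random variable $W_\times$ with $e^{-\rho t}\boldsymbol{Z}_\times(t)\to\boldsymbol{v}W_\times$ almost surely as $t\to\infty$; this defines $W_\times$. Process with immigration: $\boldsymbol{Z}(t)=\sum_{i:\,T_i\in(0,t]}\boldsymbol{Z}_\times^{(i)}(t-T_i)$, where the $T_i$ are the atoms of $\Phi$ and $\boldsymbol{Z}_\times^{(i)}$ are i.i.d. copies of $\boldsymbol{Z}_\times$, independent of $\Phi$. Determinantal process: let $\Lambda$ be a locally finite measure on $\mathbb{R}_+$ and $K:\mathbb{R}_+^2\to\mathbb{R}_+$ a symmetric measurable function such that, for every $n$ and $\Lambda^n$-almost all $(x_1,\dots,x_n)$, the matrix $(K(x_i,x_j))_{1\le i,j\le n}$ is non-negative definite, and $\int_B K(x,x)\Lambda(\mathrm{d}x)<\infty$ for each bounded Borel $B\subset\mathbb{R}_+$. A point process $\Phi$ is $(\Lambda,K)$-determinantal if its joint intensities with respect to $\Lambda$ are $\rho_n(x_1,\dots,x_n)=\det(K(x_i,x_j))_{1\le i,j\le n}$, i.e. $\mathbb{E}[\prod_{i=1}^n\Phi(B_i)]=\int_{B_1\times\dots\times B_n}\rho_n\,\mathrm{d}\Lambda^n$ for disjoint Borel $B_1,\dots,B_n$. The law of $\Phi$ is the one determined by the Laplace functional $$\mathbb{E}\left[e^{-\int f\,\mathrm{d}\Phi}\right]=1+\sum_{n\ge1}\frac{(-1)^n}{n!}\int_{\mathbb{R}_+^n}\rho_n(x_1,\dots,x_n)\prod_{i=1}^n(1-e^{-f(x_i)})\Lambda(\mathrm{d}x_1)\cdots\Lambda(\mathrm{d}x_n)$$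 for non-negative measurable $f$ with compact support. *)

theory Defs
  imports "HOL-Probability.Probability"
begin

section \<open>Matrices\<close>

definition primitive_matrix :: "real^'d^'d \<Rightarrow> bool" where
  "primitive_matrix A \<longleftrightarrow> (\<exists>k\<ge>1. \<forall>i j. 0 < (((**) A ^^ k) (mat 1)) $ i $ j)"

text \<open>Not permutation-similar to a block triangular matrix with two non-trivial diagonal blocks;
  every \<open>1 \<times> 1\<close> matrix is irreducible in this convention.\<close>

definition irreducible_matrix :: "real^'d^'d \<Rightarrow> bool" where
  "irreducible_matrix A \<longleftrightarrow>
    \<not> (\<exists>S. S \<noteq> {} \<and> S \<noteq> UNIV \<and> (\<forall>i\<in>S. \<forall>j\<in>-S. A $ i $ j = 0))"

text \<open>The eigenvalue that dominates the real parts of all complex eigenvalues. The matrices of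
  interest are non-negative only off the diagonal, so it need not dominate in modulus.\<close>

definition perron_root :: "real^'d^'d \<Rightarrow> real \<Rightarrow> bool" where
  "perron_root A r \<longleftrightarrow>
    (\<exists>x. x \<noteq> 0 \<and> A *v x = r *s x) \<and>
    (\<forall>(c::complex) z. z \<noteq> 0 \<longrightarrow> (\<chi> i j. complex_of_real (A $ i $ j)) *v z = c *s z \<longrightarrow> Re c \<le> r)"

section \<open>Probability\<close>

text \<open>The library's \<open>indep_var\<close> forces both variables to take values in the same type.\<close>

definition indep_rv ::
  "'a measure \<Rightarrow> 'b measure \<Rightarrow> ('a \<Rightarrow> 'b) \<Rightarrow> 'c measure \<Rightarrow> ('a \<Rightarrow> 'c) \<Rightarrow> bool" where
  "indep_rv M A X B Y \<longleftrightarrow> X \<in> measurable M A \<and> Y \<in> measurable M B \<and>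
    prob_space.indep_set M {X -` S \<inter> space M | S. S \<in> sets A} {Y -` S \<inter> space M | S. S \<in> sets B}"

definition converges_in_distribution ::
  "'a measure \<Rightarrow> ('t \<Rightarrow> 'a \<Rightarrow> 'b::topological_space) \<Rightarrow> ('a \<Rightarrow> 'b) \<Rightarrow> 't filter \<Rightarrow> bool" where
  "converges_in_distribution M X Y F \<longleftrightarrow>
    (\<forall>\<^sub>F t in F. X t \<in> borel_measurable M) \<and> Y \<in> borel_measurable M \<and>
    (\<forall>g :: 'b \<Rightarrow> real. continuous_on UNIV g \<longrightarrow> bounded (range g) \<longrightarrow>
      ((\<lambda>t. \<integral>\<omega>. g (X t \<omega>) \<partial>M) \<longlongrightarrow> (\<integral>\<omega>. g (Y \<omega>) \<partial>M)) F)"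

definition exp_neg :: "ennreal \<Rightarrow> real" where
  "exp_neg x = (if x = \<infinity> then 0 else exp (- enn2real x))"

abbreviation halfline :: "real measure" where
  "halfline \<equiv> restrict_space borel {0..}"

section \<open>Multitype Markov branching processes\<close>

text \<open>Particles are labelled by their ancestral lines, youngest entry first: the entry \<open>(j, k)\<close>
  stands for the \<open>k\<close>-th child of type \<open>j\<close> of the particle labelled by the rest of the list, or, at
  the end of the list, for the \<open>k\<close>-th initial particle of type \<open>j\<close>. The empty list is not a
  particle. A label is realised if every \<open>k\<close> in it lies below the actual number of children
  (or of initial particles) of type \<open>j\<close>.\<close>

type_synonym 'd label = "('d \<times> nat) list"

abbreviation particle_type :: "'d label \<Rightarrow> 'd" where
  "particle_type p \<equiv> fst (hd p)"

primrec realised :: "nat^'d \<Rightarrow> ('d label \<Rightarrow> nat^'d) \<Rightarrow> 'd label \<Rightarrow> bool" where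
  "realised x N [] = True"
| "realised x N (a # p) = (realised x N p \<and> snd a < (if p = [] then x else N p) $ fst a)"

primrec birth_time :: "('d label \<Rightarrow> real) \<Rightarrow> 'd label \<Rightarrow> real" where
  "birth_time L [] = 0"
| "birth_time L (a # p) = birth_time L p + (if p = [] then 0 else L p)"

definition alive_at ::
  "nat^'d \<Rightarrow> ('d label \<Rightarrow> real) \<Rightarrow> ('d label \<Rightarrow> nat^'d) \<Rightarrow> real \<Rightarrow> 'd label set" where
  "alive_at x L N t =
    {p. p \<noteq> [] \<and> realised x N p \<and> birth_time L p \<le> t \<and> t < birth_time L p + L p}"

definition population ::
  "nat^'d \<Rightarrow> ('d label \<Rightarrow> real) \<Rightarrow> ('d label \<Rightarrow> nat^'d) \<Rightarrow> real \<Rightarrow> nat^'d" where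
  "population x L N t = (\<chi> j. card {p \<in> alive_at x L N t. particle_type p = j})"

text \<open>The equation between joint laws says that the initial state, all lifetimes and all offspring
  vectors are independent, with laws \<open>I\<close>, exponential with mean \<open>\<mu> i\<close>, and \<open>\<nu> i\<close>, respectively.\<close>

definition branching_process ::
  "('d::finite \<Rightarrow> real) \<Rightarrow> ('d \<Rightarrow> (nat^'d) pmf) \<Rightarrow> (nat^'d) pmf \<Rightarrow>
    'a measure \<Rightarrow> (real \<Rightarrow> 'a \<Rightarrow> nat^'d) \<Rightarrow> bool" where
  "branching_process \<mu> \<nu> I M Z \<longleftrightarrow> prob_space M \<and>
    (\<forall>t\<ge>0. Z t \<in> measurable M (count_space UNIV)) \<and>
    (\<exists>X L N.
      X \<in> measurable M (count_space UNIV) \<and>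
      (\<forall>p. p \<noteq> [] \<longrightarrow> L p \<in> borel_measurable M \<and> N p \<in> measurable M (count_space UNIV)) \<and>
      distr M (count_space UNIV \<Otimes>\<^sub>M
          (\<Pi>\<^sub>M p\<in>{p. p \<noteq> []}. borel \<Otimes>\<^sub>M count_space UNIV))
        (\<lambda>\<omega>. (X \<omega>, \<lambda>p\<in>{p. p \<noteq> []}. (L p \<omega>, N p \<omega>))) =
      measure_pmf I \<Otimes>\<^sub>M
        (\<Pi>\<^sub>M p\<in>{p. p \<noteq> []}.
          density lborel (exponential_density (1 / \<mu> (particle_type p))) \<Otimes>\<^sub>M
          measure_pmf (\<nu> (particle_type p))) \<and>
      (AE \<omega> in M. \<forall>t\<ge>0. Z t \<omega> = population (X \<omega>) (\<lambda>p. L p \<omega>) (\<lambda>p. N p \<omega>) t))"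

definition mean_offspring :: "('d::finite \<Rightarrow> (nat^'d) pmf) \<Rightarrow> real^'d^'d" where
  "mean_offspring \<nu> = (\<chi> i j. measure_pmf.expectation (\<nu> i) (\<lambda>x. real (x $ j)))"

definition mean_generator :: "('d::finite \<Rightarrow> real) \<Rightarrow> ('d \<Rightarrow> (nat^'d) pmf) \<Rightarrow> real^'d^'d" where
  "mean_generator \<mu> \<nu> = (\<chi> i j. (mean_offspring \<nu> $ i $ j - (if i = j then 1 else 0)) / \<mu> i)"

definition real_vec :: "nat^'d \<Rightarrow> real^'d" where
  "real_vec x = (\<chi> j. real (x $ j))"

abbreviation path_space :: "(real \<Rightarrow> nat^'d) measure" where
  "path_space \<equiv> \<Pi>\<^sub>M t\<in>{0..}. count_space UNIV"

definition sample_path :: "(real \<Rightarrow> 'a \<Rightarrow> nat^'d) \<Rightarrow> 'a \<Rightarrow> real \<Rightarrow> nat^'d" where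
  "sample_path Z \<omega> = (\<lambda>t\<in>{0..}. Z t \<omega>)"

text \<open>Equality of laws on the product path space only fixes the finite-dimensional distributions;
  the first two conditions select a version with regular paths, so that evaluating the copy at
  random times makes sense.\<close>

definition process_copy ::
  "'b measure \<Rightarrow> (real \<Rightarrow> 'b \<Rightarrow> nat^'d::finite) \<Rightarrow> 'a measure \<Rightarrow> (real \<Rightarrow> 'a \<Rightarrow> nat^'d) \<Rightarrow> bool" where
  "process_copy M0 Z0 M Z \<longleftrightarrow>
    (\<lambda>(t, \<omega>). Z t \<omega>) \<in> measurable (halfline \<Otimes>\<^sub>M M) (count_space UNIV) \<and>
    (AE \<omega> in M. \<forall>t\<ge>0. ((\<lambda>s. Z s \<omega>) \<longlongrightarrow> Z t \<omega>) (at_right t)) \<and>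
    distr M path_space (sample_path Z) = distr M0 path_space (sample_path Z0)"

section \<open>Point processes on the half-line\<close>

definition point_process :: "'a measure \<Rightarrow> ('a \<Rightarrow> enat) \<Rightarrow> (nat \<Rightarrow> 'a \<Rightarrow> real) \<Rightarrow> bool" where
  "point_process M \<kappa> T \<longleftrightarrow>
    \<kappa> \<in> measurable M (count_space UNIV) \<and> (\<forall>i. T i \<in> borel_measurable M) \<and>
    (\<forall>\<omega>\<in>space M. \<forall>i. enat i < \<kappa> \<omega> \<longrightarrow> 0 \<le> T i \<omega>)"

text \<open>The sum of the Dirac masses at \<open>T i \<omega>\<close>, \<open>i < \<kappa> \<omega>\<close>.\<close>

definition dirac_sum :: "('a \<Rightarrow> enat) \<Rightarrow> (nat \<Rightarrow> 'a \<Rightarrow> real) \<Rightarrow> 'a \<Rightarrow> real measure" where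
  "dirac_sum \<kappa> T \<omega> = distr (count_space {i. enat i < \<kappa> \<omega>}) halfline (\<lambda>i. T i \<omega>)"

text \<open>The enumerated atoms as one random element; \<open>T i\<close> is irrelevant for \<open>i \<ge> \<kappa>\<close>.\<close>

definition atoms :: "('a \<Rightarrow> enat) \<Rightarrow> (nat \<Rightarrow> 'a \<Rightarrow> real) \<Rightarrow> 'a \<Rightarrow> enat \<times> (nat \<Rightarrow> real)" where
  "atoms \<kappa> T \<omega> = (\<kappa> \<omega>, \<lambda>i. if enat i < \<kappa> \<omega> then T i \<omega> else 0)"

abbreviation atoms_space :: "(enat \<times> (nat \<Rightarrow> real)) measure" where
  "atoms_space \<equiv> count_space UNIV \<Otimes>\<^sub>M (\<Pi>\<^sub>M i\<in>UNIV. borel)"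

text \<open>A sum over an infinite index set is \<open>0\<close> by convention; for a locally finite point process only
  finitely many immigrants arrive up to time \<open>t\<close>.\<close>

definition immigration_process ::
  "('a \<Rightarrow> enat) \<Rightarrow> (nat \<Rightarrow> 'a \<Rightarrow> real) \<Rightarrow> (nat \<Rightarrow> real \<Rightarrow> 'a \<Rightarrow> nat^'d) \<Rightarrow> real \<Rightarrow> 'a \<Rightarrow> real^'d::finite"
where
  "immigration_process \<kappa> T Z t \<omega> =
    (\<Sum>i\<in>{i. enat i < \<kappa> \<omega> \<and> T i \<omega> \<in> {0<..t}}. real_vec (Z i (t - T i \<omega>) \<omega>))"

text \<open>The Leibniz formula for the determinant of the matrix \<open>K (x i) (x j)\<close>, \<open>i, j < n\<close>, whose
  size \<open>n\<close> is not fixed by a type.\<close>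

definition kernel_det :: "(real \<Rightarrow> real \<Rightarrow> real) \<Rightarrow> nat \<Rightarrow> (nat \<Rightarrow> real) \<Rightarrow> real" where
  "kernel_det K n x =
    (\<Sum>\<pi> | \<pi> permutes {..<n}. of_int (sign \<pi>) * (\<Prod>i<n. K (x i) (x (\<pi> i))))"

definition admissible_kernel :: "real measure \<Rightarrow> (real \<Rightarrow> real \<Rightarrow> real) \<Rightarrow> bool" where
  "admissible_kernel \<Lambda> K \<longleftrightarrow>
    sets \<Lambda> = sets halfline \<and> (\<forall>b. emeasure \<Lambda> {0..b} < \<infinity>) \<and>
    (\<lambda>(x, y). K x y) \<in> borel_measurable (halfline \<Otimes>\<^sub>M halfline) \<and>
    (\<forall>x\<ge>0. \<forall>y\<ge>0. 0 \<le> K x y \<and> K x y = K y x) \<and>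
    (\<forall>n. AE x in (\<Pi>\<^sub>M i\<in>{..<n}. \<Lambda>).
      \<forall>c :: nat \<Rightarrow> real. 0 \<le> (\<Sum>i<n. \<Sum>j<n. c i * c j * K (x i) (x j))) \<and>
    (\<forall>B\<in>sets halfline. bounded B \<longrightarrow> (\<integral>\<^sup>+x\<in>B. ennreal (K x x) \<partial>\<Lambda>) < \<infinity>)"

text \<open>For disjoint sets alone, the joint intensities do not exclude multiple atoms, so they do not
  determine the law; hence the Laplace functional is part of the definition.\<close>

definition determinantal_process ::
  "real measure \<Rightarrow> (real \<Rightarrow> real \<Rightarrow> real) \<Rightarrow> 'a measure \<Rightarrow> ('a \<Rightarrow> enat) \<Rightarrow> (nat \<Rightarrow> 'a \<Rightarrow> real) \<Rightarrow> bool"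
where
  "determinantal_process \<Lambda> K M \<kappa> T \<longleftrightarrow> point_process M \<kappa> T \<and>
    (\<forall>n B. B ` {..<n} \<subseteq> sets halfline \<longrightarrow> disjoint_family_on B {..<n} \<longrightarrow>
      (\<integral>\<^sup>+\<omega>. (\<Prod>i<n. emeasure (dirac_sum \<kappa> T \<omega>) (B i)) \<partial>M) =
      (\<integral>\<^sup>+x\<in>Pi\<^sub>E {..<n} B. ennreal (kernel_det K n x) \<partial>(\<Pi>\<^sub>M i\<in>{..<n}. \<Lambda>))) \<and>
    (\<forall>f \<in> borel_measurable halfline. (\<forall>x\<ge>0. 0 \<le> f x) \<longrightarrow> (\<exists>b. \<forall>x>b. f x = 0) \<longrightarrow>
      (\<lambda>n. (- 1) ^ Suc n / fact (Suc n) *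
        (\<integral>x. kernel_det K (Suc n) x * (\<Prod>i<Suc n. 1 - exp (- f (x i)))
          \<partial>(\<Pi>\<^sub>M i\<in>{..<Suc n}. \<Lambda>)))
      sums ((\<integral>\<omega>. exp_neg (\<integral>\<^sup>+x. ennreal (f x) \<partial>dirac_sum \<kappa> T \<omega>) \<partial>M) - 1))"

end

theory Submission
  imports Defs
begin

text \<open>
  Let \<open>W\<^sub>i\<close> be the growth limit of the path of the \<open>i\<close>-th immigrant. Each summand of
  \<open>exp (- \<rho> t) Z(t)\<close> converges almost surely, to \<open>exp (- \<rho> T\<^sub>i) W\<^sub>i v\<close>. Since \<open>u\<close> is an eigenvector
  of the mean generator, \<open>exp (- \<rho> t) Z\<^sub>\<times>(t)\<close> is bounded in mean uniformly in \<open>t\<close>; by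
  independence the mean of the \<open>i\<close>-th summand is therefore at most a constant times that of
  \<open>exp (- \<rho> T\<^sub>i)\<close>, and these sum up to the integral of \<open>exp (- \<rho> x) K(x, x)\<close>, which is finite.
  So the tails of the series are uniformly small in mean and the whole sum converges in
  probability to \<open>\<Sum>\<^sub>i exp (- \<rho> T\<^sub>i) W\<^sub>i v\<close>. The law of this series depends only on the joint law of
  atoms and marks, and its Laplace transform factorises given the atoms. Only the first
  intensity of the determinantal process matters.
\<close>

section \<open>The genealogical tree\<close>

text \<open>No semigroup or generator equation is at hand: the branching process is a count over a
  random infinite set of labels. The bound on its mean comes from resampling one particle in the
  product law of the tree and telescoping over generations. A second obstacle is that the copies
  \<open>Z i\<close> share with \<open>Z0\<close> only a law on a product over uncountably many
  times, where neither convergence in real time nor evaluation at a random time is measurable.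
  Convergence is therefore encoded on the countable grid of rational times and the limit is read off
  at integer times, which carries both from \<open>M0\<close> to \<open>M\<close>; right continuity
  gives back the real times. The age \<open>t - T i\<close> is rounded up to the grid as well, by at
  most 1, which costs the factor exp \<bar>\<rho>\<bar>, whatever the sign of \<rho>. Finally,
  \<open>W\<close> is built from the marks of the given immigrants, on the space \<open>M\<close>
  itself, so that convergence in probability makes sense; marks given from elsewhere are compared
  with it in law only.\<close>

lemma nn_integral_PiM_resample:
  assumes M: "\<And>i. i \<in> I \<Longrightarrow> prob_space (M i)" and i: "i \<in> I"
    and f: "f \<in> borel_measurable (PiM I M)"
  shows "(\<integral>\<^sup>+w. f w \<partial>PiM I M) = (\<integral>\<^sup>+w. (\<integral>\<^sup>+y. f (w(i := y)) \<partial>M i) \<partial>PiM I M)"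
proof -
  interpret Mi: prob_space "M i" using M i .
  interpret P: prob_space "PiM I M" using M by (rule prob_space_PiM)
  interpret pair_sigma_finite "M i" "PiM I M" ..
  have ins: "insert i I = I" using i by auto
  have upd: "(\<lambda>(y, w). w(i := y)) \<in> measurable (M i \<Otimes>\<^sub>M PiM I M) (PiM I M)"
    using measurable_fun_upd[of I I i "\<lambda>z. snd z" "M i \<Otimes>\<^sub>M PiM I M" M "\<lambda>z. fst z"] ins
    by (simp add: split_beta')
  \<comment> \<open>Overwriting coordinate \<open>i\<close> by an independent draw from
    \<open>M i\<close> preserves the product measure, also over an infinite index set. The draw
    becomes the inner variable, so all other coordinates are held fixed.\<close>
  have "(\<integral>\<^sup>+w. f w \<partial>PiM I M) = (\<integral>\<^sup>+w. f w \<partial>distr (M i \<Otimes>\<^sub>M PiM I M) (PiM I M) (\<lambda>(y, w). w(i := y)))"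
    using distr_pair_PiM_eq_PiM[of I M i] M i ins by simp
  also have "\<dots> = (\<integral>\<^sup>+z. f (case z of (y, w) \<Rightarrow> w(i := y)) \<partial>(M i \<Otimes>\<^sub>M PiM I M))"
    by (rule nn_integral_distr[OF upd]) (simp add: f)
  also have "\<dots> = (\<integral>\<^sup>+w. (\<integral>\<^sup>+y. f (w(i := y)) \<partial>M i) \<partial>PiM I M)"
    using measurable_compose[OF upd f] by (subst nn_integral_snd[symmetric]) auto
  finally show ?thesis .
qed

lemma borel_measurable_nn_integral_count_space:
  fixes f :: "'i::countable \<Rightarrow> 'a \<Rightarrow> ennreal"
  assumes f: "\<And>i. f i \<in> borel_measurable M"
  shows "(\<lambda>x. \<integral>\<^sup>+i. f i x \<partial>count_space UNIV) \<in> borel_measurable M"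
proof -
  interpret sigma_finite_measure "count_space (UNIV :: 'i set)"
    by (rule sigma_finite_measure_count_space_countable) simp
  have "(\<lambda>z. f (snd z) (fst z)) \<in> borel_measurable (M \<Otimes>\<^sub>M count_space UNIV)"
    by (rule measurable_compose_countable[of "\<lambda>i z. f i (fst z)" _ _ snd])
      (auto intro: measurable_compose[OF measurable_fst] f)
  then show ?thesis
    by (intro borel_measurable_nn_integral) (simp add: split_beta')
qed

text \<open>Only proper ancestors matter, and these are strictly shorter labels. So overwriting the
  entry of \<open>p\<close> changes neither whether \<open>p\<close> is realised nor its birth time,
  only what happens after its birth.\<close>

lemma realised_cong:
  assumes "\<And>q. q \<noteq> [] \<Longrightarrow> length q < length p \<Longrightarrow> N q = N' q"
  shows "realised x N p = realised x N' p"
  using assms by (induction p) auto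

lemma birth_time_cong:
  assumes "\<And>q. q \<noteq> [] \<Longrightarrow> length q < length p \<Longrightarrow> L q = L' q"
  shows "birth_time L p = birth_time L' p"
  using assms by (induction p) auto

text \<open>A lifetime \<open>x\<close> is compared with the time \<open>a\<close> left to the
  horizon. Survival contributes exp (- \<rho> a) exp (- l a) = exp (- c a); death at
  \<open>x\<close> contributes c exp (- c x) on [0, a], with integral 1 - exp (- c a). The ratio c /
  l will be the mean weight of the children relative to the parent; c = 0, a parent without
  children, is allowed.\<close>

lemma nn_integral_exponential_killed:
  fixes l \<rho> c a :: real
  assumes l: "0 < l" and c: "c = l + \<rho>" "0 \<le> c" and a: "0 \<le> a"
  shows "(\<integral>\<^sup>+x. ennreal (if a < x then exp (- \<rho> * a) else exp (- \<rho> * x) * (c / l))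
    \<partial>density lborel (exponential_density l)) = 1"
proof -
  have 1: "(\<integral>\<^sup>+x. ennreal (c * exp (- c * x)) * indicator {0..a} x \<partial>lborel) =
      ennreal (- exp (- c * a) - (- exp (- c * 0)))"
    using a c(2)
    by (intro nn_integral_FTC_Icc[where F="\<lambda>x. - exp (- c * x)"]) (auto intro!: derivative_eq_intros)
  have 2: "(\<integral>\<^sup>+x. ennreal (l * exp (- l * x)) * indicator {a..} x \<partial>lborel) =
      ennreal (0 - (- exp (- l * a)))"
  proof (intro nn_integral_FTC_atLeast[where F="\<lambda>x. - exp (- l * x)"])
    have "((\<lambda>x. exp (- l * x)) \<longlongrightarrow> 0) at_top"
      by (intro filterlim_compose[OF exp_at_bot]
          filterlim_tendsto_neg_mult_at_bot[OF tendsto_const] filterlim_ident) (use l in auto)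
    from tendsto_minus[OF this] show "((\<lambda>x. - exp (- l * x)) \<longlongrightarrow> 0) at_top" by simp
  qed (use l in \<open>auto intro!: derivative_eq_intros\<close>)
  have "(\<integral>\<^sup>+x. ennreal (if a < x then exp (- \<rho> * a) else exp (- \<rho> * x) * (c / l))
      \<partial>density lborel (exponential_density l)) =
    (\<integral>\<^sup>+x. ennreal (exponential_density l x) *
       ennreal (if a < x then exp (- \<rho> * a) else exp (- \<rho> * x) * (c / l)) \<partial>lborel)"
    by (rule nn_integral_density) auto
  also have "\<dots> = (\<integral>\<^sup>+x. ennreal (c * exp (- c * x)) * indicator {0..a} x +
      ennreal (exp (- \<rho> * a)) * (ennreal (l * exp (- l * x)) * indicator {a..} x) \<partial>lborel)"
  proof (rule nn_integral_cong_AE)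
    \<comment> \<open>Both intervals on the right-hand side are closed, so the integrands differ at
      \<open>x = a\<close>.\<close>
    have "AE x in lborel. x \<noteq> a" by (rule AE_lborel_singleton)
    then show "AE x in lborel. ennreal (exponential_density l x) *
       ennreal (if a < x then exp (- \<rho> * a) else exp (- \<rho> * x) * (c / l)) =
      ennreal (c * exp (- c * x)) * indicator {0..a} x +
      ennreal (exp (- \<rho> * a)) * (ennreal (l * exp (- l * x)) * indicator {a..} x)"
    proof eventually_elim
      case (elim x)
      have "l * exp (- l * x) * (exp (- \<rho> * x) * (c / l)) = c * (exp (- l * x) * exp (- \<rho> * x))"
        using l by (simp add: field_simps)
      also have "exp (- l * x) * exp (- \<rho> * x) = exp (- c * x)"
        by (simp add: mult_exp_exp c(1) algebra_simps)
      finally have "l * exp (- x * l) * (exp (- \<rho> * x) * (c / l)) = c * exp (- c * x)"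
        by (simp add: mult.commute)
      then show ?case
        using l c(2) a elim
        by (auto simp: exponential_density_def ennreal_mult'[symmetric] ennreal_mult[symmetric] mult_ac
            split: split_indicator)
    qed
  qed
  also have "\<dots> = ennreal (1 - exp (- c * a)) + ennreal (exp (- \<rho> * a)) * ennreal (exp (- l * a))"
    by (subst nn_integral_add) (auto simp: nn_integral_cmult 1[simplified] 2[simplified])
  also have "\<dots> = ennreal (1 - exp (- c * a) + exp (- \<rho> * a) * exp (- l * a))"
    using c(2) a by (subst ennreal_plus) (auto simp: ennreal_mult)
  also have "exp (- \<rho> * a) * exp (- l * a) = exp (- c * a)"
    by (simp add: c mult_exp_exp algebra_simps)
  finally show ?thesis by simp
qed

text \<open>A child is labelled by its type and a number below the offspring count of that type, so
  the pairs of type \<open>j\<close> that count are exactly \<open>N $ j\<close> many. With the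
  initial state in place of \<open>N\<close> the same sum counts the initial particles.\<close>

lemma nn_integral_children:
  fixes N :: "nat^'d::finite" and u :: "'d \<Rightarrow> real"
  assumes u: "\<And>j. 0 \<le> u j"
  shows "(\<integral>\<^sup>+a. ennreal (if snd a < N $ fst a then u (fst a) else 0) \<partial>count_space UNIV) =
    ennreal (\<Sum>j\<in>UNIV. real (N $ j) * u j)"
proof -
  have "(\<integral>\<^sup>+a. ennreal (if snd a < N $ fst a then u (fst a) else 0) \<partial>count_space UNIV) =
     (\<integral>\<^sup>+j. \<integral>\<^sup>+k. ennreal (if k < N $ j then u j else 0) \<partial>count_space UNIV \<partial>count_space UNIV)"
    by (subst nn_integral_fst_count_space[symmetric]) (simp only: fst_conv snd_conv)
  also have "\<dots> = (\<integral>\<^sup>+j. ennreal (real (N $ j) * u j) \<partial>count_space UNIV)"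
  proof (intro nn_integral_cong)
    fix j
    have "(\<integral>\<^sup>+k. ennreal (if k < N $ j then u j else 0) \<partial>count_space UNIV) =
      (\<integral>\<^sup>+k. ennreal (u j) * indicator {..<N $ j} k \<partial>count_space UNIV)"
      by (intro nn_integral_cong) auto
    also have "\<dots> = ennreal (u j) * emeasure (count_space UNIV) {..<N $ j}"
      by (subst nn_integral_cmult_indicator) auto
    also have "\<dots> = ennreal (real (N $ j) * u j)"
      by (simp add: ennreal_mult'' u ennreal_of_nat_eq_real_of_nat mult.commute)
    finally show "(\<integral>\<^sup>+k. ennreal (if k < N $ j then u j else 0) \<partial>count_space UNIV) =
      ennreal (real (N $ j) * u j)" .
  qed
  also have "\<dots> = ennreal (\<Sum>j\<in>UNIV. real (N $ j) * u j)"
    by (simp add: nn_integral_count_space_finite sum_ennreal u)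
  finally show ?thesis .
qed

lemma label_measurable:
  fixes Q :: "('d::finite) label \<Rightarrow> (real \<times> (nat^'d)) measure"
  assumes Q: "\<And>p. sets (Q p) = sets (borel \<Otimes>\<^sub>M count_space UNIV)"
  defines "P \<equiv> \<Pi>\<^sub>M p\<in>{p. p \<noteq> []}. Q p"
  shows "p \<noteq> [] \<Longrightarrow> (\<lambda>w. fst (w p)) \<in> borel_measurable P"
    and "p \<noteq> [] \<Longrightarrow> (\<lambda>w. snd (w p)) \<in> measurable P (count_space UNIV)"
    and "Measurable.pred P (\<lambda>w. realised x (\<lambda>q. snd (w q)) p)"
    and "(\<lambda>w. birth_time (\<lambda>q. fst (w q)) p) \<in> borel_measurable P"
proof -
  have comp: "(\<lambda>w. w p) \<in> measurable P (borel \<Otimes>\<^sub>M count_space UNIV)" if "p \<noteq> []" for p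
    using that measurable_component_singleton[of p "{p. p \<noteq> []}" Q] Q[of p]
    by (simp add: P_def cong: measurable_cong_sets)
  show L: "(\<lambda>w. fst (w p)) \<in> borel_measurable P" if "p \<noteq> []" for p
    using measurable_compose[OF comp[OF that] measurable_fst] .
  show N: "(\<lambda>w. snd (w p)) \<in> measurable P (count_space UNIV)" if "p \<noteq> []" for p
    using measurable_compose[OF comp[OF that] measurable_snd] .
  show "Measurable.pred P (\<lambda>w. realised x (\<lambda>q. snd (w q)) p)"
  proof (induction p)
    case (Cons a p)
    have "Measurable.pred P (\<lambda>w. snd a < (if p = [] then x else snd (w p)) $ fst a)"
    proof (cases "p = []")
      case False
      then show ?thesis
        using measurable_compose[OF N[OF False], of "\<lambda>n. snd a < n $ fst a" "count_space UNIV"] by simp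
    qed simp
    with Cons show ?case by simp
  qed simp
  show "(\<lambda>w. birth_time (\<lambda>q. fst (w q)) p) \<in> borel_measurable P"
  proof (induction p)
    case (Cons a p)
    have "(\<lambda>w. if p = [] then 0 else fst (w p)) \<in> borel_measurable P"
      using L[of p] by (cases "p = []") auto
    with Cons show ?case by simp
  qed simp
qed

section \<open>The mean of the branching process\<close>

text \<open>A label of the next generation is a parent with one entry put in front, uniquely.
  Regrouping by parents allows a statement on one particle and its children to be summed over a
  generation.\<close>

lemma nn_integral_lists_Suc:
  fixes F :: "'a list \<Rightarrow> ennreal"
  shows "(\<integral>\<^sup>+q. (if length q = Suc n then F q else 0) \<partial>count_space UNIV) =
    (\<integral>\<^sup>+p. (if length p = n then \<integral>\<^sup>+a. F (a # p) \<partial>count_space UNIV else 0) \<partial>count_space UNIV)"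
proof -
  let ?c = "\<lambda>z::'a list \<times> 'a. snd z # fst z"
  have bij: "bij_betw ?c UNIV (range ?c)"
    by (intro inj_on_imp_bij_betw) (auto simp: inj_on_def)
  have "(\<integral>\<^sup>+q. (if length q = Suc n then F q else 0) \<partial>count_space UNIV) =
      (\<integral>\<^sup>+q. (if length q = Suc n then F q else 0) \<partial>count_space (range ?c))"
    by (rule nn_integral_count_space_eq) (auto simp: length_Suc_conv image_iff)
  also have "\<dots> = (\<integral>\<^sup>+z. (if length (?c z) = Suc n then F (?c z) else 0) \<partial>count_space UNIV)"
    by (rule nn_integral_bij_count_space[OF bij, symmetric])
  also have "\<dots> = (\<integral>\<^sup>+p. \<integral>\<^sup>+a. (if length p = n then F (a # p) else 0) \<partial>count_space UNIV \<partial>count_space UNIV)"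
    by (subst nn_integral_fst_count_space[symmetric]) (simp only: fst_conv snd_conv list.size add_Suc_right add_0_right nat.inject)
  also have "\<dots> = (\<integral>\<^sup>+p. (if length p = n then \<integral>\<^sup>+a. F (a # p) \<partial>count_space UNIV else 0) \<partial>count_space UNIV)"
    by (intro nn_integral_cong) auto
  finally show ?thesis .
qed

text \<open>For a positive right eigenvector \<open>u\<close> of the mean generator, exp (- \<rho>
  t) \<langle>Z(t), u\<rangle> is the classical martingale of the branching process. The locale
  gathers the data behind it; what is derived is the upper bound on its mean.\<close>

locale mean_eigenvector =
  fixes \<mu> :: "'d::finite \<Rightarrow> real" and \<nu> :: "'d \<Rightarrow> (nat^'d) pmf" and \<rho> :: real and u :: "real^'d"
  assumes \<mu>_pos: "\<And>i. 0 < \<mu> i"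
    and u_pos: "\<And>i. 0 < u $ i"
    and offspring_integrable: "\<And>i j. integrable (measure_pmf (\<nu> i)) (\<lambda>x. real (x $ j))"
    and u_eigen: "mean_generator \<mu> \<nu> *v u = \<rho> *s u"
begin

lemma u_nonneg: "0 \<le> u $ i"
  using u_pos[of i] by simp

text \<open>The eigenvector equation with the rate and the identity matrix cleared. The factor
  \<open>1 + \<rho> * \<mu> i\<close> is the ratio c / l of the exponential integral above, for l =
  1 / \<open>\<mu> i\<close> and c = l + \<rho>.\<close>

lemma mean_offspring_eigen:
  "(\<Sum>j\<in>UNIV. mean_offspring \<nu> $ i $ j * u $ j) = (1 + \<rho> * \<mu> i) * u $ i"
proof -
  have "\<rho> * u $ i = (mean_generator \<mu> \<nu> *v u) $ i"
    by (simp add: u_eigen)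
  also have "\<dots> = (\<Sum>j\<in>UNIV. (mean_offspring \<nu> $ i $ j * u $ j - (if i = j then u $ j else 0)) / \<mu> i)"
    by (auto simp: matrix_vector_mult_def mean_generator_def field_simps intro!: sum.cong)
  also have "\<dots> = ((\<Sum>j\<in>UNIV. mean_offspring \<nu> $ i $ j * u $ j) - u $ i) / \<mu> i"
    by (simp add: sum_divide_distrib[symmetric] sum_subtractf)
  finally show ?thesis
    using \<mu>_pos[of i] by (simp add: field_simps)
qed

lemma nn_integral_offspring:
  "(\<integral>\<^sup>+n. ennreal (\<Sum>j\<in>UNIV. real (n $ j) * u $ j) \<partial>measure_pmf (\<nu> i)) = ennreal ((1 + \<rho> * \<mu> i) * u $ i)"
proof -
  have "(\<integral>\<^sup>+n. ennreal (\<Sum>j\<in>UNIV. real (n $ j) * u $ j) \<partial>measure_pmf (\<nu> i)) =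
      ennreal (measure_pmf.expectation (\<nu> i) (\<lambda>n. \<Sum>j\<in>UNIV. real (n $ j) * u $ j))"
    by (intro nn_integral_eq_integral)
      (auto intro!: offspring_integrable sum_nonneg mult_nonneg_nonneg simp: u_nonneg)
  also have "measure_pmf.expectation (\<nu> i) (\<lambda>n. \<Sum>j\<in>UNIV. real (n $ j) * u $ j) =
      (\<Sum>j\<in>UNIV. mean_offspring \<nu> $ i $ j * u $ j)"
    by (subst Bochner_Integration.integral_sum)
      (auto intro!: offspring_integrable simp: mean_offspring_def)
  finally show ?thesis by (simp add: mean_offspring_eigen)
qed

text \<open>Non-negative offspring means keep \<rho> from falling below - 1 /
  \<open>\<mu> i\<close>, so that the rate c = 1 / \<open>\<mu> i\<close> + \<rho> of the
  exponential integral is admissible even for negative \<rho>.\<close>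

lemma mean_offspring_factor_nonneg: "0 \<le> 1 + \<rho> * \<mu> i"
proof -
  have "0 \<le> (\<Sum>j\<in>UNIV. mean_offspring \<nu> $ i $ j * u $ j)"
    by (intro sum_nonneg mult_nonneg_nonneg u_nonneg) (simp add: mean_offspring_def)
  then show ?thesis
    using u_pos[of i] by (simp add: mean_offspring_eigen zero_le_mult_iff)
qed

definition particle_law :: "'d \<Rightarrow> (real \<times> (nat^'d)) measure" where
  "particle_law i = density lborel (exponential_density (1 / \<mu> i)) \<Otimes>\<^sub>M measure_pmf (\<nu> i)"

definition tree_law :: "('d label \<Rightarrow> real \<times> (nat^'d)) measure" where
  "tree_law = (\<Pi>\<^sub>M p\<in>{p. p \<noteq> []}. particle_law (particle_type p))"

lemma sets_particle_law: "sets (particle_law i) = sets (borel \<Otimes>\<^sub>M count_space UNIV)"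
  unfolding particle_law_def by (intro sets_pair_measure_cong) auto

lemma prob_space_particle_law: "prob_space (particle_law i)"
proof -
  interpret E: prob_space "density lborel (exponential_density (1 / \<mu> i))"
    using \<mu>_pos[of i] by (intro prob_space_exponential_density) simp
  interpret pair_prob_space "density lborel (exponential_density (1 / \<mu> i))" "measure_pmf (\<nu> i)" ..
  show ?thesis unfolding particle_law_def by unfold_locales
qed

lemma prob_space_tree_law: "prob_space tree_law"
  unfolding tree_law_def by (intro prob_space_PiM prob_space_particle_law)

lemma tree_measurable [measurable]:
  "p \<noteq> [] \<Longrightarrow> (\<lambda>w. fst (w p)) \<in> borel_measurable tree_law"
  "p \<noteq> [] \<Longrightarrow> (\<lambda>w. snd (w p)) \<in> measurable tree_law (count_space UNIV)"
  "Measurable.pred tree_law (\<lambda>w. realised x (\<lambda>q. snd (w q)) p)"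
  "(\<lambda>w. birth_time (\<lambda>q. fst (w q)) p) \<in> borel_measurable tree_law"
  unfolding tree_law_def by (intro label_measurable sets_particle_law; simp)+

text \<open>Weights lie in \<open>ennreal\<close>, so sums over the infinite tree need no finiteness
  beforehand. A survivor is discounted up to \<open>t\<close>, a newborn particle in
  \<open>born\<close> only up to its birth; the integral over the lifetime balances the two.\<close>

definition living :: "nat^'d \<Rightarrow> real \<Rightarrow> 'd label \<Rightarrow> ('d label \<Rightarrow> real \<times> (nat^'d)) \<Rightarrow> ennreal" where
  "living x t p w = (if realised x (\<lambda>q. snd (w q)) p \<and> birth_time (\<lambda>q. fst (w q)) p \<le> t \<and>
      t < birth_time (\<lambda>q. fst (w q)) p + fst (w p)
    then ennreal (exp (- \<rho> * t) * u $ particle_type p) else 0)"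

definition born :: "nat^'d \<Rightarrow> real \<Rightarrow> 'd label \<Rightarrow> ('d label \<Rightarrow> real \<times> (nat^'d)) \<Rightarrow> ennreal" where
  "born x t p w = (if realised x (\<lambda>q. snd (w q)) p \<and> birth_time (\<lambda>q. fst (w q)) p \<le> t
    then ennreal (exp (- \<rho> * birth_time (\<lambda>q. fst (w q)) p) * u $ particle_type p) else 0)"

lemma living_measurable [measurable]: "p \<noteq> [] \<Longrightarrow> living x t p \<in> borel_measurable tree_law"
  unfolding living_def by measurable

lemma born_measurable [measurable]: "born x t p \<in> borel_measurable tree_law"
  unfolding born_def by measurable

text \<open>Discounting the weight \<open>u\<close> of a particle at rate \<open>\<rho>\<close> from its birth on, a particle is worth on
  average as much as what it leaves: itself if it survives time \<open>t\<close>, and its children otherwise.\<close>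

lemma born_step:
  assumes p: "p \<noteq> []"
  shows "(\<integral>\<^sup>+w. living x t p w + (\<integral>\<^sup>+a. born x t (a # p) w \<partial>count_space UNIV) \<partial>tree_law) =
    (\<integral>\<^sup>+w. born x t p w \<partial>tree_law)"
proof -
  define i where "i = particle_type p"
  have "(\<integral>\<^sup>+w. living x t p w + (\<integral>\<^sup>+a. born x t (a # p) w \<partial>count_space UNIV) \<partial>tree_law) =
    (\<integral>\<^sup>+w. (\<integral>\<^sup>+y. living x t p (w(p := y)) + (\<integral>\<^sup>+a. born x t (a # p) (w(p := y)) \<partial>count_space UNIV)
      \<partial>particle_law i) \<partial>tree_law)"
    unfolding i_def tree_law_def
  proof (intro nn_integral_PiM_resample prob_space_particle_law)
    show "(\<lambda>w. living x t p w + (\<integral>\<^sup>+a. born x t (a # p) w \<partial>count_space UNIV))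
      \<in> borel_measurable (\<Pi>\<^sub>M p\<in>{p. p \<noteq> []}. particle_law (particle_type p))"
      unfolding tree_law_def[symmetric] using p
      by (intro borel_measurable_add living_measurable borel_measurable_nn_integral_count_space
          born_measurable)
  qed (use p in simp)
  also have "\<dots> = (\<integral>\<^sup>+w. born x t p w \<partial>tree_law)"
  proof (intro nn_integral_cong)
    fix w
    define R b where "R = realised x (\<lambda>q. snd (w q)) p" and "b = birth_time (\<lambda>q. fst (w q)) p"
    define E where "E = density lborel (exponential_density (1 / \<mu> i))"
    \<comment> \<open>Per unit of discounted weight at birth, what a particle with lifetime
      \<open>l\<close> leaves behind on average. The time left is \<open>t - b\<close>, and the
      ratio is the mean offspring factor in the form in which the exponential integral expects
      it.\<close>
    define g where "g = (\<lambda>l. ennreal (if t - b < l then exp (- \<rho> * (t - b))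
      else exp (- \<rho> * l) * ((1 / \<mu> i + \<rho>) / (1 / \<mu> i))))"
    have R: "realised x (\<lambda>q. snd ((w(p := y)) q)) p = R"
      and b: "birth_time (\<lambda>q. fst ((w(p := y)) q)) p = b" for y
      unfolding R_def b_def by (auto intro!: realised_cong birth_time_cong)
    have leaves: "living x t p (w(p := (l, n))) + (\<integral>\<^sup>+a. born x t (a # p) (w(p := (l, n))) \<partial>count_space UNIV)
      = (if R \<and> b \<le> t \<and> t - b < l then ennreal (exp (- \<rho> * t) * u $ i) else 0) +
        (if R \<and> l \<le> t - b then ennreal (exp (- \<rho> * (b + l))) *
          ennreal (\<Sum>j\<in>UNIV. real (n $ j) * u $ j) else 0)" for l n
    proof -
      have "(\<integral>\<^sup>+a. born x t (a # p) (w(p := (l, n))) \<partial>count_space UNIV) =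
        (\<integral>\<^sup>+a. (if R \<and> l \<le> t - b then ennreal (exp (- \<rho> * (b + l))) else 0) *
          ennreal (if snd a < n $ fst a then u $ fst a else 0) \<partial>count_space UNIV)"
        using p R b by (intro nn_integral_cong) (auto simp: born_def ennreal_mult u_nonneg algebra_simps)
      also have "\<dots> = (if R \<and> l \<le> t - b then ennreal (exp (- \<rho> * (b + l))) else 0) *
          ennreal (\<Sum>j\<in>UNIV. real (n $ j) * u $ j)"
        by (subst nn_integral_cmult) (auto simp: nn_integral_children u_nonneg)
      finally have "(\<integral>\<^sup>+a. born x t (a # p) (w(p := (l, n))) \<partial>count_space UNIV) =
        (if R \<and> l \<le> t - b then ennreal (exp (- \<rho> * (b + l))) *
          ennreal (\<Sum>j\<in>UNIV. real (n $ j) * u $ j) else 0)"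
        by auto
      moreover have "living x t p (w(p := (l, n))) =
          (if R \<and> b \<le> t \<and> t - b < l then ennreal (exp (- \<rho> * t) * u $ i) else 0)"
        unfolding living_def R b i_def fun_upd_same by (auto simp: algebra_simps)
      ultimately show ?thesis by simp
    qed
    interpret E: prob_space E
      unfolding E_def using \<mu>_pos[of i] by (intro prob_space_exponential_density) simp
    interpret pair_prob_space E "measure_pmf (\<nu> i)" ..
    have sE: "sets E = sets borel" by (simp add: E_def)
    \<comment> \<open>If \<open>p\<close> is born after \<open>t\<close>, a negative lifetime could
      still produce children before \<open>t\<close>; this null event has to be excluded.\<close>
    have pos: "AE l in E. 0 \<le> l"
      unfolding E_def by (auto simp: AE_density exponential_density_def)
    have "(\<integral>\<^sup>+y. living x t p (w(p := y)) + (\<integral>\<^sup>+a. born x t (a # p) (w(p := y)) \<partial>count_space UNIV)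
      \<partial>particle_law i) =
      (\<integral>\<^sup>+y. (if R \<and> b \<le> t \<and> t - b < fst y then ennreal (exp (- \<rho> * t) * u $ i) else 0) +
        (if R \<and> fst y \<le> t - b then ennreal (exp (- \<rho> * (b + fst y))) *
          ennreal (\<Sum>j\<in>UNIV. real (snd y $ j) * u $ j) else 0) \<partial>(E \<Otimes>\<^sub>M measure_pmf (\<nu> i)))"
      unfolding particle_law_def E_def[symmetric]
      by (intro nn_integral_cong) (subst leaves[symmetric], simp)
    also have "\<dots> = (\<integral>\<^sup>+l. \<integral>\<^sup>+n. (if R \<and> b \<le> t \<and> t - b < l then ennreal (exp (- \<rho> * t) * u $ i) else 0) +
        (if R \<and> l \<le> t - b then ennreal (exp (- \<rho> * (b + l))) *
          ennreal (\<Sum>j\<in>UNIV. real (n $ j) * u $ j) else 0) \<partial>measure_pmf (\<nu> i) \<partial>E)"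
    proof -
      have [measurable]: "(\<lambda>y. fst y) \<in> borel_measurable (E \<Otimes>\<^sub>M measure_pmf (\<nu> i))"
        using measurable_fst[of E "measure_pmf (\<nu> i)"] sE by (simp cong: measurable_cong_sets)
      have "(\<lambda>y. (if R \<and> b \<le> t \<and> t - b < fst y then ennreal (exp (- \<rho> * t) * u $ i) else 0) +
        (if R \<and> fst y \<le> t - b then ennreal (exp (- \<rho> * (b + fst y))) *
          ennreal (\<Sum>j\<in>UNIV. real (snd y $ j) * u $ j) else 0))
        \<in> borel_measurable (E \<Otimes>\<^sub>M measure_pmf (\<nu> i))"
        by measurable
      from measure_pmf.nn_integral_fst[OF this, symmetric] show ?thesis by (simp only: fst_conv snd_conv)
    qed
    also have "\<dots> = (\<integral>\<^sup>+l. (if R \<and> b \<le> t then ennreal (exp (- \<rho> * b) * u $ i) else 0) * g l \<partial>E)"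
      using pos
    proof (intro nn_integral_cong_AE, eventually_elim)
      case (elim l)
      have c: "(1 / \<mu> i + \<rho>) / (1 / \<mu> i) = 1 + \<rho> * \<mu> i"
        using \<mu>_pos[of i] by (simp add: field_simps)
      \<comment> \<open>In either case, survival here and death in \<open>split\<close>, the
        discounted weight of \<open>p\<close> at birth factors out, and what remains is the matching
        branch of \<open>g\<close>.\<close>
      have survive: "ennreal (exp (- \<rho> * t) * u $ i) =
          ennreal (exp (- \<rho> * b) * u $ i) * ennreal (exp (- \<rho> * (t - b)))"
        by (subst ennreal_mult[symmetric])
          (simp_all add: u_nonneg mult.assoc mult.left_commute mult_exp_exp algebra_simps)
      have split: "ennreal (exp (- \<rho> * (b + l))) * ennreal ((1 + \<rho> * \<mu> i) * u $ i) =
          ennreal (exp (- \<rho> * b) * u $ i) * ennreal (exp (- \<rho> * l) * (1 + \<rho> * \<mu> i))"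
      proof -
        have "exp (- \<rho> * (b + l)) = exp (- \<rho> * b) * exp (- \<rho> * l)"
          by (simp add: mult_exp_exp algebra_simps)
        then show ?thesis
          using mean_offspring_factor_nonneg[of i]
          by (subst (1 2) ennreal_mult[symmetric]) (simp_all add: u_nonneg mult_ac)
      qed
      show ?case
      proof (cases "R \<and> b \<le> t")
        case True
        then show ?thesis
        proof (cases "t - b < l")
          case True
          with \<open>R \<and> b \<le> t\<close> show ?thesis
            unfolding g_def using survive by (simp del: mult_minus_left)
        next
          case False
          with \<open>R \<and> b \<le> t\<close> show ?thesis
            unfolding g_def c using split
            by (simp add: nn_integral_cmult nn_integral_offspring del: mult_minus_left)
        qed
      qed (use elim in auto)
    qed
    also have "\<dots> = (if R \<and> b \<le> t then ennreal (exp (- \<rho> * b) * u $ i) else 0) * (\<integral>\<^sup>+l. g l \<partial>E)"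
      by (intro nn_integral_cmult) (simp add: g_def E_def)
    also have "\<dots> = born x t p w"
    proof (cases "b \<le> t")
      case True
      have "1 / \<mu> i + \<rho> = (1 + \<rho> * \<mu> i) / \<mu> i"
        using \<mu>_pos[of i] by (simp add: field_simps)
      then have "0 \<le> 1 / \<mu> i + \<rho>"
        using mean_offspring_factor_nonneg[of i] \<mu>_pos[of i] by simp
      then have "(\<integral>\<^sup>+l. g l \<partial>E) = 1"
        unfolding g_def E_def using \<mu>_pos[of i] True
        by (intro nn_integral_exponential_killed) auto
      then show ?thesis by (simp add: born_def R_def b_def i_def)
    qed (simp add: born_def R_def b_def)
    finally show "(\<integral>\<^sup>+y. living x t p (w(p := y)) + (\<integral>\<^sup>+a. born x t (a # p) (w(p := y)) \<partial>count_space UNIV)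
      \<partial>particle_law i) = born x t p w" .
  qed
  finally show ?thesis .
qed

text \<open>The balance of \<open>born_step\<close> summed over one generation. Labels of length
  \<open>Suc n\<close> make up generation \<open>n\<close>, since the empty label is not a
  particle.\<close>

lemma living_generation_sum:
  "(\<integral>\<^sup>+p. (if length p = Suc n then \<integral>\<^sup>+w. living x t p w \<partial>tree_law else 0) \<partial>count_space UNIV) +
   (\<integral>\<^sup>+p. (if length p = Suc (Suc n) then \<integral>\<^sup>+w. born x t p w \<partial>tree_law else 0) \<partial>count_space UNIV) =
   (\<integral>\<^sup>+p. (if length p = Suc n then \<integral>\<^sup>+w. born x t p w \<partial>tree_law else 0) \<partial>count_space UNIV)"
proof -
  have "(\<integral>\<^sup>+p. (if length p = Suc n then \<integral>\<^sup>+w. living x t p w \<partial>tree_law else 0) \<partial>count_space UNIV) +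
   (\<integral>\<^sup>+p. (if length p = Suc (Suc n) then \<integral>\<^sup>+w. born x t p w \<partial>tree_law else 0) \<partial>count_space UNIV) =
   (\<integral>\<^sup>+p. (if length p = Suc n then (\<integral>\<^sup>+w. living x t p w \<partial>tree_law) +
      (\<integral>\<^sup>+a. \<integral>\<^sup>+w. born x t (a # p) w \<partial>tree_law \<partial>count_space UNIV) else 0) \<partial>count_space UNIV)"
    by (subst nn_integral_lists_Suc, subst nn_integral_add[symmetric]) (auto intro!: nn_integral_cong)
  also have "\<dots> =
      (\<integral>\<^sup>+p. (if length p = Suc n then \<integral>\<^sup>+w. born x t p w \<partial>tree_law else 0) \<partial>count_space UNIV)"
  proof (intro nn_integral_cong)
    fix p :: "'d label"
    have "(\<integral>\<^sup>+w. living x t p w \<partial>tree_law) + (\<integral>\<^sup>+a. \<integral>\<^sup>+w. born x t (a # p) w \<partial>tree_law \<partial>count_space UNIV) =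
        (\<integral>\<^sup>+w. born x t p w \<partial>tree_law)" if p: "p \<noteq> []"
    proof -
      have "(\<integral>\<^sup>+a. \<integral>\<^sup>+w. born x t (a # p) w \<partial>tree_law \<partial>count_space UNIV) =
          (\<integral>\<^sup>+w. \<integral>\<^sup>+a. born x t (a # p) w \<partial>count_space UNIV \<partial>tree_law)"
        by (intro nn_integral_count_space_nn_integral[symmetric]) auto
      then show ?thesis
        using p by (subst born_step[OF p, symmetric], subst nn_integral_add)
          (auto intro!: borel_measurable_nn_integral_count_space)
    qed
    then show "(if length p = Suc n then (\<integral>\<^sup>+w. living x t p w \<partial>tree_law) +
      (\<integral>\<^sup>+a. \<integral>\<^sup>+w. born x t (a # p) w \<partial>tree_law \<partial>count_space UNIV) else 0) =
      (if length p = Suc n then \<integral>\<^sup>+w. born x t p w \<partial>tree_law else 0)"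
      by (cases p) simp_all
  qed
  finally show ?thesis .
qed

text \<open>Telescoping: the living weight of the first \<open>n\<close> generations plus the weight
  born in the next one always equals the weight of the initial particles. Dropping the non-negative
  remainder bounds all partial sums, hence the whole series over generations.\<close>

lemma nn_integral_living_le:
  assumes t: "0 \<le> t"
  shows "(\<integral>\<^sup>+w. (\<integral>\<^sup>+p. (if p = [] then 0 else living x t p w) \<partial>count_space UNIV) \<partial>tree_law)
    \<le> ennreal (\<Sum>j\<in>UNIV. real (x $ j) * u $ j)"
proof -
  define LV where "LV n = (\<integral>\<^sup>+p. (if length p = n then \<integral>\<^sup>+w. living x t p w \<partial>tree_law else 0)
    \<partial>count_space UNIV)" for n
  define BN where "BN n = (\<integral>\<^sup>+p. (if length p = n then \<integral>\<^sup>+w. born x t p w \<partial>tree_law else 0)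
    \<partial>count_space UNIV)" for n
  interpret prob_space tree_law by (rule prob_space_tree_law)
  have telescope: "(\<Sum>m<n. LV (Suc m)) + BN (Suc n) = BN 1" for n
  proof (induction n)
    case (Suc n)
    have "LV (Suc n) + BN (Suc (Suc n)) = BN (Suc n)"
      unfolding LV_def BN_def by (rule living_generation_sum)
    with Suc show ?case by (simp add: add.assoc)
  qed simp
  \<comment> \<open>The initial particles are the children of the empty label. They are born at time
    0, so their weight is not discounted, and it counts in full because 0 \<le> t.\<close>
  have "BN 1 = (\<integral>\<^sup>+p. (if length p = 0 then
      \<integral>\<^sup>+a. \<integral>\<^sup>+w. born x t (a # p) w \<partial>tree_law \<partial>count_space UNIV else 0) \<partial>count_space UNIV)"
    unfolding BN_def One_nat_def by (rule nn_integral_lists_Suc)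
  also have "\<dots> = (\<integral>\<^sup>+p. (\<integral>\<^sup>+a. \<integral>\<^sup>+w. born x t [a] w \<partial>tree_law \<partial>count_space UNIV) * indicator {[] :: 'd label} p \<partial>count_space UNIV)"
    by (rule nn_integral_cong) auto
  also have "\<dots> = (\<integral>\<^sup>+a. \<integral>\<^sup>+w. born x t [a] w \<partial>tree_law \<partial>count_space UNIV)"
    by (subst nn_integral_cmult_indicator) auto
  also have "\<dots> = (\<integral>\<^sup>+a. ennreal (if snd a < x $ fst a then u $ fst a else 0) \<partial>count_space UNIV)"
    using t by (intro nn_integral_cong) (auto simp: born_def emeasure_space_1)
  also have "\<dots> = ennreal (\<Sum>j\<in>UNIV. real (x $ j) * u $ j)"
    by (rule nn_integral_children) (rule u_nonneg)
  finally have BN1: "BN 1 = ennreal (\<Sum>j\<in>UNIV. real (x $ j) * u $ j)" .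
  have "(\<integral>\<^sup>+w. (\<integral>\<^sup>+p. (if p = [] then 0 else living x t p w) \<partial>count_space UNIV) \<partial>tree_law) =
    (\<integral>\<^sup>+p. \<integral>\<^sup>+w. (if p = [] then 0 else living x t p w) \<partial>tree_law \<partial>count_space UNIV)"
  proof (intro nn_integral_count_space_nn_integral)
    fix p :: "'d label"
    show "(\<lambda>w. if p = [] then 0 else living x t p w) \<in> borel_measurable tree_law"
      by (cases "p = []") auto
  qed simp
  also have "\<dots> = (\<integral>\<^sup>+p. (\<Sum>m. (if length p = Suc m then \<integral>\<^sup>+w. living x t p w \<partial>tree_law else 0)) \<partial>count_space UNIV)"
  proof (intro nn_integral_cong)
    fix p :: "'d label"
    show "(\<integral>\<^sup>+w. (if p = [] then 0 else living x t p w) \<partial>tree_law) =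
      (\<Sum>m. (if length p = Suc m then \<integral>\<^sup>+w. living x t p w \<partial>tree_law else 0))"
    proof (cases p)
      case (Cons a q)
      have "(\<lambda>m. if m = length q then \<integral>\<^sup>+w. living x t p w \<partial>tree_law else 0) sums (\<integral>\<^sup>+w. living x t p w \<partial>tree_law)"
        using sums_single[of "length q" "\<lambda>_. \<integral>\<^sup>+w. living x t p w \<partial>tree_law"] by simp
      then show ?thesis using Cons by (simp add: sums_iff eq_commute)
    qed simp
  qed
  also have "\<dots> = (\<Sum>m. LV (Suc m))"
    unfolding LV_def by (rule nn_integral_suminf) simp
  also have "\<dots> \<le> BN 1"
    by (rule suminf_le_const) (use telescope[symmetric] le_iff_add in blast)+
  finally show ?thesis unfolding BN1 .
qed

text \<open>Only an inequality, since \<open>population\<close> counts infinitely many particles as \<open>0\<close>.\<close>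

lemma population_le_living:
  "ennreal (exp (- \<rho> * t) * (\<Sum>j\<in>UNIV. real (population x L N t $ j) * u $ j)) \<le>
    (\<integral>\<^sup>+p. (if p = [] then 0 else living x t p (\<lambda>p\<in>{p. p \<noteq> []}. (L p, N p))) \<partial>count_space UNIV)"
proof -
  let ?w = "\<lambda>p\<in>{p. p \<noteq> []}. (L p, N p)"
  have R: "realised x (\<lambda>q. snd (?w q)) p = realised x N p" for p
    by (rule realised_cong) auto
  have b: "birth_time (\<lambda>q. fst (?w q)) p = birth_time L p" for p
    by (rule birth_time_cong) auto
  define S where "S j = {p \<in> alive_at x L N t. particle_type p = j}" for j
  define c where "c j = ennreal (exp (- \<rho> * t) * u $ j)" for j
  have "ennreal (exp (- \<rho> * t) * (\<Sum>j\<in>UNIV. real (population x L N t $ j) * u $ j)) =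
      (\<Sum>j\<in>UNIV. ennreal (real (card (S j)) * (exp (- \<rho> * t) * u $ j)))"
    by (subst sum_ennreal) (auto simp: u_nonneg sum_distrib_left population_def S_def mult_ac)
  also have "\<dots> = (\<Sum>j\<in>UNIV. c j * of_nat (card (S j)))"
    by (simp add: c_def ennreal_mult u_nonneg ennreal_of_nat_eq_real_of_nat mult.commute)
  also have "\<dots> \<le> (\<Sum>j\<in>UNIV. c j * emeasure (count_space UNIV) (S j))"
    by (intro sum_mono mult_left_mono) (auto simp: emeasure_count_space)
  also have "\<dots> = (\<Sum>j\<in>UNIV. \<integral>\<^sup>+p. c j * indicator (S j) p \<partial>count_space UNIV)"
    by (subst nn_integral_cmult_indicator) auto
  also have "\<dots> = (\<integral>\<^sup>+p. (\<Sum>j\<in>UNIV. c j * indicator (S j) p) \<partial>count_space UNIV)"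
    by (subst nn_integral_sum) auto
  also have "\<dots> = (\<integral>\<^sup>+p. (if p = [] then 0 else living x t p ?w) \<partial>count_space UNIV)"
  proof (intro nn_integral_cong)
    fix p
    have "(\<Sum>j\<in>UNIV. c j * indicator (S j) p) =
        (\<Sum>j\<in>UNIV. if j = particle_type p then c j * indicator (alive_at x L N t) p else 0)"
      by (intro sum.cong) (auto simp: S_def indicator_def)
    also have "\<dots> = c (particle_type p) * indicator (alive_at x L N t) p"
      by simp
    also have "\<dots> = (if p = [] then 0 else living x t p ?w)"
      unfolding living_def R b by (auto simp: alive_at_def c_def)
    finally show "(\<Sum>j\<in>UNIV. c j * indicator (S j) p) = (if p = [] then 0 else living x t p ?w)" .
  qed
  finally show ?thesis .
qed

text \<open>In the joint law that defines the process the initial state is independent of the tree,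
  so the bound for a fixed initial state may be integrated over \<open>I\<close>. The discount is
  moved across at the end by multiplying with exp (\<rho> t).\<close>

lemma branching_process_mean_le:
  assumes Z: "branching_process \<mu> \<nu> I M Z"
    and I: "\<And>j. integrable (measure_pmf I) (\<lambda>x. real (x $ j))"
    and t: "0 \<le> t"
  shows "(\<integral>\<^sup>+\<omega>. ennreal (\<Sum>j\<in>UNIV. real (Z t \<omega> $ j) * u $ j) \<partial>M) \<le>
    ennreal (exp (\<rho> * t) * (\<Sum>j\<in>UNIV. measure_pmf.expectation I (\<lambda>x. real (x $ j)) * u $ j))"
proof -
  obtain X L N where X: "X \<in> measurable M (count_space UNIV)"
    and LN: "\<And>p. p \<noteq> [] \<Longrightarrow> L p \<in> borel_measurable M \<and> N p \<in> measurable M (count_space UNIV)"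
    and law: "distr M (count_space UNIV \<Otimes>\<^sub>M (\<Pi>\<^sub>M p\<in>{p. p \<noteq> []}. borel \<Otimes>\<^sub>M count_space UNIV))
        (\<lambda>\<omega>. (X \<omega>, \<lambda>p\<in>{p. p \<noteq> []}. (L p \<omega>, N p \<omega>))) = measure_pmf I \<Otimes>\<^sub>M tree_law"
    and ZX: "AE \<omega> in M. \<forall>t\<ge>0. Z t \<omega> = population (X \<omega>) (\<lambda>p. L p \<omega>) (\<lambda>p. N p \<omega>) t"
    using Z unfolding branching_process_def tree_law_def particle_law_def by blast
  interpret prob_space M using Z by (simp add: branching_process_def)
  interpret tree: prob_space tree_law by (rule prob_space_tree_law)
  let ?S = "count_space UNIV \<Otimes>\<^sub>M (\<Pi>\<^sub>M p\<in>{p. p \<noteq> []}. borel \<Otimes>\<^sub>M count_space UNIV) ::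
    ((nat^'d) \<times> ('d label \<Rightarrow> real \<times> (nat^'d))) measure"
  let ?Y = "\<lambda>\<omega>. (X \<omega>, \<lambda>p\<in>{p. p \<noteq> []}. (L p \<omega>, N p \<omega>))"
  define G where "G = (\<lambda>z. \<integral>\<^sup>+p. (if p = [] then 0 else living (fst z) t p (snd z)) \<partial>count_space UNIV)"
  have Y: "?Y \<in> measurable M ?S"
    using X LN by (intro measurable_Pair measurable_restrict) auto
  have sets_tree: "sets tree_law = sets (\<Pi>\<^sub>M p\<in>{p. p \<noteq> []}. borel \<Otimes>\<^sub>M count_space UNIV)"
    unfolding tree_law_def by (intro sets_PiM_cong refl sets_particle_law)
  have "G \<in> borel_measurable (count_space UNIV \<Otimes>\<^sub>M tree_law)"
    unfolding G_def
  proof (intro measurable_pair_measure_countable1 borel_measurable_nn_integral_count_space)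
    fix x p
    show "(\<lambda>w. if p = [] then 0 else living (fst (x, w)) t p (snd (x, w))) \<in> borel_measurable tree_law"
      by (cases "p = []") auto
  qed simp
  then have G: "G \<in> borel_measurable ?S"
    using sets_tree by (simp cong: measurable_cong_sets sets_pair_measure_cong)
  have G': "G \<in> borel_measurable (measure_pmf I \<Otimes>\<^sub>M tree_law)"
    unfolding law[symmetric] using G by simp
  have "ennreal (exp (- \<rho> * t)) * (\<integral>\<^sup>+\<omega>. ennreal (\<Sum>j\<in>UNIV. real (Z t \<omega> $ j) * u $ j) \<partial>M) \<le>
     (\<integral>\<^sup>+\<omega>. ennreal (exp (- \<rho> * t)) * ennreal (\<Sum>j\<in>UNIV. real (Z t \<omega> $ j) * u $ j) \<partial>M)"
  proof (subst nn_integral_cmult)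
    have "Z t \<in> measurable M (count_space UNIV)"
      using Z t by (simp add: branching_process_def)
    from measurable_compose[OF this, of "\<lambda>z. ennreal (\<Sum>j\<in>UNIV. real (z $ j) * u $ j)" borel]
    show "(\<lambda>\<omega>. ennreal (\<Sum>j\<in>UNIV. real (Z t \<omega> $ j) * u $ j)) \<in> borel_measurable M" by simp
  qed simp
  also have "\<dots> \<le> (\<integral>\<^sup>+\<omega>. G (?Y \<omega>) \<partial>M)"
    using ZX
  proof (intro nn_integral_mono_AE, eventually_elim)
    case (elim \<omega>)
    then show ?case
      using t population_le_living[of t "X \<omega>" "\<lambda>p. L p \<omega>" "\<lambda>p. N p \<omega>"]
      by (simp add: G_def ennreal_mult'[symmetric] cong: if_cong)
  qed
  also have "\<dots> = (\<integral>\<^sup>+z. G z \<partial>(measure_pmf I \<Otimes>\<^sub>M tree_law))"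
    unfolding law[symmetric] using Y G by (subst nn_integral_distr) auto
  also have "\<dots> = (\<integral>\<^sup>+x. \<integral>\<^sup>+w. G (x, w) \<partial>tree_law \<partial>measure_pmf I)"
    using tree.nn_integral_fst[OF G'] by simp
  also have "\<dots> \<le> (\<integral>\<^sup>+x. ennreal (\<Sum>j\<in>UNIV. real (x $ j) * u $ j) \<partial>measure_pmf I)"
    unfolding G_def using nn_integral_living_le[OF t] by (intro nn_integral_mono) (simp cong: if_cong)
  also have "\<dots> = ennreal (measure_pmf.expectation I (\<lambda>x. \<Sum>j\<in>UNIV. real (x $ j) * u $ j))"
    by (intro nn_integral_eq_integral)
      (auto intro!: I sum_nonneg mult_nonneg_nonneg simp: u_nonneg)
  also have "measure_pmf.expectation I (\<lambda>x. \<Sum>j\<in>UNIV. real (x $ j) * u $ j) =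
      (\<Sum>j\<in>UNIV. measure_pmf.expectation I (\<lambda>x. real (x $ j)) * u $ j)"
    by (subst Bochner_Integration.integral_sum) (auto intro!: I)
  finally have *: "ennreal (exp (- \<rho> * t)) * (\<integral>\<^sup>+\<omega>. ennreal (\<Sum>j\<in>UNIV. real (Z t \<omega> $ j) * u $ j) \<partial>M) \<le>
    ennreal (\<Sum>j\<in>UNIV. measure_pmf.expectation I (\<lambda>x. real (x $ j)) * u $ j)" .
  have "(\<integral>\<^sup>+\<omega>. ennreal (\<Sum>j\<in>UNIV. real (Z t \<omega> $ j) * u $ j) \<partial>M) =
      ennreal (exp (\<rho> * t)) * (ennreal (exp (- \<rho> * t)) *
        (\<integral>\<^sup>+\<omega>. ennreal (\<Sum>j\<in>UNIV. real (Z t \<omega> $ j) * u $ j) \<partial>M))"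
    by (simp add: mult.assoc[symmetric] ennreal_mult[symmetric] mult_exp_exp)
  also have "\<dots> \<le> ennreal (exp (\<rho> * t)) *
      ennreal (\<Sum>j\<in>UNIV. measure_pmf.expectation I (\<lambda>x. real (x $ j)) * u $ j)"
    by (intro mult_left_mono *) simp
  finally show ?thesis
    by (simp add: ennreal_mult')
qed

end

section \<open>The first intensity of a determinantal process\<close>

lemma nn_integral_dirac_sum:
  assumes T: "point_process M \<kappa> T" and \<omega>: "\<omega> \<in> space M" and g: "g \<in> borel_measurable halfline"
  shows "(\<integral>\<^sup>+x. g x \<partial>dirac_sum \<kappa> T \<omega>) = (\<Sum>i. if enat i < \<kappa> \<omega> then g (T i \<omega>) else 0)"
proof -
  have "(\<lambda>i. T i \<omega>) \<in> measurable (count_space {i. enat i < \<kappa> \<omega>}) halfline"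
    using T \<omega> by (auto simp: point_process_def space_restrict_space)
  then have "(\<integral>\<^sup>+x. g x \<partial>dirac_sum \<kappa> T \<omega>) = (\<integral>\<^sup>+i. g (T i \<omega>) \<partial>count_space {i. enat i < \<kappa> \<omega>})"
    unfolding dirac_sum_def by (rule nn_integral_distr) (simp add: g)
  also have "\<dots> = (\<integral>\<^sup>+i. (if enat i < \<kappa> \<omega> then g (T i \<omega>) else 0) \<partial>count_space UNIV)"
    by (subst nn_integral_count_space_indicator) (auto intro!: nn_integral_cong)
  also have "\<dots> = (\<Sum>i. if enat i < \<kappa> \<omega> then g (T i \<omega>) else 0)"
    by (rule nn_integral_count_space_nat)
  finally show ?thesis .
qed

lemma admissible_kernel_sigma_finite:
  assumes "admissible_kernel \<Lambda> K"
  shows "sigma_finite_measure \<Lambda>"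
proof
  have sets: "sets \<Lambda> = sets halfline" and fin: "\<And>b. emeasure \<Lambda> {0..b} < \<infinity>"
    using assms by (auto simp: admissible_kernel_def)
  have space: "space \<Lambda> = {0..}"
    using sets_eq_imp_space_eq[OF sets] by (simp add: space_restrict_space)
  have "\<Union> (range (\<lambda>n. {0..real n})) = space \<Lambda>"
    by (auto simp: space intro: real_arch_simple)
  then show "\<exists>A. countable A \<and> A \<subseteq> sets \<Lambda> \<and> \<Union> A = space \<Lambda> \<and> (\<forall>a\<in>A. emeasure \<Lambda> a \<noteq> \<infinity>)"
    using fin by (intro exI[of _ "range (\<lambda>n. {0..real n})"])
      (auto simp: sets sets_restrict_space_iff less_top[symmetric])
qed

lemma kernel_det_1: "kernel_det K (Suc 0) x = K (x 0) (x 0)"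
proof -
  have "{..<Suc 0} = {0}" by auto
  then show ?thesis by (simp add: kernel_det_def permutes_sing)
qed

text \<open>The joint intensity of a single set: disjointness is void, and the determinant of a
  one-by-one matrix is K(x, x).\<close>

lemma determinantal_first_intensity:
  assumes K: "admissible_kernel \<Lambda> K" and \<Phi>: "determinantal_process \<Lambda> K M \<kappa> T"
    and B: "B \<in> sets halfline"
  shows "(\<integral>\<^sup>+\<omega>. emeasure (dirac_sum \<kappa> T \<omega>) B \<partial>M) = (\<integral>\<^sup>+x\<in>B. ennreal (K x x) \<partial>\<Lambda>)"
proof -
  interpret sigma_finite_measure \<Lambda> using K by (rule admissible_kernel_sigma_finite)
  interpret product_sigma_finite "\<lambda>_::nat. \<Lambda>" ..
  have sets: "sets \<Lambda> = sets halfline" and meas: "(\<lambda>(x, y). K x y) \<in> borel_measurable (halfline \<Otimes>\<^sub>M halfline)"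
    using K by (auto simp: admissible_kernel_def)
  have one: "{..<Suc 0} = {0}" by auto
  have diag: "(\<lambda>x. ennreal (K x x)) \<in> borel_measurable \<Lambda>"
    using measurable_compose[OF measurable_Pair[OF measurable_ident measurable_ident] meas] sets
    by (simp cong: measurable_cong_sets)
  have "\<forall>n B. B ` {..<n} \<subseteq> sets halfline \<longrightarrow> disjoint_family_on B {..<n} \<longrightarrow>
      (\<integral>\<^sup>+\<omega>. (\<Prod>i<n. emeasure (dirac_sum \<kappa> T \<omega>) (B i)) \<partial>M) =
      (\<integral>\<^sup>+x\<in>Pi\<^sub>E {..<n} B. ennreal (kernel_det K n x) \<partial>(\<Pi>\<^sub>M i\<in>{..<n}. \<Lambda>))"
    using \<Phi> unfolding determinantal_process_def by (elim conjE)
  from this[rule_format, of "\<lambda>_. B" "Suc 0"] B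
  have "(\<integral>\<^sup>+\<omega>. emeasure (dirac_sum \<kappa> T \<omega>) B \<partial>M) =
      (\<integral>\<^sup>+x\<in>Pi\<^sub>E {..<Suc 0} (\<lambda>_. B). ennreal (kernel_det K (Suc 0) x) \<partial>(\<Pi>\<^sub>M i\<in>{..<Suc 0}. \<Lambda>))"
    by (auto simp: disjoint_family_on_def)
  also have "\<dots> = (\<integral>\<^sup>+x. ennreal (K (x 0) (x 0)) * indicator B (x 0) \<partial>(\<Pi>\<^sub>M i\<in>{0::nat}. \<Lambda>))"
    unfolding one kernel_det_1
    by (intro nn_integral_cong) (auto simp: space_PiM PiE_iff indicator_def)
  also have "\<dots> = (\<integral>\<^sup>+x\<in>B. ennreal (K x x) \<partial>\<Lambda>)"
    using B sets diag by (intro product_nn_integral_singleton[of "\<lambda>x. ennreal (K x x) * indicator B x"]) auto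
  finally show ?thesis by simp
qed

text \<open>Campbell's formula. On sets it is the first intensity, and measures that agree on all
  measurable sets have the same integrals. The sum over the atoms stands outside the expectation
  because the later estimates treat the atoms one by one.\<close>

lemma determinantal_campbell:
  assumes K: "admissible_kernel \<Lambda> K" and \<Phi>: "determinantal_process \<Lambda> K M \<kappa> T"
    and M: "prob_space M" and g: "g \<in> borel_measurable halfline"
  shows "(\<Sum>i. \<integral>\<^sup>+\<omega>. (if enat i < \<kappa> \<omega> then g (T i \<omega>) else 0) \<partial>M) = (\<integral>\<^sup>+x. g x * ennreal (K x x) \<partial>\<Lambda>)"
proof -
  interpret prob_space M by (rule M)
  have pp: "point_process M \<kappa> T" using \<Phi> by (simp add: determinantal_process_def)
  then have [measurable]: "\<kappa> \<in> measurable M (count_space UNIV)" "T i \<in> borel_measurable M" for i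
    by (auto simp: point_process_def)
  have nonneg: "0 \<le> T i \<omega>" if "\<omega> \<in> space M" "enat i < \<kappa> \<omega>" for i \<omega>
    using pp that by (auto simp: point_process_def)
  have sets: "sets \<Lambda> = sets halfline" and meas: "(\<lambda>(x, y). K x y) \<in> borel_measurable (halfline \<Otimes>\<^sub>M halfline)"
    using K by (auto simp: admissible_kernel_def)
  have diag: "(\<lambda>x. ennreal (K x x)) \<in> borel_measurable \<Lambda>"
    using measurable_compose[OF measurable_Pair[OF measurable_ident measurable_ident] meas] sets
    by (simp cong: measurable_cong_sets)
  define Q where "Q = M \<Otimes>\<^sub>M count_space (UNIV :: nat set)"
  \<comment> \<open>An index beyond \<open>\<kappa>\<close> may carry a negative \<open>T i\<close>;
    the truncation keeps \<open>\<tau>\<close> inside the half-line and changes nothing at actual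
    atoms.\<close>
  define \<tau> where "\<tau> z = max 0 (T (snd z) (fst z))" for z
  interpret count: sigma_finite_measure "count_space (UNIV :: nat set)"
    by (rule sigma_finite_measure_count_space)
  have [measurable]: "fst \<in> measurable Q M" "snd \<in> measurable Q (count_space UNIV)"
    unfolding Q_def by auto
  have T': "(\<lambda>z. T (snd z) (fst z)) \<in> borel_measurable Q"
    by (rule measurable_compose_countable[of "\<lambda>i z. T i (fst z)"]) auto
  then have \<tau> [measurable]: "\<tau> \<in> measurable Q halfline"
    unfolding \<tau>_def by (intro measurable_restrict_space2) auto
  have [measurable]: "Measurable.pred Q (\<lambda>z. enat (snd z) < \<kappa> (fst z))"
    by (rule measurable_compose_countable[of "\<lambda>i z. enat i < \<kappa> (fst z)"]) auto
  define N where "N = distr (density Q (\<lambda>z. if enat (snd z) < \<kappa> (fst z) then 1 else 0)) halfline \<tau>"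
  have N: "(\<integral>\<^sup>+x. h x \<partial>N) = (\<integral>\<^sup>+\<omega>. (\<Sum>i. if enat i < \<kappa> \<omega> then h (T i \<omega>) else 0) \<partial>M)"
    if h [measurable]: "h \<in> borel_measurable halfline" for h :: "real \<Rightarrow> ennreal"
  proof -
    have "(\<integral>\<^sup>+x. h x \<partial>N) = (\<integral>\<^sup>+z. h (\<tau> z) \<partial>density Q (\<lambda>z. if enat (snd z) < \<kappa> (fst z) then 1 else 0))"
      unfolding N_def by (rule nn_integral_distr) auto
    also have "\<dots> = (\<integral>\<^sup>+z. (if enat (snd z) < \<kappa> (fst z) then 1 else 0) * h (\<tau> z) \<partial>Q)"
      by (rule nn_integral_density) auto
    also have "\<dots> = (\<integral>\<^sup>+\<omega>. \<integral>\<^sup>+i. (if enat i < \<kappa> \<omega> then 1 else 0) * h (\<tau> (\<omega>, i)) \<partial>count_space UNIV \<partial>M)"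
      using count.nn_integral_fst[of "\<lambda>z. (if enat (snd z) < \<kappa> (fst z) then 1 else 0) * h (\<tau> z)" M]
      unfolding Q_def[symmetric] by simp
    also have "\<dots> = (\<integral>\<^sup>+\<omega>. (\<Sum>i. if enat i < \<kappa> \<omega> then h (T i \<omega>) else 0) \<partial>M)"
      using nonneg unfolding nn_integral_count_space_nat
      by (intro nn_integral_cong suminf_cong) (auto simp: \<tau>_def max_def)
    finally show ?thesis .
  qed
  have "N = density \<Lambda> (\<lambda>x. ennreal (K x x))"
  proof (rule measure_eqI)
    fix A assume "A \<in> sets N"
    then have A: "A \<in> sets halfline" by (simp add: N_def)
    have "emeasure N A = (\<integral>\<^sup>+x. indicator A x \<partial>N)"
      using A by (simp add: N_def)
    also have "\<dots> = (\<integral>\<^sup>+\<omega>. (\<Sum>i. if enat i < \<kappa> \<omega> then indicator A (T i \<omega>) else 0) \<partial>M)"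
      using A by (intro N) auto
    also have "\<dots> = (\<integral>\<^sup>+\<omega>. emeasure (dirac_sum \<kappa> T \<omega>) A \<partial>M)"
    proof (intro nn_integral_cong)
      fix \<omega> assume "\<omega> \<in> space M"
      from nn_integral_dirac_sum[OF pp this, of "indicator A"] A
      show "(\<Sum>i. if enat i < \<kappa> \<omega> then indicator A (T i \<omega>) else 0) = emeasure (dirac_sum \<kappa> T \<omega>) A"
        by (simp add: dirac_sum_def)
    qed
    also have "\<dots> = emeasure (density \<Lambda> (\<lambda>x. ennreal (K x x))) A"
      using determinantal_first_intensity[OF K \<Phi> A] diag A sets by (simp add: emeasure_density)
    finally show "emeasure N A = emeasure (density \<Lambda> (\<lambda>x. ennreal (K x x))) A" .
  qed (simp add: N_def sets)
  then have "(\<integral>\<^sup>+\<omega>. (\<Sum>i. if enat i < \<kappa> \<omega> then g (T i \<omega>) else 0) \<partial>M) =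
      (\<integral>\<^sup>+x. ennreal (K x x) * g x \<partial>\<Lambda>)"
    using N[OF g] diag g sets by (simp add: nn_integral_density cong: measurable_cong_sets)
  moreover have "(\<lambda>\<omega>. if enat i < \<kappa> \<omega> then g (T i \<omega>) else 0) \<in> borel_measurable M" for i
  proof -
    have [measurable]: "(\<lambda>\<omega>. \<tau> (\<omega>, i)) \<in> measurable M halfline"
      by (rule measurable_compose[OF _ \<tau>]) (simp add: Q_def)
    have "(\<lambda>\<omega>. if enat i < \<kappa> \<omega> then g (\<tau> (\<omega>, i)) else 0) \<in> borel_measurable M"
      using g by measurable
    then show ?thesis
      by (rule measurable_cong[THEN iffD1, rotated]) (use nonneg in \<open>auto simp: \<tau>_def max_def\<close>)
  qed
  ultimately show ?thesis
    by (subst nn_integral_suminf[symmetric]) (auto simp: mult.commute)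
qed

section \<open>Independence and convergence in distribution\<close>

text \<open>Independence is the product formula on rectangles, and rectangles determine the product
  of two \<sigma>-finite measures.\<close>

lemma indep_rv_distr_pair:
  assumes M: "prob_space M" and indep: "indep_rv M A X B Y"
  shows "distr M (A \<Otimes>\<^sub>M B) (\<lambda>\<omega>. (X \<omega>, Y \<omega>)) = distr M A X \<Otimes>\<^sub>M distr M B Y"
proof (rule pair_measure_eqI[symmetric])
  interpret prob_space M by (rule M)
  have [measurable]: "X \<in> measurable M A" "Y \<in> measurable M B"
    and indep': "indep_set {X -` S \<inter> space M | S. S \<in> sets A} {Y -` S \<inter> space M | S. S \<in> sets B}"
    using indep by (auto simp: indep_rv_def)
  show "sigma_finite_measure (distr M A X)" "sigma_finite_measure (distr M B Y)"
    by (intro prob_space_imp_sigma_finite prob_space_distr; simp)+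
  fix S R assume "S \<in> sets (distr M A X)" "R \<in> sets (distr M B Y)"
  then have [measurable]: "S \<in> sets A" "R \<in> sets B" by auto
  have "prob ((X -` S \<inter> space M) \<inter> (Y -` R \<inter> space M)) = prob (X -` S \<inter> space M) * prob (Y -` R \<inter> space M)"
    by (rule indep_setD[OF indep']) auto
  moreover have "(\<lambda>\<omega>. (X \<omega>, Y \<omega>)) -` (S \<times> R) \<inter> space M = (X -` S \<inter> space M) \<inter> (Y -` R \<inter> space M)"
    by auto
  ultimately show "emeasure (distr M A X) S * emeasure (distr M B Y) R =
      emeasure (distr M (A \<Otimes>\<^sub>M B) (\<lambda>\<omega>. (X \<omega>, Y \<omega>))) (S \<times> R)"
    by (simp add: emeasure_distr emeasure_eq_measure ennreal_mult[symmetric])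
qed (simp cong: sets_pair_measure_cong)

lemma indep_rv_compose:
  assumes M: "prob_space M" and indep: "indep_rv M A X B Y" and g: "g \<in> measurable B C"
  shows "indep_rv M A X C (\<lambda>\<omega>. g (Y \<omega>))"
proof -
  interpret prob_space M by (rule M)
  have X: "X \<in> measurable M A" and Y: "Y \<in> measurable M B"
    and indep': "indep_set {X -` S \<inter> space M | S. S \<in> sets A} {Y -` S \<inter> space M | S. S \<in> sets B}"
    using indep by (auto simp: indep_rv_def)
  have "{(\<lambda>\<omega>. g (Y \<omega>)) -` S \<inter> space M | S. S \<in> sets C} \<subseteq> {Y -` S \<inter> space M | S. S \<in> sets B}"
  proof clarify
    fix S assume S: "S \<in> sets C"
    have "(\<lambda>\<omega>. g (Y \<omega>)) -` S \<inter> space M = Y -` (g -` S \<inter> space B) \<inter> space M"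
      using measurable_space[OF Y] by auto
    then show "\<exists>R. (\<lambda>\<omega>. g (Y \<omega>)) -` S \<inter> space M = Y -` R \<inter> space M \<and> R \<in> sets B"
      using measurable_sets[OF g S] by blast
  qed
  then have "indep_set {X -` S \<inter> space M | S. S \<in> sets A} {(\<lambda>\<omega>. g (Y \<omega>)) -` S \<inter> space M | S. S \<in> sets C}"
    using indep' unfolding indep_set_def
    by (elim indep_sets_mono_sets) (auto split: bool.split)
  then show ?thesis
    using X measurable_compose[OF Y g] by (simp add: indep_rv_def)
qed

lemma iid_distr_PiM:
  fixes V :: "nat \<Rightarrow> 'a \<Rightarrow> 'b"
  assumes M: "prob_space M" and indep: "prob_space.indep_vars M (\<lambda>_. N) V UNIV"
    and D: "\<And>i. distr M N (V i) = D"
  shows "distr M (\<Pi>\<^sub>M i\<in>UNIV. N) (\<lambda>\<omega> i. V i \<omega>) = (\<Pi>\<^sub>M i\<in>UNIV. D)"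
proof -
  interpret prob_space M by (rule M)
  have V: "random_variable N (V i)" for i
    using indep by (simp add: indep_vars_def)
  from iffD1[OF indep_vars_iff_distr_eq_PiM[where I=UNIV and M'="\<lambda>_. N" and X=V, OF _ V] indep] D
  show ?thesis by (simp add: restrict_def)
qed

text \<open>The integrand sees only the coordinates in \<open>J\<close>, so the infinite product may
  be replaced by its finite marginal, where Fubini gives the product.\<close>

lemma (in product_prob_space) nn_integral_PiM_prod:
  assumes J: "finite J" "J \<subseteq> I" and h: "\<And>i. i \<in> J \<Longrightarrow> h i \<in> borel_measurable (M i)"
  shows "(\<integral>\<^sup>+w. (\<Prod>i\<in>J. h i (w i)) \<partial>PiM I M) = (\<Prod>i\<in>J. \<integral>\<^sup>+y. h i y \<partial>M i)"
proof -
  have [measurable]: "(\<lambda>w. \<Prod>i\<in>J. h i (w i)) \<in> borel_measurable (PiM J M)"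
    by (intro borel_measurable_prod_ennreal measurable_compose[OF measurable_component_singleton]) (auto intro: h)
  have "(\<integral>\<^sup>+w. (\<Prod>i\<in>J. h i (w i)) \<partial>PiM J M) =
      (\<integral>\<^sup>+w. (\<Prod>i\<in>J. h i (w i)) \<partial>distr (PiM I M) (PiM J M) (\<lambda>x. restrict x J))"
    by (simp add: distr_PiM_restrict_finite[OF J])
  also have "\<dots> = (\<integral>\<^sup>+w. (\<Prod>i\<in>J. h i (restrict w J i)) \<partial>PiM I M)"
    using J by (subst nn_integral_distr) (auto intro!: measurable_restrict_subset)
  finally show ?thesis
    using product_nn_integral_prod[OF J(1) h] by (simp cong: prod.cong)
qed

text \<open>Divergence is included: the partial sums then increase to infinity, and the limit 0 of
  the exponentials is the value of \<open>exp_neg\<close> at infinity. No summability over the atoms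
  has to be known beforehand.\<close>

lemma exp_neg_sum_tendsto:
  assumes x: "\<And>i. 0 \<le> x i"
  shows "(\<lambda>n. exp (- (\<Sum>i<n. x i))) \<longlonglongrightarrow> exp_neg (\<Sum>i. ennreal (x i))"
proof (cases "summable x")
  case True
  then have "(\<Sum>i. ennreal (x i)) = ennreal (suminf x)"
    by (intro suminf_ennreal_eq x) (simp add: summable_sums)
  moreover have "(\<lambda>n. exp (- (\<Sum>i<n. x i))) \<longlonglongrightarrow> exp (- suminf x)"
    using True by (intro tendsto_intros) (simp add: summable_LIMSEQ)
  ultimately show ?thesis
    using suminf_nonneg[OF True x] by (simp add: exp_neg_def)
next
  case False
  have "(\<Sum>i. ennreal (x i)) = \<infinity>"
  proof (rule ccontr)
    assume "(\<Sum>i. ennreal (x i)) \<noteq> \<infinity>"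
    then have "summable x" by (intro summable_suminf_not_top x) simp
    with False show False by contradiction
  qed
  moreover have "filterlim (\<lambda>n. \<Sum>i<n. x i) at_top sequentially"
  proof (rule ccontr)
    assume "\<not> ?thesis"
    then obtain B where B: "\<exists>\<^sub>F n in sequentially. (\<Sum>i<n. x i) < B"
      by (auto simp: filterlim_at_top not_eventually not_le)
    have "(\<Sum>i<n. x i) \<le> B" for n
    proof -
      obtain m where "n \<le> m" "(\<Sum>i<m. x i) < B"
        using B by (auto simp: frequently_sequentially)
      moreover from this have "(\<Sum>i<n. x i) \<le> (\<Sum>i<m. x i)"
        by (intro sum_mono2) (auto simp: x)
      ultimately show ?thesis by simp
    qed
    then have "summable x"
      by (intro bounded_imp_summable[where B=B] x) (simp only: lessThan_Suc_atMost[symmetric])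
    with False show False by contradiction
  qed
  then have "(\<lambda>n. exp (- (\<Sum>i<n. x i))) \<longlonglongrightarrow> 0"
    by (intro filterlim_compose[OF exp_at_bot] filterlim_uminus_at_bot[THEN iffD1]) (simp add: filterlim_uminus_at_bot)
  ultimately show ?thesis by (simp add: exp_neg_def)
qed

text \<open>Otherwise some open neighbourhood of \<open>l\<close> is missed along a whole
  subsequence, and no further subsequence of that one can converge to \<open>l\<close>.\<close>

lemma subseq_tendsto:
  fixes f :: "nat \<Rightarrow> 'a :: topological_space"
  assumes "\<And>s :: nat \<Rightarrow> nat. strict_mono s \<Longrightarrow> \<exists>r. strict_mono r \<and> (\<lambda>n. f (s (r n))) \<longlonglongrightarrow> l"
  shows "f \<longlonglongrightarrow> l"
proof (rule ccontr)
  assume "\<not> f \<longlonglongrightarrow> l"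
  then obtain S where S: "open S" "l \<in> S" "\<exists>\<^sub>F n in sequentially. f n \<notin> S"
    by (auto simp: tendsto_def not_eventually)
  then have "infinite {n. f n \<notin> S}"
    by (simp add: frequently_cofinite[symmetric] cofinite_eq_sequentially)
  then obtain s :: "nat \<Rightarrow> nat" where s: "strict_mono s" "\<And>n. s n \<in> {n. f n \<notin> S}"
    using infinite_enumerate by blast
  then obtain r where "strict_mono r" "(\<lambda>n. f (s (r n))) \<longlonglongrightarrow> l" using assms by blast
  then have "\<forall>\<^sub>F n in sequentially. f (s (r n)) \<in> S" using S by (auto simp: tendsto_def)
  then show False using s(2) by (auto simp: eventually_sequentially)
qed

text \<open>The truncated distance describes convergence in probability. Every sequence of times
  tending to infinity has a subsequence along which the distance vanishes almost surely; there the
  bounded continuous \<open>g\<close> passes to the limit by dominated convergence, and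
  \<open>subseq_tendsto\<close> returns to the full family.\<close>

lemma converges_in_distributionI_dist:
  fixes X :: "real \<Rightarrow> 'a \<Rightarrow> 'b::{metric_space, second_countable_topology}"
  assumes M: "prob_space M"
    and X [measurable]: "\<And>t. X t \<in> borel_measurable M" and Y [measurable]: "Y \<in> borel_measurable M"
    and lim: "((\<lambda>t. \<integral>\<omega>. min 1 (dist (X t \<omega>) (Y \<omega>)) \<partial>M) \<longlongrightarrow> 0) at_top"
  shows "converges_in_distribution M X Y at_top"
  unfolding converges_in_distribution_def
proof (intro conjI allI impI)
  interpret prob_space M by (rule M)
  fix g :: "'b \<Rightarrow> real" assume g: "continuous_on UNIV g" "bounded (range g)"
  have [measurable]: "g \<in> borel_measurable borel" using g(1) by (rule borel_measurable_continuous_onI)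
  obtain B where B: "\<And>x. norm (g x) \<le> B" using g(2) by (auto simp: bounded_iff)
  show "((\<lambda>t. \<integral>\<omega>. g (X t \<omega>) \<partial>M) \<longlongrightarrow> (\<integral>\<omega>. g (Y \<omega>) \<partial>M)) at_top"
  proof (rule tendsto_at_topI_sequentially, rule subseq_tendsto)
    fix \<tau> :: "nat \<Rightarrow> real" and s :: "nat \<Rightarrow> nat"
    assume \<tau>: "filterlim \<tau> at_top sequentially" and s: "strict_mono s"
    have "filterlim (\<lambda>n. \<tau> (s n)) at_top sequentially"
      using \<tau> filterlim_subseq[OF s] by (rule filterlim_compose)
    then have "(\<lambda>n. \<integral>\<omega>. min 1 (dist (X (\<tau> (s n)) \<omega>) (Y \<omega>)) \<partial>M) \<longlonglongrightarrow> 0"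
      using lim by (rule filterlim_compose[rotated])
    moreover have "integrable M (\<lambda>\<omega>. min 1 (dist (X (\<tau> (s n)) \<omega>) (Y \<omega>)))" for n
      by (rule integrable_const_bound[where B=1]) auto
    ultimately obtain r where r: "strict_mono r"
      "AE \<omega> in M. (\<lambda>n. min 1 (dist (X (\<tau> (s (r n))) \<omega>) (Y \<omega>))) \<longlonglongrightarrow> 0"
      using tendsto_L1_AE_subseq[of M "\<lambda>n \<omega>. min 1 (dist (X (\<tau> (s n)) \<omega>) (Y \<omega>))"] by auto
    have "(\<lambda>n. \<integral>\<omega>. g (X (\<tau> (s (r n))) \<omega>) \<partial>M) \<longlonglongrightarrow> (\<integral>\<omega>. g (Y \<omega>) \<partial>M)"
    proof (rule integral_dominated_convergence[where w="\<lambda>_. B"])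
      show "AE \<omega> in M. (\<lambda>n. g (X (\<tau> (s (r n))) \<omega>)) \<longlonglongrightarrow> g (Y \<omega>)"
        using r(2)
      proof eventually_elim
        case (elim \<omega>)
        have "(\<lambda>n. dist (X (\<tau> (s (r n))) \<omega>) (Y \<omega>)) \<longlonglongrightarrow> 0"
        proof (rule Lim_transform_eventually[OF elim])
          have "\<forall>\<^sub>F n in sequentially. min 1 (dist (X (\<tau> (s (r n))) \<omega>) (Y \<omega>)) < 1"
            by (rule order_tendstoD[OF elim]) simp
          then show "\<forall>\<^sub>F n in sequentially. min 1 (dist (X (\<tau> (s (r n))) \<omega>) (Y \<omega>)) =
              dist (X (\<tau> (s (r n))) \<omega>) (Y \<omega>)"
            by eventually_elim auto
        qed
        then have "(\<lambda>n. X (\<tau> (s (r n))) \<omega>) \<longlonglongrightarrow> Y \<omega>" by (rule iffD2[OF tendsto_dist_iff])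
        then show ?case using continuous_on_tendsto_compose[OF g(1)] by simp
      qed
    qed (use B in auto)
    with r show "\<exists>r. strict_mono r \<and> (\<lambda>n. \<integral>\<omega>. g (X (\<tau> (s (r n))) \<omega>) \<partial>M) \<longlonglongrightarrow> (\<integral>\<omega>. g (Y \<omega>) \<partial>M)"
      by blast
  qed
qed auto

section \<open>Growth limits of copies of the branching process\<close>

text \<open>The first multiple of 1 / (b + 1) strictly to the right of \<open>t\<close>. Strictness
  makes the grid points approach \<open>t\<close> in the sense of \<open>at_right\<close>, the only
  side on which paths are known to be continuous.\<close>

definition right_grid :: "nat \<Rightarrow> real \<Rightarrow> real" where
  "right_grid b t = real (Suc (nat \<lfloor>t * real (Suc b)\<rfloor>)) / real (Suc b)"

lemma right_grid_bounds:
  assumes "0 \<le> t"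
  shows "t < right_grid b t" "right_grid b t \<le> t + 1 / real (Suc b)"
proof -
  have *: "real (nat \<lfloor>t * real (Suc b)\<rfloor>) = of_int \<lfloor>t * real (Suc b)\<rfloor>"
    using assms by (intro of_nat_nat) simp
  have "t * real (Suc b) < real (Suc (nat \<lfloor>t * real (Suc b)\<rfloor>))"
    "real (Suc (nat \<lfloor>t * real (Suc b)\<rfloor>)) \<le> t * real (Suc b) + 1"
    unfolding of_nat_Suc[of "nat _"] * by linarith+
  then show "t < right_grid b t" "right_grid b t \<le> t + 1 / real (Suc b)"
    unfolding right_grid_def by (auto simp: divide_simps simp del: of_nat_Suc)
qed

lemma right_grid_tendsto:
  assumes t: "0 \<le> t"
  shows "filterlim (\<lambda>b. right_grid b t) (at_right t) sequentially"
  unfolding filterlim_at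
proof (intro conjI always_eventually allI)
  show "(\<lambda>b. right_grid b t) \<longlonglongrightarrow> t"
  proof (rule tendsto_sandwich[where f="\<lambda>_. t"])
    show "(\<lambda>b. t + 1 / real (Suc b)) \<longlonglongrightarrow> t"
      using tendsto_add[OF tendsto_const LIMSEQ_inverse_real_of_nat, of t] by (simp add: inverse_eq_divide)
  qed (use right_grid_bounds[OF t] in \<open>auto intro!: always_eventually less_imp_le\<close>)
qed (use right_grid_bounds[OF t] in \<open>auto simp: less_imp_neq[symmetric]\<close>)

text \<open>Coordinates are natural numbers with the discrete topology, so a convergent coordinate
  is eventually constant.\<close>

lemma real_vec_tendsto:
  fixes f :: "'b \<Rightarrow> nat^'d::finite"
  assumes "(f \<longlongrightarrow> z) F"
  shows "((\<lambda>s. real_vec (f s)) \<longlongrightarrow> real_vec z) F"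
  unfolding real_vec_def
proof (rule tendsto_vec_lambda)
  fix j
  have "((\<lambda>s. f s $ j) \<longlongrightarrow> z $ j) F" using assms by (rule tendsto_vec_nth)
  then have "\<forall>\<^sub>F s in F. f s $ j = z $ j" by (simp add: tendsto_discrete)
  then show "((\<lambda>s. real (f s $ j)) \<longlongrightarrow> real (z $ j)) F"
    by (intro tendsto_eventually) (auto elim: eventually_mono)
qed

lemma measurable_path_eval:
  "0 \<le> t \<Longrightarrow> (\<lambda>x. h (x t)) \<in> borel_measurable (path_space :: (real \<Rightarrow> nat^'d::finite) measure)"
  by (rule measurable_compose[OF measurable_component_singleton]) auto

text \<open>Only integer times are used, so that the functional is measurable on the product path
  space. Coordinates are added up and divided by the sum of those of \<open>v\<close> in order to
  recover the scalar \<open>w\<close> from the vector limit \<open>w *\<^sub>R v\<close>.\<close>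

definition growth_limit :: "real \<Rightarrow> real^'d::finite \<Rightarrow> (real \<Rightarrow> nat^'d) \<Rightarrow> real" where
  "growth_limit \<rho> v x = lim (\<lambda>n. exp (- \<rho> * real n) * (\<Sum>j\<in>UNIV. real (x (real n) $ j)) / (\<Sum>j\<in>UNIV. v $ j))"

lemma growth_limit_measurable [measurable]: "growth_limit \<rho> v \<in> borel_measurable path_space"
  unfolding growth_limit_def
  by (intro borel_measurable_lim_metric measurable_path_eval) simp

lemma growth_limit_eq:
  fixes v :: "real^'d::finite"
  assumes v: "\<And>j. 0 < v $ j"
    and lim: "((\<lambda>t. exp (- \<rho> * t) *\<^sub>R real_vec (x t)) \<longlongrightarrow> w *\<^sub>R v) at_top"
  shows "growth_limit \<rho> v x = w"
proof -
  have S: "(\<Sum>j\<in>UNIV. v $ j) > 0" by (intro sum_pos v) auto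
  have "(\<lambda>n. \<Sum>j\<in>UNIV. (exp (- \<rho> * real n) *\<^sub>R real_vec (x (real n))) $ j) \<longlonglongrightarrow> (\<Sum>j\<in>UNIV. (w *\<^sub>R v) $ j)"
    using filterlim_compose[OF lim filterlim_real_sequentially] by (intro tendsto_sum tendsto_vec_nth)
  then have "(\<lambda>n. exp (- \<rho> * real n) * (\<Sum>j\<in>UNIV. real (x (real n) $ j))) \<longlonglongrightarrow> w * (\<Sum>j\<in>UNIV. v $ j)"
    by (simp add: real_vec_def sum_distrib_left)
  then have "(\<lambda>n. exp (- \<rho> * real n) * (\<Sum>j\<in>UNIV. real (x (real n) $ j)) / (\<Sum>j\<in>UNIV. v $ j))
      \<longlonglongrightarrow> w * (\<Sum>j\<in>UNIV. v $ j) / (\<Sum>j\<in>UNIV. v $ j)"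
    using S by (intro tendsto_divide tendsto_const) auto
  then show ?thesis
    unfolding growth_limit_def using S by (intro limI) simp
qed

text \<open>Convergence at infinity along all non-negative rational times, spelled out with
  quantifiers over natural numbers so that it becomes an event of the product path space.\<close>

definition grid_convergent :: "real \<Rightarrow> real^'d::finite \<Rightarrow> (real \<Rightarrow> nat^'d) \<Rightarrow> bool" where
  "grid_convergent \<rho> v x \<longleftrightarrow> (\<forall>k::nat. \<exists>N::nat. \<forall>a b::nat. real N \<le> real a / real (Suc b) \<longrightarrow>
    norm (exp (- \<rho> * (real a / real (Suc b))) *\<^sub>R real_vec (x (real a / real (Suc b))) -
      growth_limit \<rho> v x *\<^sub>R v) < 1 / real (Suc k))"

lemma grid_convergent_measurable [measurable]: "Measurable.pred path_space (grid_convergent \<rho> v)"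
proof -
  have [measurable]: "(\<lambda>x. real_vec (x (real a / real (Suc b)))) \<in> borel_measurable path_space" for a b
    by (rule measurable_path_eval) simp
  show ?thesis
    unfolding grid_convergent_def by measurable
qed

lemma grid_convergentI:
  fixes v :: "real^'d::finite"
  assumes v: "\<And>j. 0 < v $ j"
    and lim: "((\<lambda>t. exp (- \<rho> * t) *\<^sub>R real_vec (x t)) \<longlongrightarrow> w *\<^sub>R v) at_top"
  shows "grid_convergent \<rho> v x"
  unfolding grid_convergent_def growth_limit_eq[OF v lim]
proof (intro allI)
  fix k :: nat
  have "\<forall>\<^sub>F t in at_top. dist (exp (- \<rho> * t) *\<^sub>R real_vec (x t)) (w *\<^sub>R v) < 1 / real (Suc k)"
    by (rule tendstoD[OF lim]) simp
  then obtain B where B: "\<And>t. B \<le> t \<Longrightarrow> dist (exp (- \<rho> * t) *\<^sub>R real_vec (x t)) (w *\<^sub>R v) < 1 / real (Suc k)"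
    by (auto simp: eventually_at_top_linorder)
  obtain N :: nat where "B \<le> real N" using real_arch_simple by blast
  show "\<exists>N. \<forall>a b. real N \<le> real a / real (Suc b) \<longrightarrow>
    norm (exp (- \<rho> * (real a / real (Suc b))) *\<^sub>R real_vec (x (real a / real (Suc b))) -
      w *\<^sub>R v) < 1 / real (Suc k)"
  proof (intro exI allI impI)
    fix a b assume "real N \<le> real a / real (Suc b)"
    with \<open>B \<le> real N\<close> have "B \<le> real a / real (Suc b)" by linarith
    from B[OF this] show "norm (exp (- \<rho> * (real a / real (Suc b))) *\<^sub>R real_vec (x (real a / real (Suc b))) -
      w *\<^sub>R v) < 1 / real (Suc k)"
      by (simp only: dist_norm)
  qed
qed

text \<open>Right continuity extends the convergence from the grid, where it can be read off the law on
  the product space, to all real times.\<close>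

lemma grid_convergent_imp_tendsto:
  fixes v :: "real^'d::finite"
  assumes conv: "grid_convergent \<rho> v x"
    and right: "\<And>t. 0 \<le> t \<Longrightarrow> (x \<longlongrightarrow> x t) (at_right t)"
  shows "((\<lambda>t. exp (- \<rho> * t) *\<^sub>R real_vec (x t)) \<longlongrightarrow> growth_limit \<rho> v x *\<^sub>R v) at_top"
proof (rule tendstoI)
  fix e :: real assume "0 < e"
  then obtain k :: nat where k: "1 / real (Suc k) < e" using nat_approx_posE by blast
  obtain N :: nat where N: "\<And>a b. real N \<le> real a / real (Suc b) \<Longrightarrow>
    norm (exp (- \<rho> * (real a / real (Suc b))) *\<^sub>R real_vec (x (real a / real (Suc b))) -
      growth_limit \<rho> v x *\<^sub>R v) < 1 / real (Suc k)"
    using conv unfolding grid_convergent_def by blast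
  show "\<forall>\<^sub>F t in at_top. dist (exp (- \<rho> * t) *\<^sub>R real_vec (x t)) (growth_limit \<rho> v x *\<^sub>R v) < e"
    using eventually_ge_at_top[of "real N"]
  proof eventually_elim
    case (elim t)
    then have t: "0 \<le> t" using of_nat_0_le_iff[of N] by linarith
    have "(\<lambda>b. norm (exp (- \<rho> * right_grid b t) *\<^sub>R real_vec (x (right_grid b t)) - growth_limit \<rho> v x *\<^sub>R v))
        \<longlonglongrightarrow> norm (exp (- \<rho> * t) *\<^sub>R real_vec (x t) - growth_limit \<rho> v x *\<^sub>R v)"
      using filterlim_compose[OF right[OF t] right_grid_tendsto[OF t]] right_grid_tendsto[OF t]
      by (intro tendsto_intros real_vec_tendsto) (auto simp: filterlim_at)
    \<comment> \<open>Every \<open>right_grid b t\<close> is a grid time beyond \<open>N\<close>, so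
      the bound holds before the limit \<open>b\<close> to infinity. It turns into a weak inequality
      there, for which \<open>k\<close> was chosen with room below \<open>e\<close>.\<close>
    moreover have "norm (exp (- \<rho> * right_grid b t) *\<^sub>R real_vec (x (right_grid b t)) - growth_limit \<rho> v x *\<^sub>R v)
        \<le> 1 / real (Suc k)" for b
      using N[of "Suc (nat \<lfloor>t * real (Suc b)\<rfloor>)" b] right_grid_bounds(1)[OF t, of b] elim
      unfolding right_grid_def[symmetric] by linarith
    ultimately have "norm (exp (- \<rho> * t) *\<^sub>R real_vec (x t) - growth_limit \<rho> v x *\<^sub>R v) \<le> 1 / real (Suc k)"
      by (intro LIMSEQ_le_const2) auto
    with k show ?case by (simp add: dist_norm)
  qed
qed

text \<open>The first claim is where joint measurability in time and \<omega> enters: it permits a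
  random time to be inserted.\<close>

lemma process_copy_measurable:
  assumes copy: "process_copy M0 Z0 M Z"
  shows "f \<in> measurable N M \<Longrightarrow> \<tau> \<in> measurable N halfline \<Longrightarrow>
      (\<lambda>y. Z (\<tau> y) (f y)) \<in> measurable N (count_space UNIV)"
    and "0 \<le> t \<Longrightarrow> Z t \<in> measurable M (count_space UNIV)"
    and "sample_path Z \<in> measurable M path_space"
proof -
  have *: "(\<lambda>(t, \<omega>). Z t \<omega>) \<in> measurable (halfline \<Otimes>\<^sub>M M) (count_space UNIV)"
    using copy by (simp add: process_copy_def)
  show 1: "(\<lambda>y. Z (\<tau> y) (f y)) \<in> measurable N (count_space UNIV)"
    if "f \<in> measurable N M" "\<tau> \<in> measurable N halfline" for f \<tau> and N :: "'z measure"
    using measurable_compose[OF measurable_Pair[OF that(2,1)] *] by simp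
  show 2: "Z t \<in> measurable M (count_space UNIV)" if "0 \<le> t" for t
    using measurable_compose[OF measurable_Pair[OF measurable_const measurable_ident] *, of t] that
    by (simp add: space_restrict_space)
  show "sample_path Z \<in> measurable M path_space"
    unfolding sample_path_def by (rule measurable_restrict) (simp add: 2)
qed

text \<open>\<open>grid_convergent\<close> is an event of the path space, so its probability one
  passes from \<open>M0\<close> to \<open>M\<close> by equality of laws; the right-continuous paths
  of the copy then converge in real time. The limit is a measurable functional of the path and thus
  keeps its law.\<close>

lemma process_copy_growth_limit:
  fixes v :: "real^'d::finite"
  assumes copy: "process_copy M0 Z0 M Z"
    and Z0: "sample_path Z0 \<in> measurable M0 path_space"
    and v: "\<And>j. 0 < v $ j" and W0: "W0 \<in> borel_measurable M0"
    and lim: "AE \<omega> in M0. ((\<lambda>t. exp (- \<rho> * t) *\<^sub>R real_vec (Z0 t \<omega>)) \<longlongrightarrow> W0 \<omega> *\<^sub>R v) at_top"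
  shows "AE \<omega> in M. ((\<lambda>t. exp (- \<rho> * t) *\<^sub>R real_vec (Z t \<omega>)) \<longlongrightarrow>
      growth_limit \<rho> v (sample_path Z \<omega>) *\<^sub>R v) at_top"
    and "distr M borel (\<lambda>\<omega>. growth_limit \<rho> v (sample_path Z \<omega>)) = distr M0 borel W0"
proof -
  have law: "distr M path_space (sample_path Z) = distr M0 path_space (sample_path Z0)"
    and right: "AE \<omega> in M. \<forall>t\<ge>0. ((\<lambda>s. Z s \<omega>) \<longlongrightarrow> Z t \<omega>) (at_right t)"
    using copy by (simp_all add: process_copy_def)
  have Z: "sample_path Z \<in> measurable M path_space" using copy by (rule process_copy_measurable)
  have restrict: "((\<lambda>t. exp (- \<rho> * t) *\<^sub>R real_vec (sample_path Y \<omega> t)) \<longlongrightarrow> w) at_top \<longleftrightarrow>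
      ((\<lambda>t. exp (- \<rho> * t) *\<^sub>R real_vec (Y t \<omega>)) \<longlongrightarrow> w) at_top"
    for Y :: "real \<Rightarrow> 'z \<Rightarrow> nat^'d" and \<omega> w
    by (intro tendsto_cong eventually_mono[OF eventually_ge_at_top[of 0]]) (simp add: sample_path_def)
  have "AE \<omega> in M0. grid_convergent \<rho> v (sample_path Z0 \<omega>)"
    using lim by eventually_elim (rule grid_convergentI[OF v], rule iffD2[OF restrict])
  then have "AE x in distr M0 path_space (sample_path Z0). grid_convergent \<rho> v x"
    using Z0 by (subst AE_distr_iff) auto
  then have "AE \<omega> in M. grid_convergent \<rho> v (sample_path Z \<omega>)"
    unfolding law[symmetric] using Z by (subst (asm) AE_distr_iff) auto
  with right show "AE \<omega> in M. ((\<lambda>t. exp (- \<rho> * t) *\<^sub>R real_vec (Z t \<omega>)) \<longlongrightarrow>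
      growth_limit \<rho> v (sample_path Z \<omega>) *\<^sub>R v) at_top"
  proof eventually_elim
    case (elim \<omega>)
    have "(sample_path Z \<omega> \<longlongrightarrow> sample_path Z \<omega> t) (at_right t)" if "0 \<le> t" for t
    proof -
      have "((\<lambda>s. Z s \<omega>) \<longlongrightarrow> Z t \<omega>) (at_right t)" using elim that by simp
      moreover have "sample_path Z \<omega> t = Z t \<omega>" using that by (simp add: sample_path_def)
      ultimately show ?thesis
        by (simp, elim Lim_transform_eventually)
          (use that in \<open>auto simp: sample_path_def eventually_at_right_field intro!: exI[of _ "t + 1"]\<close>)
    qed
    from grid_convergent_imp_tendsto[OF elim(2) this] show ?case by (rule iffD1[OF restrict])
  qed
  have "distr M borel (\<lambda>\<omega>. growth_limit \<rho> v (sample_path Z \<omega>)) =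
      distr (distr M path_space (sample_path Z)) borel (growth_limit \<rho> v)"
    using Z by (subst distr_distr) (auto simp: comp_def)
  also have "\<dots> = distr M0 borel (\<lambda>\<omega>. growth_limit \<rho> v (sample_path Z0 \<omega>))"
    unfolding law using Z0 by (subst distr_distr) (auto simp: comp_def)
  also have "\<dots> = distr M0 borel W0"
  proof (rule distr_cong_AE)
    show "AE \<omega> in M0. growth_limit \<rho> v (sample_path Z0 \<omega>) = W0 \<omega>"
      using lim by eventually_elim (rule growth_limit_eq[OF v], rule iffD2[OF restrict])
  qed (use Z0 W0 in auto)
  finally show "distr M borel (\<lambda>\<omega>. growth_limit \<rho> v (sample_path Z \<omega>)) = distr M0 borel W0" .
qed

text \<open>Evaluation at a random time is not measurable on the product path space, so the time is first
  moved up to a grid, and Fatou's lemma restores it.\<close>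

lemma mean_at_independent_time:
  fixes h :: "nat^'d::finite \<Rightarrow> real"
  assumes M: "prob_space M" and copy: "process_copy M0 Z0 M Z"
    and indep: "indep_rv M A X path_space (sample_path Z)"
    and h: "\<And>z. 0 \<le> h z" and h_cont: "\<And>f z. f \<longlonglongrightarrow> z \<Longrightarrow> (\<lambda>n. h (f n)) \<longlonglongrightarrow> h z"
    and mean: "\<And>t. 0 \<le> t \<Longrightarrow> (\<integral>\<^sup>+\<omega>. ennreal (h (Z t \<omega>)) \<partial>M) \<le> C * ennreal (exp (\<rho> * t))"
    and g [measurable]: "g \<in> borel_measurable A" and g_finite: "\<And>a. g a < top"
    and \<tau> [measurable]: "\<tau> \<in> borel_measurable A" and \<tau>_nonneg: "\<And>a. g a \<noteq> 0 \<Longrightarrow> 0 \<le> \<tau> a"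
  shows "(\<integral>\<^sup>+\<omega>. g (X \<omega>) * ennreal (h (Z (\<tau> (X \<omega>)) \<omega>)) \<partial>M) \<le>
    C * ennreal (exp \<bar>\<rho>\<bar>) * (\<integral>\<^sup>+\<omega>. g (X \<omega>) * ennreal (exp (\<rho> * \<tau> (X \<omega>))) \<partial>M)"
proof -
  interpret prob_space M by (rule M)
  have [measurable]: "X \<in> measurable M A" and Z [measurable]: "sample_path Z \<in> measurable M path_space"
    using indep by (auto simp: indep_rv_def)
  interpret XA: prob_space "distr M A X" by (rule prob_space_distr) simp
  interpret ZP: prob_space "distr M path_space (sample_path Z)" by (rule prob_space_distr) simp
  have right: "AE \<omega> in M. \<forall>t\<ge>0. ((\<lambda>s. Z s \<omega>) \<longlongrightarrow> Z t \<omega>) (at_right t)"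
    using copy by (simp add: process_copy_def)
  define F where "F b = (\<lambda>z. g (fst z) * ennreal (h (snd z (right_grid b (\<tau> (fst z))))))" for b
  have F [measurable]: "F b \<in> borel_measurable (A \<Otimes>\<^sub>M path_space)" for b
  proof -
    have "(\<lambda>z. ennreal (h (snd z (right_grid b (\<tau> (fst z)))))) \<in> borel_measurable (A \<Otimes>\<^sub>M path_space)"
      unfolding right_grid_def
    proof (rule measurable_compose_countable[where
        f="\<lambda>n z. ennreal (h (snd z (real (Suc n) / real (Suc b))))" and
        g="\<lambda>z. nat \<lfloor>\<tau> (fst z) * real (Suc b)\<rfloor>"])
      fix n
      show "(\<lambda>z. ennreal (h (snd z (real (Suc n) / real (Suc b))))) \<in> borel_measurable (A \<Otimes>\<^sub>M path_space)"
        by (rule measurable_compose[OF measurable_snd measurable_path_eval]) simp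
    qed measurable
    then show ?thesis unfolding F_def by measurable
  qed
  have bound: "(\<integral>\<^sup>+\<omega>. F b (X \<omega>, sample_path Z \<omega>) \<partial>M) \<le>
      C * ennreal (exp \<bar>\<rho>\<bar>) * (\<integral>\<^sup>+\<omega>. g (X \<omega>) * ennreal (exp (\<rho> * \<tau> (X \<omega>))) \<partial>M)" for b
  proof -
    have "(\<integral>\<^sup>+\<omega>. F b (X \<omega>, sample_path Z \<omega>) \<partial>M) =
        (\<integral>\<^sup>+z. F b z \<partial>distr M (A \<Otimes>\<^sub>M path_space) (\<lambda>\<omega>. (X \<omega>, sample_path Z \<omega>)))"
      by (rule nn_integral_distr[symmetric]) auto
    also have "\<dots> = (\<integral>\<^sup>+a. \<integral>\<^sup>+x. F b (a, x) \<partial>distr M path_space (sample_path Z) \<partial>distr M A X)"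
      unfolding indep_rv_distr_pair[OF M indep]
      by (rule ZP.nn_integral_fst[symmetric]) (simp cong: measurable_cong_sets sets_pair_measure_cong)
    also have "\<dots> \<le> (\<integral>\<^sup>+a. C * ennreal (exp \<bar>\<rho>\<bar>) * (g a * ennreal (exp (\<rho> * \<tau> a))) \<partial>distr M A X)"
    proof (rule nn_integral_mono)
      fix a
      show "(\<integral>\<^sup>+x. F b (a, x) \<partial>distr M path_space (sample_path Z)) \<le>
          C * ennreal (exp \<bar>\<rho>\<bar>) * (g a * ennreal (exp (\<rho> * \<tau> a)))"
      proof (cases "g a = 0")
        case True
        then show ?thesis by (simp add: F_def)
      next
        case False
        define q where "q = right_grid b (\<tau> a)"
        have q: "\<tau> a < q" "q \<le> \<tau> a + 1 / real (Suc b)" "0 \<le> q"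
          using right_grid_bounds[OF \<tau>_nonneg[OF False], of b] \<tau>_nonneg[OF False]
          by (auto simp: q_def)
        \<comment> \<open>Rounding moves the time by at most 1 on every grid, so the factor exp
          \<bar>\<rho>\<bar> is uniform in \<open>b\<close>.\<close>
        have "1 / real (Suc b) \<le> 1" by simp
        then have "\<bar>q - \<tau> a\<bar> \<le> 1" using q(1,2) by linarith
        then have "\<bar>\<rho>\<bar> * \<bar>q - \<tau> a\<bar> \<le> \<bar>\<rho>\<bar> * 1"
          by (rule mult_left_mono) simp
        moreover have "\<rho> * (q - \<tau> a) \<le> \<bar>\<rho>\<bar> * \<bar>q - \<tau> a\<bar>"
          unfolding abs_mult[symmetric] by (rule abs_ge_self)
        ultimately have "\<rho> * (q - \<tau> a) \<le> \<bar>\<rho>\<bar>" by simp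
        then have exp_le: "exp (\<rho> * q) \<le> exp \<bar>\<rho>\<bar> * exp (\<rho> * \<tau> a)"
          by (simp add: mult_exp_exp algebra_simps)
        have "(\<integral>\<^sup>+x. F b (a, x) \<partial>distr M path_space (sample_path Z)) =
            g a * (\<integral>\<^sup>+x. ennreal (h (x q)) \<partial>distr M path_space (sample_path Z))"
          unfolding F_def fst_conv snd_conv q_def[symmetric]
          using measurable_path_eval[OF q(3), of "\<lambda>z. ennreal (h z)"] by (intro nn_integral_cmult) simp
        also have "(\<integral>\<^sup>+x. ennreal (h (x q)) \<partial>distr M path_space (sample_path Z)) = (\<integral>\<^sup>+\<omega>. ennreal (h (Z q \<omega>)) \<partial>M)"
          using measurable_path_eval[OF q(3), of "\<lambda>z. ennreal (h z)"] q(3)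
          by (subst nn_integral_distr) (auto simp: sample_path_def)
        also have "g a * \<dots> \<le> g a * (C * ennreal (exp (\<rho> * q)))"
          by (intro mult_left_mono mean q(3)) simp
        also have "\<dots> \<le> g a * (C * ennreal (exp \<bar>\<rho>\<bar> * exp (\<rho> * \<tau> a)))"
          by (intro mult_left_mono ennreal_leI exp_le) auto
        finally show ?thesis by (simp add: ennreal_mult mult_ac)
      qed
    qed
    also have "\<dots> = (\<integral>\<^sup>+\<omega>. C * ennreal (exp \<bar>\<rho>\<bar>) * (g (X \<omega>) * ennreal (exp (\<rho> * \<tau> (X \<omega>)))) \<partial>M)"
      by (rule nn_integral_distr) auto
    also have "\<dots> = C * ennreal (exp \<bar>\<rho>\<bar>) * (\<integral>\<^sup>+\<omega>. g (X \<omega>) * ennreal (exp (\<rho> * \<tau> (X \<omega>))) \<partial>M)"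
      by (rule nn_integral_cmult) measurable
    finally show ?thesis .
  qed
  have "(\<integral>\<^sup>+\<omega>. g (X \<omega>) * ennreal (h (Z (\<tau> (X \<omega>)) \<omega>)) \<partial>M) \<le>
      (\<integral>\<^sup>+\<omega>. liminf (\<lambda>b. F b (X \<omega>, sample_path Z \<omega>)) \<partial>M)"
    using right
  proof (intro nn_integral_mono_AE, eventually_elim)
    case (elim \<omega>)
    show ?case
    proof (cases "g (X \<omega>) = 0")
      case False
      note t = \<tau>_nonneg[OF False]
      have "(\<lambda>b. h (Z (right_grid b (\<tau> (X \<omega>))) \<omega>)) \<longlonglongrightarrow> h (Z (\<tau> (X \<omega>)) \<omega>)"
        using filterlim_compose[OF elim(2)[rule_format, OF t] right_grid_tendsto[OF t]] by (rule h_cont)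
      then have "(\<lambda>b. g (X \<omega>) * ennreal (h (Z (right_grid b (\<tau> (X \<omega>))) \<omega>))) \<longlonglongrightarrow>
          g (X \<omega>) * ennreal (h (Z (\<tau> (X \<omega>)) \<omega>))"
        by (intro ennreal_tendsto_cmult g_finite tendsto_ennrealI)
      moreover have "0 \<le> right_grid b (\<tau> (X \<omega>))" for b
        using right_grid_bounds(1)[OF t, of b] t by simp
      ultimately have "(\<lambda>b. F b (X \<omega>, sample_path Z \<omega>)) \<longlonglongrightarrow> g (X \<omega>) * ennreal (h (Z (\<tau> (X \<omega>)) \<omega>))"
        by (simp add: F_def sample_path_def)
      from lim_imp_Liminf[OF _ this] show ?thesis by simp
    qed simp
  qed
  also have "\<dots> \<le> liminf (\<lambda>b. \<integral>\<^sup>+\<omega>. F b (X \<omega>, sample_path Z \<omega>) \<partial>M)"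
    by (rule nn_integral_liminf) measurable
  also have "\<dots> \<le> C * ennreal (exp \<bar>\<rho>\<bar>) * (\<integral>\<^sup>+\<omega>. g (X \<omega>) * ennreal (exp (\<rho> * \<tau> (X \<omega>))) \<partial>M)"
    by (intro Liminf_le always_eventually allI bound) simp
  finally show ?thesis .
qed

section \<open>Independently marked point processes\<close>

text \<open>The value 0 at absent indices and at atoms in 0 turns sums over the atoms in (0,
  \<infinity>) into series over all indices.\<close>

definition atom_weight :: "real \<Rightarrow> nat \<Rightarrow> enat \<times> (nat \<Rightarrow> real) \<Rightarrow> real" where
  "atom_weight \<rho> i a = (if enat i < fst a \<and> 0 < snd a i then exp (- \<rho> * snd a i) else 0)"

lemma atom_weight_measurable [measurable]: "atom_weight \<rho> i \<in> borel_measurable atoms_space"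
  unfolding atom_weight_def by measurable

lemma atom_weight_nonneg: "0 \<le> atom_weight \<rho> i a"
  by (simp add: atom_weight_def)

lemma atom_weight_atoms:
  "atom_weight \<rho> i (atoms \<kappa> T \<omega>) = (if enat i < \<kappa> \<omega> \<and> 0 < T i \<omega> then exp (- \<rho> * T i \<omega>) else 0)"
  by (simp add: atom_weight_def atoms_def)

lemma AE_summable_norm:
  fixes f :: "nat \<Rightarrow> 'a \<Rightarrow> 'b::{banach, second_countable_topology}"
  assumes f [measurable]: "\<And>i. f i \<in> borel_measurable M"
    and fin: "(\<Sum>i. \<integral>\<^sup>+\<omega>. ennreal (norm (f i \<omega>)) \<partial>M) < \<infinity>"
  shows "AE \<omega> in M. summable (\<lambda>i. norm (f i \<omega>))"
proof -
  have "(\<integral>\<^sup>+\<omega>. (\<Sum>i. ennreal (norm (f i \<omega>))) \<partial>M) \<noteq> \<infinity>"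
    using fin by (subst nn_integral_suminf) auto
  then have "AE \<omega> in M. (\<Sum>i. ennreal (norm (f i \<omega>))) \<noteq> \<infinity>"
    by (intro nn_integral_PInf_AE) auto
  then show ?thesis
    by eventually_elim (auto intro: summable_suminf_not_top)
qed

lemma nn_integral_indep_rv:
  assumes M: "prob_space M" and indep: "indep_rv M A X B Y"
    and F: "F \<in> borel_measurable (A \<Otimes>\<^sub>M B)"
  shows "(\<integral>\<^sup>+\<omega>. F (X \<omega>, Y \<omega>) \<partial>M) = (\<integral>\<^sup>+\<omega>. \<integral>\<^sup>+y. F (X \<omega>, y) \<partial>distr M B Y \<partial>M)"
proof -
  interpret prob_space M by (rule M)
  have [measurable]: "X \<in> measurable M A" "Y \<in> measurable M B"
    using indep by (auto simp: indep_rv_def)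
  interpret Y: prob_space "distr M B Y" by (rule prob_space_distr) simp
  have F': "F \<in> borel_measurable (distr M A X \<Otimes>\<^sub>M distr M B Y)"
    using F by (simp cong: measurable_cong_sets sets_pair_measure_cong)
  have F'': "F \<in> borel_measurable (A \<Otimes>\<^sub>M distr M B Y)"
    using F by (simp cong: measurable_cong_sets sets_pair_measure_cong)
  have "(\<integral>\<^sup>+\<omega>. F (X \<omega>, Y \<omega>) \<partial>M) = (\<integral>\<^sup>+z. F z \<partial>distr M (A \<Otimes>\<^sub>M B) (\<lambda>\<omega>. (X \<omega>, Y \<omega>)))"
    using F by (subst nn_integral_distr) auto
  also have "\<dots> = (\<integral>\<^sup>+a. \<integral>\<^sup>+y. F (a, y) \<partial>distr M B Y \<partial>distr M A X)"
    unfolding indep_rv_distr_pair[OF M indep] by (rule Y.nn_integral_fst[OF F', symmetric])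
  also have "\<dots> = (\<integral>\<^sup>+\<omega>. \<integral>\<^sup>+y. F (X \<omega>, y) \<partial>distr M B Y \<partial>M)"
    using Y.borel_measurable_nn_integral_fst[OF F''] by (subst nn_integral_distr) auto
  finally show ?thesis .
qed

text \<open>By independence the mean of each absolute summand is the mean weight of the atom times
  the common absolute mean of the marks, so the sum of all means is finite.\<close>

lemma AE_summable_marked_atoms:
  fixes V :: "nat \<Rightarrow> 'a \<Rightarrow> real"
  assumes M: "prob_space M"
    and law: "\<And>i. distr M borel (V i) = D"
    and indep: "indep_rv M atoms_space (atoms \<kappa> T) (\<Pi>\<^sub>M i\<in>UNIV. borel) (\<lambda>\<omega> i. V i \<omega>)"
    and D: "(\<integral>\<^sup>+x. ennreal \<bar>x\<bar> \<partial>D) < \<infinity>"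
    and weight: "(\<Sum>i. \<integral>\<^sup>+\<omega>. ennreal (atom_weight \<rho> i (atoms \<kappa> T \<omega>)) \<partial>M) < \<infinity>"
  shows "AE \<omega> in M. summable (\<lambda>i. norm (atom_weight \<rho> i (atoms \<kappa> T \<omega>) * V i \<omega>))"
proof (rule AE_summable_norm)
  have [measurable]: "atoms \<kappa> T \<in> measurable M atoms_space"
    and "(\<lambda>\<omega> i. V i \<omega>) \<in> measurable M (\<Pi>\<^sub>M i\<in>UNIV. borel)"
    using indep by (auto simp: indep_rv_def)
  from measurable_compose[OF this(2) measurable_component_singleton]
  have V [measurable]: "V i \<in> borel_measurable M" for i by simp
  show "(\<lambda>\<omega>. atom_weight \<rho> i (atoms \<kappa> T \<omega>) * V i \<omega>) \<in> borel_measurable M" for i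
    by measurable
  have "(\<integral>\<^sup>+\<omega>. ennreal (norm (atom_weight \<rho> i (atoms \<kappa> T \<omega>) * V i \<omega>)) \<partial>M) =
      (\<integral>\<^sup>+x. ennreal \<bar>x\<bar> \<partial>D) * (\<integral>\<^sup>+\<omega>. ennreal (atom_weight \<rho> i (atoms \<kappa> T \<omega>)) \<partial>M)" for i
  proof -
    have ind: "indep_rv M atoms_space (atoms \<kappa> T) borel (V i)"
      using indep_rv_compose[OF M indep, of "\<lambda>w. w i" borel] by simp
    have "(\<integral>\<^sup>+\<omega>. ennreal (norm (atom_weight \<rho> i (atoms \<kappa> T \<omega>) * V i \<omega>)) \<partial>M) =
        (\<integral>\<^sup>+\<omega>. (\<lambda>z. ennreal (atom_weight \<rho> i (fst z)) * ennreal \<bar>snd z\<bar>) (atoms \<kappa> T \<omega>, V i \<omega>) \<partial>M)"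
      by (intro nn_integral_cong) (simp add: abs_mult atom_weight_nonneg ennreal_mult)
    also have "\<dots> = (\<integral>\<^sup>+\<omega>. \<integral>\<^sup>+x. ennreal (atom_weight \<rho> i (atoms \<kappa> T \<omega>)) * ennreal \<bar>x\<bar> \<partial>D \<partial>M)"
      by (subst nn_integral_indep_rv[OF M ind]) (simp_all add: law)
    also have "\<dots> = (\<integral>\<^sup>+\<omega>. ennreal (atom_weight \<rho> i (atoms \<kappa> T \<omega>)) * (\<integral>\<^sup>+x. ennreal \<bar>x\<bar> \<partial>D) \<partial>M)"
      unfolding law[of i, symmetric] by (intro nn_integral_cong nn_integral_cmult) simp
    also have "\<dots> = (\<integral>\<^sup>+\<omega>. ennreal (atom_weight \<rho> i (atoms \<kappa> T \<omega>)) \<partial>M) * (\<integral>\<^sup>+x. ennreal \<bar>x\<bar> \<partial>D)"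
      by (rule nn_integral_multc) measurable
    finally show ?thesis
      by (simp only: mult.commute)
  qed
  then have "(\<Sum>i. \<integral>\<^sup>+\<omega>. ennreal (norm (atom_weight \<rho> i (atoms \<kappa> T \<omega>) * V i \<omega>)) \<partial>M) =
      (\<integral>\<^sup>+x. ennreal \<bar>x\<bar> \<partial>D) * (\<Sum>i. \<integral>\<^sup>+\<omega>. ennreal (atom_weight \<rho> i (atoms \<kappa> T \<omega>)) \<partial>M)"
    by simp
  then show "(\<Sum>i. \<integral>\<^sup>+\<omega>. ennreal (norm (atom_weight \<rho> i (atoms \<kappa> T \<omega>) * V i \<omega>)) \<partial>M) < \<infinity>"
    using D weight by (simp add: ennreal_mult_less_top)
qed

text \<open>The series is a fixed measurable function of atoms and marks, whose joint law is a
  product. The right-hand side involves the marks through \<open>D\<close> alone, so any two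
  admissible families of marks give series of the same law.\<close>

lemma marked_series_law:
  fixes V :: "nat \<Rightarrow> 'a \<Rightarrow> real"
  assumes M: "prob_space M"
    and law: "\<And>i. distr M borel (V i) = D"
    and iid: "prob_space.indep_vars M (\<lambda>_. borel) V UNIV"
    and indep: "indep_rv M atoms_space (atoms \<kappa> T) (\<Pi>\<^sub>M i\<in>UNIV. borel) (\<lambda>\<omega> i. V i \<omega>)"
  shows "distr M borel (\<lambda>\<omega>. (\<Sum>i. atom_weight \<rho> i (atoms \<kappa> T \<omega>) * V i \<omega>) *\<^sub>R v) =
    distr (distr M atoms_space (atoms \<kappa> T) \<Otimes>\<^sub>M (\<Pi>\<^sub>M i\<in>UNIV. D)) borel
      (\<lambda>z. (\<Sum>i. atom_weight \<rho> i (fst z) * snd z i) *\<^sub>R (v :: real^'d::finite))"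
proof -
  let ?J = "\<lambda>\<omega>. (atoms \<kappa> T \<omega>, \<lambda>i. V i \<omega>)"
  let ?H = "\<lambda>z. (\<Sum>i. atom_weight \<rho> i (fst z) * snd z i) *\<^sub>R v"
  have [measurable]: "atoms \<kappa> T \<in> measurable M atoms_space"
    "(\<lambda>\<omega> i. V i \<omega>) \<in> measurable M (\<Pi>\<^sub>M i\<in>UNIV. borel)"
    using indep by (auto simp: indep_rv_def)
  have [measurable]: "?H \<in> borel_measurable (atoms_space \<Otimes>\<^sub>M (\<Pi>\<^sub>M i\<in>UNIV. borel))"
    by measurable
  have "distr M (atoms_space \<Otimes>\<^sub>M (\<Pi>\<^sub>M i\<in>UNIV. borel)) ?J =
      distr M atoms_space (atoms \<kappa> T) \<Otimes>\<^sub>M (\<Pi>\<^sub>M i\<in>UNIV. D)"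
    using indep_rv_distr_pair[OF M indep] iid_distr_PiM[OF M iid law] by simp
  moreover have "distr M borel (\<lambda>\<omega>. ?H (?J \<omega>)) =
      distr (distr M (atoms_space \<Otimes>\<^sub>M (\<Pi>\<^sub>M i\<in>UNIV. borel)) ?J) borel ?H"
    by (subst distr_distr) (auto simp: comp_def)
  ultimately show ?thesis by simp
qed

text \<open>For finitely many terms both sides agree by conditioning on the atoms. All exponentials
  lie between 0 and 1, since the marks are non-negative almost surely and \<open>L\<close> takes
  values in (0, 1], so both sides pass to the infinite series by dominated convergence.\<close>

lemma marked_series_laplace:
  fixes V :: "nat \<Rightarrow> 'a \<Rightarrow> real"
  assumes M: "prob_space M"
    and law: "\<And>i. distr M borel (V i) = D"
    and iid: "prob_space.indep_vars M (\<lambda>_. borel) V UNIV"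
    and indep: "indep_rv M atoms_space (atoms \<kappa> T) (\<Pi>\<^sub>M i\<in>UNIV. borel) (\<lambda>\<omega> i. V i \<omega>)"
    and nonneg: "AE x in D. 0 \<le> x" and c: "0 \<le> c"
    and summable: "AE \<omega> in M. summable (\<lambda>i. norm (atom_weight \<rho> i (atoms \<kappa> T \<omega>) * V i \<omega>))"
  shows "(\<integral>\<omega>. exp (- (c * (\<Sum>i. atom_weight \<rho> i (atoms \<kappa> T \<omega>) * V i \<omega>))) \<partial>M) =
    (\<integral>\<omega>. exp_neg (\<Sum>i. ennreal (- ln (\<integral>x. exp (- (c * atom_weight \<rho> i (atoms \<kappa> T \<omega>) * x)) \<partial>D))) \<partial>M)"
proof -
  interpret prob_space M by (rule M)
  have atoms [measurable]: "atoms \<kappa> T \<in> measurable M atoms_space"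
    and V' [measurable]: "(\<lambda>\<omega> i. V i \<omega>) \<in> measurable M (\<Pi>\<^sub>M i\<in>UNIV. borel)"
    using indep by (auto simp: indep_rv_def)
  from measurable_compose[OF V' measurable_component_singleton]
  have V [measurable]: "V i \<in> borel_measurable M" for i by simp
  have sets_D [simp, measurable_cong]: "sets D = sets borel"
    unfolding law[of 0, symmetric] by simp
  interpret D: prob_space D
    unfolding law[of 0, symmetric] by (rule prob_space_distr) simp
  interpret PD: product_prob_space "\<lambda>_::nat. D" UNIV ..
  define L where "L r = (\<integral>x. exp (- (r * x)) \<partial>D)" for r
  have exp_int: "integrable D (\<lambda>x. exp (- (r * x)))" if "0 \<le> r" for r
    using nonneg that by (intro D.integrable_const_bound[where B=1]) (auto elim!: eventually_mono)
  have L_le: "L r \<le> 1" if "0 \<le> r" for r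
    unfolding L_def using nonneg that exp_int
    by (intro D.integral_le_const) (auto elim!: eventually_mono)
  have L_pos: "0 < L r" if "0 \<le> r" for r
  proof -
    have "0 \<le> L r" unfolding L_def by (rule integral_nonneg_AE) simp
    moreover have "L r \<noteq> 0"
    proof
      assume "L r = 0"
      then have "AE x in D. exp (- (r * x)) = 0"
        unfolding L_def using exp_int[OF that] by (subst (asm) integral_nonneg_eq_0_iff_AE) auto
      then show False using D.AE_const[of False] by simp
    qed
    ultimately show ?thesis by simp
  qed
  have L_nn: "(\<integral>\<^sup>+x. ennreal (exp (- (r * x))) \<partial>D) = ennreal (L r)" if "0 \<le> r" for r
    unfolding L_def by (intro nn_integral_eq_integral exp_int that) simp
  have [measurable]: "L \<in> borel_measurable borel"
    unfolding L_def by measurable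
  define r where "r i \<omega> = c * atom_weight \<rho> i (atoms \<kappa> T \<omega>)" for i \<omega>
  have r: "0 \<le> r i \<omega>" for i \<omega> by (simp add: r_def c atom_weight_nonneg)
  have [measurable]: "r i \<in> borel_measurable M" for i unfolding r_def by measurable
  have V_nonneg: "AE \<omega> in M. \<forall>i. 0 \<le> V i \<omega>"
    unfolding AE_all_countable
  proof
    fix i show "AE \<omega> in M. 0 \<le> V i \<omega>"
      using nonneg unfolding law[of i, symmetric] by (subst (asm) AE_distr_iff) auto
  qed
  \<comment> \<open>Given the atoms, the first \<open>n\<close> marks are independent with law
    \<open>D\<close>, so the expectation is a product of values of \<open>L\<close>; as these are
    positive, the product can be written through logarithms.\<close>
  have partial: "(\<integral>\<omega>. exp (- (\<Sum>i<n. r i \<omega> * V i \<omega>)) \<partial>M) = (\<integral>\<omega>. exp (- (\<Sum>i<n. - ln (L (r i \<omega>)))) \<partial>M)" for n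
  proof -
    define F where "F z = (\<Prod>i<n. ennreal (exp (- (c * atom_weight \<rho> i (fst z) * snd z i))))"
      for z :: "(enat \<times> (nat \<Rightarrow> real)) \<times> (nat \<Rightarrow> real)"
    have F: "F \<in> borel_measurable (atoms_space \<Otimes>\<^sub>M (\<Pi>\<^sub>M i\<in>UNIV. borel))"
      unfolding F_def by measurable
    have "(\<integral>\<^sup>+\<omega>. ennreal (exp (- (\<Sum>i<n. r i \<omega> * V i \<omega>))) \<partial>M) = (\<integral>\<^sup>+\<omega>. F (atoms \<kappa> T \<omega>, \<lambda>i. V i \<omega>) \<partial>M)"
      by (simp add: F_def r_def prod_ennreal exp_sum[symmetric] sum_negf)
    also have "\<dots> = (\<integral>\<^sup>+\<omega>. \<integral>\<^sup>+w. F (atoms \<kappa> T \<omega>, w) \<partial>(\<Pi>\<^sub>M i\<in>UNIV. D) \<partial>M)"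
      using nn_integral_indep_rv[OF M indep F] iid_distr_PiM[OF M iid law] by simp
    also have "\<dots> = (\<integral>\<^sup>+\<omega>. (\<Prod>i<n. ennreal (L (r i \<omega>))) \<partial>M)"
    proof (intro nn_integral_cong)
      fix \<omega>
      have "(\<integral>\<^sup>+w. F (atoms \<kappa> T \<omega>, w) \<partial>(\<Pi>\<^sub>M i\<in>UNIV. D)) =
          (\<Prod>i<n. \<integral>\<^sup>+x. ennreal (exp (- (r i \<omega> * x))) \<partial>D)"
        unfolding F_def r_def fst_conv snd_conv by (rule PD.nn_integral_PiM_prod) auto
      then show "(\<integral>\<^sup>+w. F (atoms \<kappa> T \<omega>, w) \<partial>(\<Pi>\<^sub>M i\<in>UNIV. D)) = (\<Prod>i<n. ennreal (L (r i \<omega>)))"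
        by (simp add: L_nn r)
    qed
    also have "\<dots> = (\<integral>\<^sup>+\<omega>. ennreal (exp (- (\<Sum>i<n. - ln (L (r i \<omega>))))) \<partial>M)"
      using L_pos[OF r] by (simp add: prod_ennreal less_imp_le sum_negf exp_sum)
    finally show ?thesis
      by (subst (1 2) integral_eq_nn_integral) auto
  qed
  have "(\<lambda>n. \<integral>\<omega>. exp (- (\<Sum>i<n. r i \<omega> * V i \<omega>)) \<partial>M) \<longlonglongrightarrow>
      (\<integral>\<omega>. exp (- (c * (\<Sum>i. atom_weight \<rho> i (atoms \<kappa> T \<omega>) * V i \<omega>))) \<partial>M)"
  proof (rule integral_dominated_convergence[where w="\<lambda>_. 1"])
    show "AE \<omega> in M. (\<lambda>n. exp (- (\<Sum>i<n. r i \<omega> * V i \<omega>))) \<longlonglongrightarrow>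
      exp (- (c * (\<Sum>i. atom_weight \<rho> i (atoms \<kappa> T \<omega>) * V i \<omega>)))"
      using summable
    proof eventually_elim
      case (elim \<omega>)
      from sums_mult[OF summable_sums[OF summable_norm_cancel[OF elim]], of c] show ?case
        by (intro tendsto_intros) (simp add: sums_def r_def mult.assoc)
    qed
    show "AE \<omega> in M. norm (exp (- (\<Sum>i<n. r i \<omega> * V i \<omega>))) \<le> 1" for n
      using V_nonneg by eventually_elim (auto intro!: sum_nonneg mult_nonneg_nonneg r)
  qed auto
  moreover have "(\<lambda>n. \<integral>\<omega>. exp (- (\<Sum>i<n. - ln (L (r i \<omega>)))) \<partial>M) \<longlonglongrightarrow>
      (\<integral>\<omega>. exp_neg (\<Sum>i. ennreal (- ln (L (r i \<omega>)))) \<partial>M)"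
  proof (rule integral_dominated_convergence[where w="\<lambda>_. 1"])
    have neg: "0 \<le> - ln (L (r i \<omega>))" for i \<omega>
      using L_le[OF r[of i \<omega>]] L_pos[OF r[of i \<omega>]] by simp
    show "AE \<omega> in M. (\<lambda>n. exp (- (\<Sum>i<n. - ln (L (r i \<omega>))))) \<longlonglongrightarrow>
        exp_neg (\<Sum>i. ennreal (- ln (L (r i \<omega>))))"
      by (intro AE_I2 exp_neg_sum_tendsto neg)
    show "AE \<omega> in M. norm (exp (- (\<Sum>i<n. - ln (L (r i \<omega>))))) \<le> 1" for n
      using neg by (intro AE_I2) (simp add: sum_nonneg del: sum_negf)
    show "(\<lambda>\<omega>. exp_neg (\<Sum>i. ennreal (- ln (L (r i \<omega>))))) \<in> borel_measurable M"
      unfolding exp_neg_def by measurable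
  qed auto
  ultimately show ?thesis
    unfolding partial unfolding L_def[symmetric] r_def by (rule LIMSEQ_unique)
qed

section \<open>Random series\<close>

lemma summable_norm_iff_suminf_ennreal:
  fixes f :: "nat \<Rightarrow> 'b::real_normed_vector"
  shows "summable (\<lambda>i. norm (f i)) \<longleftrightarrow> (\<Sum>i. ennreal (norm (f i))) \<noteq> \<infinity>"
proof
  assume "summable (\<lambda>i. norm (f i))"
  then have "(\<Sum>i. ennreal (norm (f i))) = ennreal (\<Sum>i. norm (f i))"
    by (rule suminf_ennreal2[OF norm_ge_zero])
  then show "(\<Sum>i. ennreal (norm (f i))) \<noteq> \<infinity>" by simp
next
  assume "(\<Sum>i. ennreal (norm (f i))) \<noteq> \<infinity>"
  then show "summable (\<lambda>i. norm (f i))"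
    by (intro summable_suminf_not_top) simp_all
qed

lemma suminf_norm_tail:
  fixes f :: "nat \<Rightarrow> 'b::banach"
  assumes "summable (\<lambda>i. norm (f i))"
  shows "ennreal (norm (\<Sum>i. f (i + n))) \<le> (\<Sum>i. ennreal (norm (f (i + n))))"
proof -
  have s: "summable (\<lambda>i. norm (f (i + n)))" using summable_ignore_initial_segment[OF assms] .
  have "ennreal (norm (\<Sum>i. f (i + n))) \<le> ennreal (\<Sum>i. norm (f (i + n)))"
    by (intro ennreal_leI summable_norm s)
  also have "\<dots> = (\<Sum>i. ennreal (norm (f (i + n))))"
    by (rule suminf_ennreal2[symmetric]) (use s in auto)
  finally show ?thesis .
qed

text \<open>Cut after \<open>n\<close> terms. The head converges almost surely and is truncated at
  1, so its mean vanishes as \<open>t\<close> grows. The tails of both series have mean at most that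
  of \<open>b\<close>, uniformly in \<open>t\<close>, whence the factor 2; the limits
  \<open>X i\<close> inherit the bound by Fatou's lemma.\<close>

lemma random_series_tendsto:
  fixes Y :: "nat \<Rightarrow> real \<Rightarrow> 'a \<Rightarrow> 'b::{banach, second_countable_topology}"
  assumes M: "prob_space M"
    and Y [measurable]: "\<And>i t. Y i t \<in> borel_measurable M"
    and X [measurable]: "\<And>i. X i \<in> borel_measurable M"
    and lim: "\<And>i. AE \<omega> in M. ((\<lambda>t. Y i t \<omega>) \<longlongrightarrow> X i \<omega>) at_top"
    and bound: "\<And>i t. (\<integral>\<^sup>+\<omega>. ennreal (norm (Y i t \<omega>)) \<partial>M) \<le> ennreal (b i)"
    and b: "summable b" "\<And>i. 0 \<le> b i"
  shows "((\<lambda>t. \<integral>\<omega>. min 1 (dist (\<Sum>i. Y i t \<omega>) (\<Sum>i. X i \<omega>)) \<partial>M) \<longlongrightarrow> 0) at_top"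
proof -
  interpret prob_space M by (rule M)
  have bound': "(\<integral>\<^sup>+\<omega>. ennreal (norm (X i \<omega>)) \<partial>M) \<le> ennreal (b i)" for i
  proof -
    have "(\<integral>\<^sup>+\<omega>. ennreal (norm (X i \<omega>)) \<partial>M) = (\<integral>\<^sup>+\<omega>. liminf (\<lambda>n. ennreal (norm (Y i (real n) \<omega>))) \<partial>M)"
      using lim[of i]
    proof (intro nn_integral_cong_AE, eventually_elim)
      case (elim \<omega>)
      have "(\<lambda>n. ennreal (norm (Y i (real n) \<omega>))) \<longlonglongrightarrow> ennreal (norm (X i \<omega>))"
        by (intro tendsto_ennrealI tendsto_norm filterlim_compose[OF elim(2) filterlim_real_sequentially])
      from lim_imp_Liminf[OF _ this] show ?case by simp
    qed
    also have "\<dots> \<le> liminf (\<lambda>n. \<integral>\<^sup>+\<omega>. ennreal (norm (Y i (real n) \<omega>)) \<partial>M)"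
      by (rule nn_integral_liminf) measurable
    also have "\<dots> \<le> ennreal (b i)"
      by (intro Liminf_le always_eventually allI bound) simp
    finally show ?thesis .
  qed
  have tail: "(\<Sum>i. \<integral>\<^sup>+\<omega>. ennreal (norm (f (i + n) \<omega>)) \<partial>M) \<le> ennreal (\<Sum>i. b (i + n))"
    if "\<And>i. (\<integral>\<^sup>+\<omega>. ennreal (norm (f i \<omega>)) \<partial>M) \<le> ennreal (b i)" for f :: "nat \<Rightarrow> 'a \<Rightarrow> 'b" and n
  proof -
    have "(\<Sum>i. \<integral>\<^sup>+\<omega>. ennreal (norm (f (i + n) \<omega>)) \<partial>M) \<le> (\<Sum>i. ennreal (b (i + n)))"
      by (intro suminf_le that summableI)
    also have "\<dots> = ennreal (\<Sum>i. b (i + n))"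
      using b summable_ignore_initial_segment[OF b(1), of n] by (intro suminf_ennreal2) auto
    finally show ?thesis .
  qed
  have summable: "AE \<omega> in M. summable (\<lambda>i. norm (f i \<omega>))"
    if "\<And>i. f i \<in> borel_measurable M" "\<And>i. (\<integral>\<^sup>+\<omega>. ennreal (norm (f i \<omega>)) \<partial>M) \<le> ennreal (b i)"
    for f :: "nat \<Rightarrow> 'a \<Rightarrow> 'b"
  proof (rule AE_summable_norm[OF that(1)])
    show "(\<Sum>i. \<integral>\<^sup>+\<omega>. ennreal (norm (f i \<omega>)) \<partial>M) < \<infinity>"
      using tail[of f 0, OF that(2)] by (auto simp: less_top[symmetric] top_unique)
  qed
  have min_le: "norm (min 1 (\<Sum>i<n. dist (Y i t \<omega>) (X i \<omega>))) \<le> 1" for n t \<omega>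
  proof -
    have "0 \<le> (\<Sum>i<n. dist (Y i t \<omega>) (X i \<omega>))" by (intro sum_nonneg) simp
    then show ?thesis by (simp add: min_def)
  qed
  define e where "e n t = (\<integral>\<omega>. min 1 (\<Sum>i<n. dist (Y i t \<omega>) (X i \<omega>)) \<partial>M)" for n t
  have main: "(\<integral>\<omega>. min 1 (dist (\<Sum>i. Y i t \<omega>) (\<Sum>i. X i \<omega>)) \<partial>M) \<le> e n t + 2 * (\<Sum>i. b (i + n))" for n t
  proof -
    have pos: "0 \<le> (\<Sum>i. b (i + n))"
      using b summable_ignore_initial_segment[OF b(1), of n] by (intro suminf_nonneg) auto
    have e0: "0 \<le> e n t" unfolding e_def by (intro integral_nonneg_AE AE_I2) (auto intro!: sum_nonneg)
    have "ennreal (\<integral>\<omega>. min 1 (dist (\<Sum>i. Y i t \<omega>) (\<Sum>i. X i \<omega>)) \<partial>M) =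
        (\<integral>\<^sup>+\<omega>. ennreal (min 1 (dist (\<Sum>i. Y i t \<omega>) (\<Sum>i. X i \<omega>))) \<partial>M)"
      by (intro nn_integral_eq_integral[symmetric] integrable_const_bound[where B=1]) auto
    also have "\<dots> \<le> (\<integral>\<^sup>+\<omega>. ennreal (min 1 (\<Sum>i<n. dist (Y i t \<omega>) (X i \<omega>))) +
        ((\<Sum>i. ennreal (norm (Y (i + n) t \<omega>))) + (\<Sum>i. ennreal (norm (X (i + n) \<omega>)))) \<partial>M)"
      using summable[of "\<lambda>i. Y i t", OF Y bound] summable[of X, OF X bound']
    proof (intro nn_integral_mono_AE, eventually_elim)
      case (elim \<omega>)
      define y x where "y = (\<Sum>i. Y (i + n) t \<omega>)" and "x = (\<Sum>i. X (i + n) \<omega>)"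
      define d where "d = (\<Sum>i<n. dist (Y i t \<omega>) (X i \<omega>))"
      have "(\<Sum>i. Y i t \<omega>) = y + (\<Sum>i<n. Y i t \<omega>)" "(\<Sum>i. X i \<omega>) = x + (\<Sum>i<n. X i \<omega>)"
        unfolding x_def y_def using elim by (auto intro!: suminf_split_initial_segment summable_norm_cancel)
      then have "dist (\<Sum>i. Y i t \<omega>) (\<Sum>i. X i \<omega>) = norm ((\<Sum>i<n. Y i t \<omega> - X i \<omega>) + (y - x))"
        by (simp add: dist_norm sum_subtractf algebra_simps)
      also have "\<dots> \<le> norm (\<Sum>i<n. Y i t \<omega> - X i \<omega>) + (norm y + norm x)"
        by (intro norm_triangle_le add_mono norm_triangle_ineq4 order_refl)
      also have "norm (\<Sum>i<n. Y i t \<omega> - X i \<omega>) \<le> d"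
        unfolding d_def dist_norm by (rule norm_sum)
      finally have "min 1 (dist (\<Sum>i. Y i t \<omega>) (\<Sum>i. X i \<omega>)) \<le> min 1 d + (norm y + norm x)"
        using norm_ge_zero[of y] norm_ge_zero[of x] by linarith
      moreover have "0 \<le> d" by (simp add: d_def sum_nonneg)
      ultimately have "ennreal (min 1 (dist (\<Sum>i. Y i t \<omega>) (\<Sum>i. X i \<omega>))) \<le>
          ennreal (min 1 d) + (ennreal (norm y) + ennreal (norm x))"
        by (simp add: ennreal_plus[symmetric] ennreal_leI del: ennreal_plus)
      also have "\<dots> \<le> ennreal (min 1 d) +
          ((\<Sum>i. ennreal (norm (Y (i + n) t \<omega>))) + (\<Sum>i. ennreal (norm (X (i + n) \<omega>))))"
        unfolding x_def y_def using elim by (intro add_mono order_refl suminf_norm_tail)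
      finally show ?case unfolding d_def .
    qed
    also have "\<dots> = (\<integral>\<^sup>+\<omega>. ennreal (min 1 (\<Sum>i<n. dist (Y i t \<omega>) (X i \<omega>))) \<partial>M) +
        ((\<Sum>i. \<integral>\<^sup>+\<omega>. ennreal (norm (Y (i + n) t \<omega>)) \<partial>M) + (\<Sum>i. \<integral>\<^sup>+\<omega>. ennreal (norm (X (i + n) \<omega>)) \<partial>M))"
      by (simp add: nn_integral_add nn_integral_suminf)
    also have "(\<integral>\<^sup>+\<omega>. ennreal (min 1 (\<Sum>i<n. dist (Y i t \<omega>) (X i \<omega>))) \<partial>M) = ennreal (e n t)"
      unfolding e_def by (intro nn_integral_eq_integral integrable_const_bound[where B=1] AE_I2 min_le)
        (auto intro!: sum_nonneg)
    also have "\<dots> + ((\<Sum>i. \<integral>\<^sup>+\<omega>. ennreal (norm (Y (i + n) t \<omega>)) \<partial>M) + (\<Sum>i. \<integral>\<^sup>+\<omega>. ennreal (norm (X (i + n) \<omega>)) \<partial>M))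
        \<le> ennreal (e n t) + (ennreal (\<Sum>i. b (i + n)) + ennreal (\<Sum>i. b (i + n)))"
      using tail[of "\<lambda>i. Y i t" n, OF bound] tail[of X n, OF bound'] by (intro add_mono order_refl)
    also have "\<dots> = ennreal (e n t + 2 * (\<Sum>i. b (i + n)))"
      using pos e0 by (simp add: ennreal_plus[symmetric] del: ennreal_plus)
    finally show ?thesis
      using pos e0 by (subst (asm) ennreal_le_iff) auto
  qed
  have e_tendsto: "(e n \<longlongrightarrow> 0) at_top" for n
  proof -
    have "((\<lambda>t. \<integral>\<omega>. min 1 (\<Sum>i<n. dist (Y i t \<omega>) (X i \<omega>)) \<partial>M) \<longlongrightarrow> (\<integral>\<omega>. 0 \<partial>M)) at_top"
    proof (rule integral_dominated_convergence_at_top[where w="\<lambda>_. 1"])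
      have "AE \<omega> in M. \<forall>i. ((\<lambda>t. Y i t \<omega>) \<longlongrightarrow> X i \<omega>) at_top"
        using lim by (simp add: AE_all_countable)
      then show "AE \<omega> in M. ((\<lambda>t. min 1 (\<Sum>i<n. dist (Y i t \<omega>) (X i \<omega>))) \<longlongrightarrow> 0) at_top"
      proof eventually_elim
        case (elim \<omega>)
        have "((\<lambda>t. dist (Y i t \<omega>) (X i \<omega>)) \<longlongrightarrow> 0) at_top" for i
          using elim by (intro iffD1[OF tendsto_dist_iff]) simp
        then have "((\<lambda>t. \<Sum>i<n. dist (Y i t \<omega>) (X i \<omega>)) \<longlongrightarrow> (\<Sum>i<n. 0)) at_top"
          by (intro tendsto_sum)
        from tendsto_min[OF tendsto_const this, of 1] show ?case by simp
      qed
      show "\<forall>\<^sub>F t in at_top. AE \<omega> in M. norm (min 1 (\<Sum>i<n. dist (Y i t \<omega>) (X i \<omega>))) \<le> 1"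
        by (intro always_eventually allI AE_I2 min_le)
    qed auto
    then show ?thesis by (simp add: e_def[abs_def])
  qed
  show ?thesis
  proof (rule tendstoI)
    fix r :: real assume r: "0 < r"
    \<comment> \<open>The tails enter twice, so r / 4 for them and r / 2 for the head add up to
      \<open>r\<close>.\<close>
    have "\<forall>\<^sub>F n in sequentially. dist (\<Sum>i. b (i + n)) 0 < r / 4"
      using suminf_exist_split2[OF b(1)] r by (intro tendstoD) auto
    then obtain n where n: "norm (\<Sum>i. b (i + n)) < r / 4"
      by (auto simp: eventually_sequentially)
    have "\<forall>\<^sub>F t in at_top. dist (e n t) 0 < r / 2"
      using e_tendsto r by (intro tendstoD) auto
    then show "\<forall>\<^sub>F t in at_top. dist (\<integral>\<omega>. min 1 (dist (\<Sum>i. Y i t \<omega>) (\<Sum>i. X i \<omega>)) \<partial>M) 0 < r"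
    proof eventually_elim
      case (elim t)
      have "0 \<le> (\<integral>\<omega>. min 1 (dist (\<Sum>i. Y i t \<omega>) (\<Sum>i. X i \<omega>)) \<partial>M)"
        by (intro integral_nonneg_AE AE_I2) simp
      with main[of t n] n elim show ?case by (auto simp: dist_real_def)
    qed
  qed
qed

text \<open>The inner product with \<open>v\<close> reduces the claim to real series, where
  unordered and absolute summability coincide.\<close>

lemma summable_on_scaleR_iff:
  fixes a :: "nat \<Rightarrow> real" and v :: "'b::{real_inner, banach}"
  assumes v: "v \<noteq> 0"
  shows "(\<lambda>i. a i *\<^sub>R v) summable_on UNIV \<longleftrightarrow> summable (\<lambda>i. norm (a i))"
proof
  assume "(\<lambda>i. a i *\<^sub>R v) summable_on UNIV"
  then have "(\<lambda>i. (a i *\<^sub>R v) \<bullet> v) summable_on UNIV"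
    by (rule summable_on_bounded_linear[OF bounded_linear_inner_left])
  then have "a summable_on UNIV"
    using v by (simp add: summable_on_cmult_left')
  then have "(\<lambda>i. norm (a i)) summable_on UNIV"
    by (rule iffD1[OF summable_on_iff_abs_summable_on_real])
  then show "summable (\<lambda>i. norm (a i))"
    by (rule summable_on_imp_summable)
qed (intro norm_summable_imp_summable_on, simp add: summable_mult2)

text \<open>Without absolute summability the unordered sum is 0 by convention. The explicit case
  distinction makes it possible to prove that a random unordered sum is measurable.\<close>

lemma infsum_scaleR_eq_suminf:
  fixes a :: "nat \<Rightarrow> real" and v :: "'b::{real_inner, banach}"
  assumes v: "v \<noteq> 0"
  shows "(\<Sum>\<^sub>\<infinity>i. a i *\<^sub>R v) = (if summable (\<lambda>i. norm (a i)) then (\<Sum>i. a i) *\<^sub>R v else 0)"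
proof (cases "summable (\<lambda>i. norm (a i))")
  case True
  have "(a has_sum (\<Sum>i. a i)) UNIV"
    by (rule norm_summable_imp_has_sum[OF True summable_sums[OF summable_norm_cancel[OF True]]])
  from has_sum_bounded_linear[OF bounded_linear_scaleR_left this, of v] True show ?thesis
    by (simp add: infsumI)
next
  case False
  then show ?thesis using summable_on_scaleR_iff[OF v, of a] by (simp add: infsum_not_exists)
qed

section \<open>The process with immigration\<close>

theorem theorem5p2:
  fixes \<mu> :: "'d::finite \<Rightarrow> real"
    and \<nu> :: "'d \<Rightarrow> (nat^'d) pmf"
    and I :: "(nat^'d) pmf"
    and \<rho> :: real
    and u v :: "real^'d"
    and M0 :: "'b measure"
    and Z0 :: "real \<Rightarrow> 'b \<Rightarrow> nat^'d"
    and W0 :: "'b \<Rightarrow> real"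
    and \<Lambda> :: "real measure"
    and K :: "real \<Rightarrow> real \<Rightarrow> real"
    and M :: "'a measure"
    and \<kappa> :: "'a \<Rightarrow> enat"
    and T :: "nat \<Rightarrow> 'a \<Rightarrow> real"
    and Z :: "nat \<Rightarrow> real \<Rightarrow> 'a \<Rightarrow> nat^'d"
  assumes lifetime_pos: "\<And>i. 0 < \<mu> i"
    and initial_integrable: "\<And>j. integrable (measure_pmf I) (\<lambda>x. real (x $ j))"
    and offspring_integrable: "\<And>i j. integrable (measure_pmf (\<nu> i)) (\<lambda>x. real (x $ j))"
    and offspring_nonconst:
      "\<exists>i. \<not> (\<exists>c. AE x in measure_pmf (\<nu> i). (\<Sum>j\<in>UNIV. x $ j) = c)"
    and primitive: "primitive_matrix (mean_offspring \<nu>)"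
    and irreducible: "irreducible_matrix (mean_generator \<mu> \<nu>)"
    and perron: "perron_root (mean_generator \<mu> \<nu>) \<rho>"
    and u_pos: "\<And>i. 0 < u $ i"
    and v_pos: "\<And>i. 0 < v $ i"
    and u_eigen: "mean_generator \<mu> \<nu> *v u = \<rho> *s u"
    and v_eigen: "v v* mean_generator \<mu> \<nu> = \<rho> *s v"
    and uv_norm: "(\<Sum>i\<in>UNIV. u $ i * v $ i) = 1"
    and u_norm: "(\<Sum>i\<in>UNIV. u $ i) = 1"
    and Z0: "branching_process \<mu> \<nu> I M0 Z0"
    and W0_measurable: "W0 \<in> borel_measurable M0"
    and W0_limit: "AE \<omega> in M0.
      ((\<lambda>t. exp (- \<rho> * t) *\<^sub>R real_vec (Z0 t \<omega>)) \<longlongrightarrow> W0 \<omega> *\<^sub>R v) at_top"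
    and M: "prob_space M"
    and kernel: "admissible_kernel \<Lambda> K"
    and \<Phi>: "determinantal_process \<Lambda> K M \<kappa> T"
    and Z_copies: "\<And>i. process_copy M0 Z0 M (Z i)"
    and Z_indep: "prob_space.indep_vars M (\<lambda>_. path_space) (\<lambda>i. sample_path (Z i)) UNIV"
    and Z_indep_\<Phi>: "indep_rv M atoms_space (atoms \<kappa> T)
      (\<Pi>\<^sub>M i\<in>UNIV. path_space) (\<lambda>\<omega> i. sample_path (Z i) \<omega>)"
    and finite_integral: "(\<integral>\<^sup>+x\<in>{0<..}. ennreal (exp (- \<rho> * x) * K x x) \<partial>\<Lambda>) < \<infinity>"
  shows "\<exists>W :: 'a \<Rightarrow> real^'d.
    W \<in> borel_measurable M \<and>
    converges_in_distribution M
      (\<lambda>t \<omega>. immigration_process \<kappa> T Z t \<omega> /\<^sub>R exp (\<rho> * t)) W at_top \<and>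
    (\<forall>V :: nat \<Rightarrow> 'a \<Rightarrow> real.
      (\<forall>i. distr M borel (V i) = distr M0 borel W0) \<longrightarrow>
      prob_space.indep_vars M (\<lambda>_. borel) V UNIV \<longrightarrow>
      indep_rv M atoms_space (atoms \<kappa> T) (\<Pi>\<^sub>M i\<in>UNIV. borel) (\<lambda>\<omega> i. V i \<omega>) \<longrightarrow>
      (AE \<omega> in M. (\<lambda>i. (V i \<omega> * exp (- \<rho> * T i \<omega>)) *\<^sub>R v)
        summable_on {i. enat i < \<kappa> \<omega> \<and> 0 < T i \<omega>}) \<and>
      distr M borel W = distr M borel
        (\<lambda>\<omega>. \<Sum>\<^sub>\<infinity>i\<in>{i. enat i < \<kappa> \<omega> \<and> 0 < T i \<omega>}. (V i \<omega> * exp (- \<rho> * T i \<omega>)) *\<^sub>R v)) \<and>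
    (\<forall>s :: real^'d. (\<forall>j. 0 \<le> s $ j) \<longrightarrow>
      (let f = (\<lambda>x. - ln (\<integral>\<omega>. exp (- ((W0 \<omega> *\<^sub>R v) \<bullet> (exp (- \<rho> * x) *\<^sub>R s))) \<partial>M0)) in
        (\<integral>\<omega>. exp (- (W \<omega> \<bullet> s)) \<partial>M) =
        (\<integral>\<omega>. exp_neg (\<integral>\<^sup>+x\<in>{0<..}. ennreal (f x) \<partial>dirac_sum \<kappa> T \<omega>) \<partial>M)))"
proof -
  interpret M: prob_space M by (rule M)
  interpret mean_eigenvector \<mu> \<nu> \<rho> u
    by unfold_locales (use lifetime_pos u_pos offspring_integrable u_eigen in auto)
  have M0: "prob_space M0" and Z0_meas: "\<And>t. 0 \<le> t \<Longrightarrow> Z0 t \<in> measurable M0 (count_space UNIV)"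
    using Z0 by (auto simp: branching_process_def)
  have path0: "sample_path Z0 \<in> measurable M0 path_space"
    unfolding sample_path_def by (rule measurable_restrict) (simp add: Z0_meas)
  have pp: "point_process M \<kappa> T" using \<Phi> by (simp add: determinantal_process_def)
  have [measurable]: "\<kappa> \<in> measurable M (count_space UNIV)" "\<And>i. T i \<in> borel_measurable M"
    using pp by (auto simp: point_process_def)
  have atoms [measurable]: "atoms \<kappa> T \<in> measurable M atoms_space"
    using Z_indep_\<Phi> by (simp add: indep_rv_def)

  \<comment> \<open>Means of the population weighted with the eigenvector\<close>
  define lin :: "nat^'d \<Rightarrow> real" where "lin z = (\<Sum>j\<in>UNIV. real (z $ j) * u $ j)" for z
  have lin_nonneg: "0 \<le> lin z" for z
    unfolding lin_def by (intro sum_nonneg mult_nonneg_nonneg u_nonneg) simp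
  have lin_inner: "lin z = real_vec z \<bullet> u" for z
    by (simp add: lin_def inner_vec_def real_vec_def)
  define C0 where "C0 = (\<Sum>j\<in>UNIV. measure_pmf.expectation I (\<lambda>x. real (x $ j)) * u $ j)"
  have C0: "0 \<le> C0"
    unfolding C0_def by (intro sum_nonneg mult_nonneg_nonneg u_nonneg integral_nonneg_AE) simp
  have mean0: "(\<integral>\<^sup>+\<omega>. ennreal (lin (Z0 t \<omega>)) \<partial>M0) \<le> ennreal C0 * ennreal (exp (\<rho> * t))" if "0 \<le> t" for t
    using branching_process_mean_le[OF Z0 initial_integrable that] C0
    by (simp add: lin_def C0_def ennreal_mult' mult.commute)
  have path: "sample_path (Z i) \<in> measurable M path_space" for i
    using Z_copies by (rule process_copy_measurable)
  have mean: "(\<integral>\<^sup>+\<omega>. ennreal (lin (Z i t \<omega>)) \<partial>M) \<le> ennreal C0 * ennreal (exp (\<rho> * t))" if t: "0 \<le> t" for i t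
  proof -
    note ev = measurable_path_eval[OF t, of "\<lambda>z. ennreal (lin z)"]
    have "(\<integral>\<^sup>+\<omega>. ennreal (lin (Z i t \<omega>)) \<partial>M) = (\<integral>\<^sup>+x. ennreal (lin (x t)) \<partial>distr M path_space (sample_path (Z i)))"
      using t ev path[of i] by (subst nn_integral_distr) (auto simp: sample_path_def)
    also have "\<dots> = (\<integral>\<^sup>+x. ennreal (lin (x t)) \<partial>distr M0 path_space (sample_path Z0))"
      using Z_copies[of i] by (simp add: process_copy_def)
    also have "\<dots> = (\<integral>\<^sup>+\<omega>. ennreal (lin (Z0 t \<omega>)) \<partial>M0)"
      using t ev path0 by (subst nn_integral_distr) (auto simp: sample_path_def)
    finally show ?thesis using mean0[OF t] by simp
  qed
  \<comment> \<open>Each coordinate of \<open>z\<close> is at most \<open>lin z / u $ j\<close>, so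
    \<open>cn\<close> compares the Euclidean norm with the weighted size.\<close>
  define cn where "cn = (\<Sum>j\<in>UNIV. 1 / u $ j)"
  have cn: "0 \<le> cn" unfolding cn_def by (intro sum_nonneg) (simp add: u_nonneg)
  have norm_le: "norm (real_vec z) \<le> cn * lin z" for z :: "nat^'d"
  proof -
    have "norm (real_vec z) \<le> (\<Sum>j\<in>UNIV. \<bar>real_vec z $ j\<bar>)" by (rule norm_le_l1_cart)
    also have "\<dots> \<le> (\<Sum>j\<in>UNIV. (1 / u $ j) * lin z)"
    proof (intro sum_mono)
      fix j
      have "real (z $ j) * u $ j \<le> lin z"
        unfolding lin_def by (intro member_le_sum) (auto simp: u_nonneg)
      then show "\<bar>real_vec z $ j\<bar> \<le> (1 / u $ j) * lin z"
        using u_pos[of j] by (simp add: real_vec_def field_simps)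
    qed
    finally show ?thesis by (simp add: cn_def sum_distrib_right)
  qed

  \<comment> \<open>Sign and mean of the limit variable\<close>
  define D where "D = distr M0 borel W0"
  \<comment> \<open>Pairing with \<open>u\<close> isolates the scalar \<open>W0\<close>, because
    \<langle>v, u\<rangle> = 1. It is thus a limit of non-negative variables of mean at most
    \<open>C0\<close>, and Fatou's lemma bounds its mean by \<open>C0\<close>.\<close>
  have W0_lin: "AE \<omega> in M0. (\<lambda>n. exp (- \<rho> * real n) * lin (Z0 (real n) \<omega>)) \<longlonglongrightarrow> W0 \<omega>"
    using W0_limit
  proof eventually_elim
    case (elim \<omega>)
    have "(\<lambda>n. (exp (- \<rho> * real n) *\<^sub>R real_vec (Z0 (real n) \<omega>)) \<bullet> u) \<longlonglongrightarrow> (W0 \<omega> *\<^sub>R v) \<bullet> u"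
      by (intro tendsto_inner tendsto_const filterlim_compose[OF elim filterlim_real_sequentially])
    moreover have "v \<bullet> u = 1"
      using uv_norm by (simp add: inner_vec_def mult.commute)
    ultimately show ?case by (simp add: lin_inner)
  qed
  have W0_nonneg: "AE \<omega> in M0. 0 \<le> W0 \<omega>"
    using W0_lin by eventually_elim (rule LIMSEQ_le_const, auto simp: lin_nonneg)
  then have D_nonneg: "AE x in D. 0 \<le> x"
    unfolding D_def using W0_measurable by (subst AE_distr_iff) auto
  have "(\<integral>\<^sup>+x. ennreal \<bar>x\<bar> \<partial>D) = (\<integral>\<^sup>+\<omega>. ennreal \<bar>W0 \<omega>\<bar> \<partial>M0)"
    unfolding D_def using W0_measurable by (subst nn_integral_distr) auto
  also have "\<dots> = (\<integral>\<^sup>+\<omega>. liminf (\<lambda>n. ennreal (exp (- \<rho> * real n) * lin (Z0 (real n) \<omega>))) \<partial>M0)"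
    using W0_lin W0_nonneg
  proof (intro nn_integral_cong_AE, eventually_elim)
    case (elim \<omega>)
    from lim_imp_Liminf[OF _ tendsto_ennrealI[OF elim(3)]] elim(4) show ?case by simp
  qed
  also have "\<dots> \<le> liminf (\<lambda>n. \<integral>\<^sup>+\<omega>. ennreal (exp (- \<rho> * real n) * lin (Z0 (real n) \<omega>)) \<partial>M0)"
    by (intro nn_integral_liminf measurable_compose[OF Z0_meas]) auto
  also have "\<dots> \<le> ennreal C0"
  proof (intro Liminf_le always_eventually allI)
    fix n
    have "(\<integral>\<^sup>+\<omega>. ennreal (exp (- \<rho> * real n) * lin (Z0 (real n) \<omega>)) \<partial>M0) =
        ennreal (exp (- \<rho> * real n)) * (\<integral>\<^sup>+\<omega>. ennreal (lin (Z0 (real n) \<omega>)) \<partial>M0)"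
      unfolding ennreal_mult'[OF exp_ge_zero] by (intro nn_integral_cmult measurable_compose[OF Z0_meas]) auto
    also have "\<dots> \<le> ennreal (exp (- \<rho> * real n)) * (ennreal C0 * ennreal (exp (\<rho> * real n)))"
      by (intro mult_left_mono mean0) auto
    also have "\<dots> = ennreal C0"
      using C0 by (simp add: ennreal_mult[symmetric] mult.left_commute mult_exp_exp)
    finally show "(\<integral>\<^sup>+\<omega>. ennreal (exp (- \<rho> * real n) * lin (Z0 (real n) \<omega>)) \<partial>M0) \<le> ennreal C0" .
  qed simp
  finally have D_mean: "(\<integral>\<^sup>+x. ennreal \<bar>x\<bar> \<partial>D) < \<infinity>"
    using le_less_trans by force

  \<comment> \<open>Mean weights of the atoms\<close>
  define wt where "wt i \<omega> = atom_weight \<rho> i (atoms \<kappa> T \<omega>)" for i \<omega>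
  have wt_meas [measurable]: "wt i \<in> borel_measurable M" for i unfolding wt_def by measurable
  have wt: "wt i \<omega> = (if enat i < \<kappa> \<omega> \<and> 0 < T i \<omega> then exp (- \<rho> * T i \<omega>) else 0)" for i \<omega>
    by (simp add: wt_def atom_weight_atoms)
  have wt_nonneg: "0 \<le> wt i \<omega>" for i \<omega> by (simp add: wt)
  have "(\<Sum>i. \<integral>\<^sup>+\<omega>. ennreal (wt i \<omega>) \<partial>M) =
      (\<Sum>i. \<integral>\<^sup>+\<omega>. (if enat i < \<kappa> \<omega> then ennreal (exp (- \<rho> * T i \<omega>)) * indicator {0<..} (T i \<omega>) else 0) \<partial>M)"
    by (intro suminf_cong nn_integral_cong) (auto simp: wt)
  also have "\<dots> = (\<integral>\<^sup>+x. ennreal (exp (- \<rho> * x)) * indicator {0<..} x * ennreal (K x x) \<partial>\<Lambda>)"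
    by (rule determinantal_campbell[OF kernel \<Phi> M]) (intro measurable_restrict_space1, measurable)
  also have "\<dots> = (\<integral>\<^sup>+x\<in>{0<..}. ennreal (exp (- \<rho> * x) * K x x) \<partial>\<Lambda>)"
    unfolding ennreal_mult'[OF exp_ge_zero] by (simp only: mult_ac)
  finally have wt_sum: "(\<Sum>i. \<integral>\<^sup>+\<omega>. ennreal (wt i \<omega>) \<partial>M) < \<infinity>"
    using finite_integral by simp
  define m where "m i = enn2real (\<integral>\<^sup>+\<omega>. ennreal (wt i \<omega>) \<partial>M)" for i
  have "(\<integral>\<^sup>+\<omega>. ennreal (wt i \<omega>) \<partial>M) < \<infinity>" for i
    using wt_sum ennreal_suminf_lessD by blast
  then have m: "(\<integral>\<^sup>+\<omega>. ennreal (wt i \<omega>) \<partial>M) = ennreal (m i)" for i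
    by (simp add: m_def)
  have m_nonneg: "0 \<le> m i" for i by (simp add: m_def)
  have "(\<Sum>i. ennreal (m i)) \<noteq> top" using wt_sum unfolding m by simp
  then have m_summable: "summable m" by (rule summable_suminf_not_top[OF m_nonneg])

  \<comment> \<open>Growth limits as independent marks of the atoms\<close>
  define V where "V i \<omega> = growth_limit \<rho> v (sample_path (Z i) \<omega>)" for i \<omega>
  have V_meas [measurable]: "V i \<in> borel_measurable M" for i
    unfolding V_def using path by measurable
  note growth = process_copy_growth_limit[OF Z_copies path0 v_pos W0_measurable W0_limit]
  have V_law: "distr M borel (V i) = D" for i
    using growth(2)[of i] by (simp add: V_def[abs_def] D_def)
  have V_lim: "AE \<omega> in M. ((\<lambda>t. exp (- \<rho> * t) *\<^sub>R real_vec (Z i t \<omega>)) \<longlongrightarrow> V i \<omega> *\<^sub>R v) at_top" for i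
    using growth(1)[of i] by (simp add: V_def)
  have V_iid: "prob_space.indep_vars M (\<lambda>_. borel) V UNIV"
    unfolding V_def[abs_def] by (rule M.indep_vars_compose2[OF Z_indep]) simp
  have V_indep: "indep_rv M atoms_space (atoms \<kappa> T) (\<Pi>\<^sub>M i\<in>UNIV. borel) (\<lambda>\<omega> i. V i \<omega>)"
  proof -
    have "(\<lambda>x i. growth_limit \<rho> v (x i)) \<in> measurable (\<Pi>\<^sub>M i\<in>UNIV. path_space) (\<Pi>\<^sub>M i\<in>(UNIV::nat set). borel)"
      by (rule measurable_PiM_single') (auto simp: space_PiM)
    from indep_rv_compose[OF M Z_indep_\<Phi> this] show ?thesis by (simp add: V_def)
  qed
  \<comment> \<open>Stated for arbitrary marks, since it serves both the growth limits
    \<open>V\<close> and the marks given in the representation of the limit law.\<close>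
  have summ: "AE \<omega> in M. summable (\<lambda>i. norm (wt i \<omega> * U i \<omega>))"
    if "\<And>i. distr M borel (U i) = D"
      "indep_rv M atoms_space (atoms \<kappa> T) (\<Pi>\<^sub>M i\<in>UNIV. borel) (\<lambda>\<omega> i. U i \<omega>)" for U
    using AE_summable_marked_atoms[OF M that D_mean] wt_sum unfolding wt_def by blast

  define W where "W \<omega> = (\<Sum>i. wt i \<omega> * V i \<omega>) *\<^sub>R v" for \<omega>
  have W_meas [measurable]: "W \<in> borel_measurable M" unfolding W_def by measurable

  \<comment> \<open>Limits and mean bounds of the single summands\<close>
  define Y where "Y i t \<omega> = (if enat i < \<kappa> \<omega> \<and> 0 < T i \<omega> \<and> T i \<omega> \<le> t
    then exp (- \<rho> * t) *\<^sub>R real_vec (Z i (t - T i \<omega>) \<omega>) else 0)" for i t \<omega>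
  have Y_meas [measurable]: "Y i t \<in> borel_measurable M" for i t
  proof -
    \<comment> \<open>Wherever \<open>Y i t\<close> uses the age, the age is non-negative; the
      truncation only makes it a half-line valued function of \<omega>.\<close>
    have "(\<lambda>\<omega>. max 0 (t - T i \<omega>)) \<in> measurable M halfline"
      by (intro measurable_restrict_space2) auto
    from process_copy_measurable(1)[OF Z_copies[of i] measurable_ident this]
    have "(\<lambda>\<omega>. Z i (max 0 (t - T i \<omega>)) \<omega>) \<in> measurable M (count_space UNIV)" by simp
    from measurable_compose[OF this, of real_vec borel]
    have [measurable]: "(\<lambda>\<omega>. real_vec (Z i (max 0 (t - T i \<omega>)) \<omega>)) \<in> borel_measurable M" by simp
    have "(\<lambda>\<omega>. if enat i < \<kappa> \<omega> \<and> 0 < T i \<omega> \<and> T i \<omega> \<le> t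
      then exp (- \<rho> * t) *\<^sub>R real_vec (Z i (max 0 (t - T i \<omega>)) \<omega>) else 0) \<in> borel_measurable M"
      by measurable
    also have "(\<lambda>\<omega>. if enat i < \<kappa> \<omega> \<and> 0 < T i \<omega> \<and> T i \<omega> \<le> t
      then exp (- \<rho> * t) *\<^sub>R real_vec (Z i (max 0 (t - T i \<omega>)) \<omega>) else 0) = Y i t"
      by (auto simp: Y_def fun_eq_iff max_def)
    finally show ?thesis .
  qed
  have Y_lim: "AE \<omega> in M. ((\<lambda>t. Y i t \<omega>) \<longlongrightarrow> (wt i \<omega> * V i \<omega>) *\<^sub>R v) at_top" for i
    using V_lim[of i]
  proof eventually_elim
    case (elim \<omega>)
    show ?case
    proof (cases "enat i < \<kappa> \<omega> \<and> 0 < T i \<omega>")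
      case True
      have "LIM t at_top. t - T i \<omega> :> at_top"
        using filterlim_tendsto_add_at_top[OF tendsto_const filterlim_ident, of "- T i \<omega>"] by simp
      from tendsto_scaleR[OF tendsto_const filterlim_compose[OF elim this], of "exp (- \<rho> * T i \<omega>)"]
      have "((\<lambda>t. exp (- \<rho> * t) *\<^sub>R real_vec (Z i (t - T i \<omega>) \<omega>)) \<longlongrightarrow> (wt i \<omega> * V i \<omega>) *\<^sub>R v) at_top"
        using True by (simp add: wt mult_exp_exp algebra_simps)
      then show ?thesis
        by (rule Lim_transform_eventually)
          (use True in \<open>auto intro!: eventually_mono[OF eventually_ge_at_top[of "T i \<omega>"]] simp: Y_def\<close>)
    qed (auto simp: Y_def wt)
  qed
  \<comment> \<open>The discount exp (- \<rho> t) is that of the arrival time times that of the age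
    \<open>t - T i\<close>. The latter cancels the mean growth over the age, so the weight of the
    atom remains, independently of \<open>t\<close>. The constant collects \<open>cn\<close> from
    the norm, \<open>C0\<close> from the initial state and exp \<bar>\<rho>\<bar> from rounding the
    age.\<close>
  have Y_bound: "(\<integral>\<^sup>+\<omega>. ennreal (norm (Y i t \<omega>)) \<partial>M) \<le> ennreal (cn * C0 * exp \<bar>\<rho>\<bar> * m i)" for i t
  proof -
    define g where "g = (\<lambda>a :: enat \<times> (nat \<Rightarrow> real).
      ennreal (if enat i < fst a \<and> 0 < snd a i \<and> snd a i \<le> t then exp (- \<rho> * t) else 0))"
    define \<tau> where "\<tau> = (\<lambda>a :: enat \<times> (nat \<Rightarrow> real). t - snd a i)"
    have g_atoms: "g (atoms \<kappa> T \<omega>) =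
        ennreal (if enat i < \<kappa> \<omega> \<and> 0 < T i \<omega> \<and> T i \<omega> \<le> t then exp (- \<rho> * t) else 0)" for \<omega>
      by (simp add: g_def atoms_def)
    have \<tau>_atoms: "enat i < \<kappa> \<omega> \<Longrightarrow> \<tau> (atoms \<kappa> T \<omega>) = t - T i \<omega>" for \<omega>
      by (simp add: \<tau>_def atoms_def)
    have [measurable]: "g \<in> borel_measurable atoms_space" "\<tau> \<in> borel_measurable atoms_space"
      unfolding g_def \<tau>_def by measurable
    have ind: "indep_rv M atoms_space (atoms \<kappa> T) path_space (sample_path (Z i))"
      using indep_rv_compose[OF M Z_indep_\<Phi>, of "\<lambda>x. x i" path_space] by simp
    have "(\<integral>\<^sup>+\<omega>. ennreal (norm (Y i t \<omega>)) \<partial>M) \<le>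
        (\<integral>\<^sup>+\<omega>. g (atoms \<kappa> T \<omega>) * ennreal (cn * lin (Z i (\<tau> (atoms \<kappa> T \<omega>)) \<omega>)) \<partial>M)"
    proof (intro nn_integral_mono)
      fix \<omega>
      show "ennreal (norm (Y i t \<omega>)) \<le>
          g (atoms \<kappa> T \<omega>) * ennreal (cn * lin (Z i (\<tau> (atoms \<kappa> T \<omega>)) \<omega>))"
      proof (cases "enat i < \<kappa> \<omega> \<and> 0 < T i \<omega> \<and> T i \<omega> \<le> t")
        case True
        have "norm (Y i t \<omega>) \<le> exp (- \<rho> * t) * (cn * lin (Z i (t - T i \<omega>) \<omega>))"
          using True norm_le by (simp add: Y_def)
        then have "ennreal (norm (Y i t \<omega>)) \<le> ennreal (exp (- \<rho> * t) * (cn * lin (Z i (t - T i \<omega>) \<omega>)))"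
          by (rule ennreal_leI)
        also have "\<dots> = g (atoms \<kappa> T \<omega>) * ennreal (cn * lin (Z i (\<tau> (atoms \<kappa> T \<omega>)) \<omega>))"
          unfolding g_atoms using True by (simp add: \<tau>_atoms ennreal_mult')
        finally show ?thesis .
      qed (auto simp: Y_def)
    qed
    also have "\<dots> \<le> ennreal (cn * C0) * ennreal (exp \<bar>\<rho>\<bar>) *
        (\<integral>\<^sup>+\<omega>. g (atoms \<kappa> T \<omega>) * ennreal (exp (\<rho> * \<tau> (atoms \<kappa> T \<omega>))) \<partial>M)"
    proof (rule mean_at_independent_time[OF M Z_copies[of i] ind])
      show "0 \<le> cn * lin z" for z using cn lin_nonneg by simp
      show "(\<lambda>n. cn * lin (f n)) \<longlonglongrightarrow> cn * lin z" if "f \<longlonglongrightarrow> z" for f z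
        using tendsto_mult[OF tendsto_const tendsto_inner[OF real_vec_tendsto[OF that] tendsto_const], of cn u]
        by (simp add: lin_inner)
      show "(\<integral>\<^sup>+\<omega>. ennreal (cn * lin (Z i r \<omega>)) \<partial>M) \<le> ennreal (cn * C0) * ennreal (exp (\<rho> * r))" if "0 \<le> r" for r
      proof -
        have "(\<integral>\<^sup>+\<omega>. ennreal (cn * lin (Z i r \<omega>)) \<partial>M) = ennreal cn * (\<integral>\<^sup>+\<omega>. ennreal (lin (Z i r \<omega>)) \<partial>M)"
          unfolding ennreal_mult'[OF cn]
          by (intro nn_integral_cmult measurable_compose[OF process_copy_measurable(2)[OF Z_copies that]]) simp
        also have "\<dots> \<le> ennreal cn * (ennreal C0 * ennreal (exp (\<rho> * r)))"
          by (intro mult_left_mono mean that) simp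
        finally show ?thesis by (simp add: ennreal_mult'[OF cn] mult.assoc)
      qed
      show "0 \<le> \<tau> a" if "g a \<noteq> 0" for a
        using that by (auto simp: g_def \<tau>_def split: if_splits)
    qed (auto simp: g_def)
    also have "\<dots> \<le> ennreal (cn * C0) * ennreal (exp \<bar>\<rho>\<bar>) * (\<integral>\<^sup>+\<omega>. ennreal (wt i \<omega>) \<partial>M)"
    proof (intro mult_left_mono nn_integral_mono)
      fix \<omega>
      show "g (atoms \<kappa> T \<omega>) * ennreal (exp (\<rho> * \<tau> (atoms \<kappa> T \<omega>))) \<le> ennreal (wt i \<omega>)"
        unfolding g_atoms
        by (auto simp: \<tau>_atoms wt ennreal_mult[symmetric] mult_exp_exp algebra_simps intro!: ennreal_leI)
    qed simp
    also have "\<dots> = ennreal (cn * C0 * exp \<bar>\<rho>\<bar> * m i)"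
      using cn C0 m_nonneg by (simp add: m ennreal_mult)
    finally show ?thesis .
  qed
  have series: "((\<lambda>t. \<integral>\<omega>. min 1 (dist (\<Sum>i. Y i t \<omega>) (\<Sum>i. (wt i \<omega> * V i \<omega>) *\<^sub>R v)) \<partial>M) \<longlongrightarrow> 0) at_top"
    using C0 cn m_nonneg by (intro random_series_tendsto[OF M _ _ Y_lim Y_bound] summable_mult m_summable) auto

  \<comment> \<open>From the series of summands to the immigration process\<close>
  define S where "S t \<omega> = {i. enat i < \<kappa> \<omega> \<and> T i \<omega> \<in> {0<..t}}" for t \<omega>
  have immigration_S: "immigration_process \<kappa> T Z t \<omega> = (\<Sum>i\<in>S t \<omega>. real_vec (Z i (t - T i \<omega>) \<omega>))" for t \<omega>
    unfolding immigration_process_def S_def ..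
  \<comment> \<open>A finite sum over an infinite index set is 0 by convention. Reproducing this
    case makes the identity valid for every \<omega>, from which measurability of the immigration
    process follows without an exceptional set.\<close>
  have immigration: "immigration_process \<kappa> T Z t \<omega> /\<^sub>R exp (\<rho> * t) =
      (if finite (S t \<omega>) then \<Sum>i. Y i t \<omega> else 0)" for t \<omega>
  proof (cases "finite (S t \<omega>)")
    case True
    then have "(\<Sum>i. Y i t \<omega>) = (\<Sum>i\<in>S t \<omega>. Y i t \<omega>)"
      by (intro suminf_finite) (auto simp: S_def Y_def)
    also have "\<dots> = (\<Sum>i\<in>S t \<omega>. real_vec (Z i (t - T i \<omega>) \<omega>) /\<^sub>R exp (\<rho> * t))"
      by (intro sum.cong) (auto simp: S_def Y_def exp_minus)
    finally show ?thesis
      using True by (simp add: immigration_S scaleR_sum_right)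
  qed (simp add: immigration_S)
  have immigration_meas: "(\<lambda>\<omega>. immigration_process \<kappa> T Z t \<omega> /\<^sub>R exp (\<rho> * t)) \<in> borel_measurable M" for t
  proof -
    have [measurable]: "Measurable.pred M (\<lambda>\<omega>. i \<in> S t \<omega>)" for i
      unfolding S_def mem_Collect_eq greaterThanAtMost_iff by measurable
    show ?thesis unfolding immigration by measurable
  qed
  \<comment> \<open>An atom in (0, t] has weight at least exp (- \<rho> t) if \<rho> \<ge> 0 and at
    least 1 if \<rho> < 0, hence at least \<delta> in both cases. An almost surely summable sequence
    has only finitely many such terms.\<close>
  have finite_S: "AE \<omega> in M. \<forall>t. finite (S t \<omega>)"
  proof -
    have "AE \<omega> in M. summable (\<lambda>i. norm (wt i \<omega>))"
      using wt_sum by (intro AE_summable_norm) (auto simp: wt_nonneg)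
    then show ?thesis
    proof eventually_elim
      case (elim \<omega>)
      show ?case
      proof
        fix t
        define \<delta> where "\<delta> = min 1 (exp (- \<rho> * t))"
        have "(\<lambda>i. norm (wt i \<omega>)) \<longlonglongrightarrow> 0" by (rule summable_LIMSEQ_zero[OF elim])
        then have "\<forall>\<^sub>F i in sequentially. norm (wt i \<omega>) < \<delta>"
          by (rule order_tendstoD) (simp add: \<delta>_def)
        then obtain n where n: "\<And>i. n \<le> i \<Longrightarrow> wt i \<omega> < \<delta>"
          by (auto simp: eventually_sequentially wt_nonneg)
        have "S t \<omega> \<subseteq> {..<n}"
        proof
          fix i assume i: "i \<in> S t \<omega>"
          then have T: "0 < T i \<omega>" "T i \<omega> \<le> t" and w: "wt i \<omega> = exp (- \<rho> * T i \<omega>)"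
            by (auto simp: S_def wt)
          have "\<delta> \<le> wt i \<omega>"
          proof (cases "0 \<le> \<rho>")
            case True
            then have "\<rho> * T i \<omega> \<le> \<rho> * t" using T by (intro mult_left_mono) auto
            then show ?thesis by (simp add: w \<delta>_def min_le_iff_disj)
          next
            case False
            then have "\<rho> * T i \<omega> \<le> 0" using T by (intro mult_nonpos_nonneg) auto
            then show ?thesis by (simp add: w \<delta>_def min_le_iff_disj)
          qed
          then show "i \<in> {..<n}" using n[of i] by (auto simp: not_le[symmetric])
        qed
        then show "finite (S t \<omega>)" by (rule finite_subset) simp
      qed
    qed
  qed
  have conv: "converges_in_distribution M (\<lambda>t \<omega>. immigration_process \<kappa> T Z t \<omega> /\<^sub>R exp (\<rho> * t)) W at_top"
  proof (rule converges_in_distributionI_dist[OF M immigration_meas W_meas])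
    have "(\<integral>\<omega>. min 1 (dist (immigration_process \<kappa> T Z t \<omega> /\<^sub>R exp (\<rho> * t)) (W \<omega>)) \<partial>M) =
      (\<integral>\<omega>. min 1 (dist (\<Sum>i. Y i t \<omega>) (\<Sum>i. (wt i \<omega> * V i \<omega>) *\<^sub>R v)) \<partial>M)" for t
    proof (rule integral_cong_AE)
      show "AE \<omega> in M. min 1 (dist (immigration_process \<kappa> T Z t \<omega> /\<^sub>R exp (\<rho> * t)) (W \<omega>)) =
          min 1 (dist (\<Sum>i. Y i t \<omega>) (\<Sum>i. (wt i \<omega> * V i \<omega>) *\<^sub>R v))"
        using finite_S summ[OF V_law V_indep]
      proof eventually_elim
        case (elim \<omega>)
        have "(\<Sum>i. (wt i \<omega> * V i \<omega>) *\<^sub>R v) = W \<omega>"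
          unfolding W_def using summable_norm_cancel[OF elim(2)] by (rule suminf_scaleR_left[symmetric])
        with elim show ?case by (simp add: immigration)
      qed
    qed (use immigration_meas in measurable)
    with series show "((\<lambda>t. \<integral>\<omega>. min 1 (dist (immigration_process \<kappa> T Z t \<omega> /\<^sub>R exp (\<rho> * t)) (W \<omega>)) \<partial>M) \<longlongrightarrow> 0) at_top"
      by simp
  qed

  \<comment> \<open>Representation by arbitrary independent marks\<close>
  have v0: "v \<noteq> 0" using v_pos[of undefined] by (metis less_irrefl zero_index)
  have representation: "(AE \<omega> in M. (\<lambda>i. (U i \<omega> * exp (- \<rho> * T i \<omega>)) *\<^sub>R v)
        summable_on {i. enat i < \<kappa> \<omega> \<and> 0 < T i \<omega>}) \<and>
      distr M borel W = distr M borel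
        (\<lambda>\<omega>. \<Sum>\<^sub>\<infinity>i\<in>{i. enat i < \<kappa> \<omega> \<and> 0 < T i \<omega>}. (U i \<omega> * exp (- \<rho> * T i \<omega>)) *\<^sub>R v)"
    if U: "\<And>i. distr M borel (U i) = distr M0 borel W0" "prob_space.indep_vars M (\<lambda>_. borel) U UNIV"
      "indep_rv M atoms_space (atoms \<kappa> T) (\<Pi>\<^sub>M i\<in>UNIV. borel) (\<lambda>\<omega> i. U i \<omega>)" for U :: "nat \<Rightarrow> 'a \<Rightarrow> real"
  proof
    have U_law: "distr M borel (U i) = D" for i using U(1) by (simp add: D_def)
    have [measurable]: "U i \<in> borel_measurable M" for i
      using U(2) by (simp add: M.indep_vars_def)
    have sum_on: "(\<lambda>i. (U i \<omega> * exp (- \<rho> * T i \<omega>)) *\<^sub>R v) summable_on {i. enat i < \<kappa> \<omega> \<and> 0 < T i \<omega>} \<longleftrightarrow>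
        (\<lambda>i. (wt i \<omega> * U i \<omega>) *\<^sub>R v) summable_on UNIV" for \<omega>
      by (rule summable_on_cong_neutral) (auto simp: wt)
    have inf: "(\<Sum>\<^sub>\<infinity>i\<in>{i. enat i < \<kappa> \<omega> \<and> 0 < T i \<omega>}. (U i \<omega> * exp (- \<rho> * T i \<omega>)) *\<^sub>R v) =
        (\<Sum>\<^sub>\<infinity>i. (wt i \<omega> * U i \<omega>) *\<^sub>R v)" for \<omega>
      by (rule infsum_cong_neutral) (auto simp: wt)
    note summ_U = summ[OF U_law U(3)]
    show "AE \<omega> in M. (\<lambda>i. (U i \<omega> * exp (- \<rho> * T i \<omega>)) *\<^sub>R v) summable_on {i. enat i < \<kappa> \<omega> \<and> 0 < T i \<omega>}"
      unfolding sum_on summable_on_scaleR_iff[OF v0] by (rule summ_U)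
    \<comment> \<open>Both series have the law of the same function on the product of the law of the
      atoms with the infinite power of \<open>D\<close>.\<close>
    have "distr M borel W = distr M borel (\<lambda>\<omega>. (\<Sum>i. wt i \<omega> * U i \<omega>) *\<^sub>R v)"
      unfolding W_def[abs_def] wt_def
      using marked_series_law[OF M V_law V_iid V_indep, of \<rho> v] marked_series_law[OF M U_law U(2,3), of \<rho> v]
      by simp
    also have "\<dots> = distr M borel (\<lambda>\<omega>. \<Sum>\<^sub>\<infinity>i. (wt i \<omega> * U i \<omega>) *\<^sub>R v)"
    proof (rule distr_cong_AE)
      show "AE \<omega> in M. (\<Sum>i. wt i \<omega> * U i \<omega>) *\<^sub>R v = (\<Sum>\<^sub>\<infinity>i. (wt i \<omega> * U i \<omega>) *\<^sub>R v)"
        using summ_U by eventually_elim (simp add: infsum_scaleR_eq_suminf[OF v0])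
      have "Measurable.pred M (\<lambda>\<omega>. summable (\<lambda>i. norm (wt i \<omega> * U i \<omega>)))"
        unfolding summable_norm_iff_suminf_ennreal by measurable
      then show "(\<lambda>\<omega>. \<Sum>\<^sub>\<infinity>i. (wt i \<omega> * U i \<omega>) *\<^sub>R v) \<in> borel_measurable M"
        unfolding infsum_scaleR_eq_suminf[OF v0] by measurable
    qed auto
    finally show "distr M borel W = distr M borel
        (\<lambda>\<omega>. \<Sum>\<^sub>\<infinity>i\<in>{i. enat i < \<kappa> \<omega> \<and> 0 < T i \<omega>}. (U i \<omega> * exp (- \<rho> * T i \<omega>)) *\<^sub>R v)"
      unfolding inf .
  qed

  \<comment> \<open>The Laplace transform of the limit\<close>
  have laplace: "let f = (\<lambda>x. - ln (\<integral>\<omega>. exp (- ((W0 \<omega> *\<^sub>R v) \<bullet> (exp (- \<rho> * x) *\<^sub>R s))) \<partial>M0)) in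
        (\<integral>\<omega>. exp (- (W \<omega> \<bullet> s)) \<partial>M) =
        (\<integral>\<omega>. exp_neg (\<integral>\<^sup>+x\<in>{0<..}. ennreal (f x) \<partial>dirac_sum \<kappa> T \<omega>) \<partial>M)"
    if s: "\<forall>j. 0 \<le> s $ j" for s :: "real^'d"
  proof -
    \<comment> \<open>All limits are multiples of \<open>v\<close>, so the vector \<open>s\<close>
      enters only through its product with \<open>v\<close>, which is non-negative.\<close>
    define c where "c = v \<bullet> s"
    have c: "0 \<le> c"
      unfolding c_def inner_vec_def using s v_pos by (auto intro!: sum_nonneg simp: less_imp_le)
    define L where "L r = (\<integral>x. exp (- (r * x)) \<partial>D)" for r
    interpret W0: prob_space M0 by (rule M0)
    interpret D: prob_space D unfolding D_def by (rule W0.prob_space_distr) (rule W0_measurable)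
    have [measurable_cong]: "sets D = sets borel" by (simp add: D_def)
    have [measurable]: "L \<in> borel_measurable borel" unfolding L_def by measurable
    have f: "(\<integral>\<omega>. exp (- ((W0 \<omega> *\<^sub>R v) \<bullet> (exp (- \<rho> * x) *\<^sub>R s))) \<partial>M0) = L (c * exp (- \<rho> * x))" for x
      unfolding L_def D_def c_def using W0_measurable
      by (subst integral_distr) (auto simp: mult_ac)
    \<comment> \<open>Indices of weight 0 contribute - ln 1 = 0, so the series over all indices is
      the integral over the atoms in (0, \<infinity>).\<close>
    have L0: "L 0 = 1" by (simp add: L_def D.prob_space)
    have "(\<integral>\<omega>. exp (- (W \<omega> \<bullet> s)) \<partial>M) = (\<integral>\<omega>. exp (- (c * (\<Sum>i. wt i \<omega> * V i \<omega>))) \<partial>M)"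
      by (simp add: W_def c_def mult.commute)
    also have "\<dots> = (\<integral>\<omega>. exp_neg (\<Sum>i. ennreal (- ln (L (c * wt i \<omega>)))) \<partial>M)"
      unfolding wt_def L_def
      by (rule marked_series_laplace[OF M V_law V_iid V_indep D_nonneg c])
        (use summ[OF V_law V_indep] in \<open>simp add: wt_def\<close>)
    also have "\<dots> = (\<integral>\<omega>. exp_neg (\<integral>\<^sup>+x\<in>{0<..}. ennreal (- ln (L (c * exp (- \<rho> * x)))) \<partial>dirac_sum \<kappa> T \<omega>) \<partial>M)"
    proof (intro Bochner_Integration.integral_cong refl arg_cong[where f=exp_neg])
      fix \<omega> assume \<omega>: "\<omega> \<in> space M"
      have "(\<integral>\<^sup>+x\<in>{0<..}. ennreal (- ln (L (c * exp (- \<rho> * x)))) \<partial>dirac_sum \<kappa> T \<omega>) =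
          (\<Sum>i. if enat i < \<kappa> \<omega> then ennreal (- ln (L (c * exp (- \<rho> * T i \<omega>)))) * indicator {0<..} (T i \<omega>) else 0)"
        by (rule nn_integral_dirac_sum[OF pp \<omega>]) (intro measurable_restrict_space1, measurable)
      also have "\<dots> = (\<Sum>i. ennreal (- ln (L (c * wt i \<omega>))))"
        by (intro suminf_cong) (auto simp: wt L0)
      finally show "(\<Sum>i. ennreal (- ln (L (c * wt i \<omega>)))) =
          (\<integral>\<^sup>+x\<in>{0<..}. ennreal (- ln (L (c * exp (- \<rho> * x)))) \<partial>dirac_sum \<kappa> T \<omega>)" by simp
    qed
    finally show ?thesis unfolding f Let_def .
  qed
  show ?thesis
    using W_meas conv representation laplace by (intro exI[of _ W] conjI allI impI) blast+
qed

end
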